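(* Assume model $\mathcal M_{\mathrm s}$ and $\alpha\in(0,1]$. Define, for $\mathbb T=(T_1,\dots,T_K)\in\mathcal T$, $\mathrm{RL}_t(\mathbb T)=\sum_{k=1}^K\min(T_k,\tau_k,t)$ and $\mathrm{CD}_t(\mathbb T)=K-|S_t|$. Then for all $t\ge1$, $$\mathbb E(\mathrm{RL}_t(\mathbb T^* ))=\sup_{\mathbb T\in\mathcal T_\alpha}\mathbb E(\mathrm{RL}_t(\mathbb T))\quad\text{and}\quad\mathbb E(\mathrm{CD}_t(\mathbb T^* ))=\inf_{\mathbb T\in\mathcal T_\alpha}\mathbb E(\mathrm{CD}_t(\mathbb T)).$$
   Context: There are $K\ge1$ data streams. Each stream $k$ has a change point $\tau_k\in\{0,1,2,\dots\}\cup\{\infty\}$. Observations $X_{k,t}$ ($1\le k\le K$, $t=1,2,\dots$) are, conditionally on $(\tau_1,\dots,\tau_K)$, independent over $k$ and $t$, with $X_{k,t}$ having density $p_{k,t}$ if $t\le\tau_k$ and $q_{k,t}$ if $t>\tau_k$ with respect to a baseline measure $\mu$. Model $\mathcal M_{\mathrm s}$: $\tau_1,\dots,\tau_K$ are i.i.d. with $\mathbb P(\tau_k=m)=\theta(1-\theta)^m$, $m=0,1,2,\dots$, for some $\theta\in(0,1)$, and $p_{k,t}=p$, $q_{k,t}=q$ for all $k,t$. A compound sequential detection procedure consists of index sets $S_1=\{1,\dots,K\}\supseteq S_2\supseteq\cdots$ and a filtration defined inductively by $\mathcal F_1=\sigma(X_{k,1}:1\le k\le K)$ and $\mathcal F_t=\sigma(\mathcal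 F_{t-1},S_t,X_{k,t}:k\in S_t)$ for $t>1$, where $S_t$ is required to be $\mathcal F_{t-1}$-measurable; equivalently $\mathbb T=(T_1,\dots,T_K)$ with $T_k=\sup\{t:k\in S_t\}$. $\mathcal T$ is the set of all such procedures. For $t\ge1$, $\mathrm{FNP}_{t+1}(\mathbb T)=\sum_{k\in S_{t+1}}\mathbf 1(\tau_k<t)/(|S_{t+1}|\vee1)$, $\mathrm{LFNR}_{t+1}(\mathbb T)=\mathbb E(\mathrm{FNP}_{t+1}(\mathbb T)\mid\mathcal F_t)$, $\mathrm{LFNR}_1(\mathbb T)=0$. $\mathcal T_\alpha=\{\mathbb T\in\mathcal T:\mathrm{LFNR}_t(\mathbb T)\le\alpha\text{ a.s. for all }t\ge1\}$. Posterior probabilities: $W_{k,t}=\mathbb P(\tau_k<t\mid\mathcal F_t)$. One-step update rule: given $\alpha$, $S_t$ and $(W_{k,t})_{k\in S_t}$, write $S_t=\{k_1,\dots,k_m\}$ ordered so that $W_{k_1,t}\le\cdots\le W_{k_m,t}$, ties broken so that $k_i<k_{i+1}$ when $W_{k_i,t}=W_{k_{i+1},t}$; set $R_0=0$ and $R_n=\frac1n\sum_{i=1}^nW_{k_i,t}$; let $n$ be the largest element of $\{0,\dots,m\}$ with $R_n\le\alpha$; output $S_{t+1}=\{k_1,\dots,k_n\}$ ($\emptyset$ if $n=0$). The proposed procedure $\mathbb T^*$: $S_1=\{1,\dots,K\}$ and, for every $t\ge1$, $S_{t+1}$ is the output of the one-step update rule applied to $\alpha$, $S_t$ and $(W_{k,t})_{k\in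 S_t}$. *)

theory Defs
  imports "HOL-Probability.Probability"
begin

text \<open>Streams are indexed by k in {0..<K} (paper: 1..K); times t are 1,2,...
  Observations X k t : 'w => 'a, change points tau k : 'w => enat.\<close>

text \<open>Model M_s: finite-dimensional joint law of (tau, X) on the probability space M.
  Conditionally on tau, the X k t are independent with density p (t <= tau k) or q (t > tau k)
  w.r.t. mu, and the tau k are i.i.d. geometric(theta).\<close>
definition model_s ::
  "'w measure \<Rightarrow> nat \<Rightarrow> real \<Rightarrow> 'a measure \<Rightarrow> ('a \<Rightarrow> real) \<Rightarrow> ('a \<Rightarrow> real)
   \<Rightarrow> (nat \<Rightarrow> 'w \<Rightarrow> enat) \<Rightarrow> (nat \<Rightarrow> nat \<Rightarrow> 'w \<Rightarrow> 'a) \<Rightarrow> bool" where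
  "model_s M K \<theta> \<mu> p q \<tau> X \<longleftrightarrow>
     prob_space M \<and> 0 < \<theta> \<and> \<theta> < 1 \<and>
     p \<in> borel_measurable \<mu> \<and> q \<in> borel_measurable \<mu> \<and>
     (\<forall>x\<in>space \<mu>. 0 \<le> p x \<and> 0 \<le> q x) \<and>
     (\<integral>\<^sup>+ x. ennreal (p x) \<partial>\<mu>) = 1 \<and> (\<integral>\<^sup>+ x. ennreal (q x) \<partial>\<mu>) = 1 \<and>
     (\<forall>k. \<tau> k \<in> measurable M (count_space UNIV)) \<and>
     (\<forall>k t. X k t \<in> measurable M \<mu>) \<and>
     (\<forall>(m::nat \<Rightarrow> nat) F (B::nat \<times> nat \<Rightarrow> 'a set).
        finite F \<longrightarrow> F \<subseteq> {(k, t). k < K \<and> 1 \<le> t} \<longrightarrow> B ` F \<subseteq> sets \<mu> \<longrightarrow>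
        emeasure M {\<omega> \<in> space M. (\<forall>k<K. \<tau> k \<omega> = enat (m k)) \<and>
                                   (\<forall>(k, t)\<in>F. X k t \<omega> \<in> B (k, t))}
        = (\<Prod>k<K. ennreal (\<theta> * (1 - \<theta>) ^ m k)) *
          (\<Prod>(k, t)\<in>F. \<integral>\<^sup>+ x \<in> B (k, t). ennreal (if t \<le> m k then p x else q x) \<partial>\<mu>))"

text \<open>The filtration F_t generated by a sequence of index sets S (S t for t >= 1):
  F_0 trivial, F_t = sigma(F_{t-1}, S_t, X_{k,t} : k in S_t).  Since S_1 = {0..<K} for
  procedures, F_1 = sigma(X_{k,1} : k < K).\<close>
primrec filt :: "'w measure \<Rightarrow> 'a measure \<Rightarrow> (nat \<Rightarrow> nat \<Rightarrow> 'w \<Rightarrow> 'a)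
    \<Rightarrow> (nat \<Rightarrow> 'w \<Rightarrow> nat set) \<Rightarrow> nat \<Rightarrow> 'w measure" where
  "filt M \<mu> X S 0 = sigma (space M) {}"
| "filt M \<mu> X S (Suc t) = sigma (space M)
     (sets (filt M \<mu> X S t)
      \<union> {{\<omega> \<in> space M. S (Suc t) \<omega> = A} | A. True}
      \<union> {{\<omega> \<in> space M. k \<in> S (Suc t) \<omega> \<and> X k (Suc t) \<omega> \<in> B} | k B. B \<in> sets \<mu>})"

definition procedures :: "'w measure \<Rightarrow> 'a measure \<Rightarrow> nat \<Rightarrow> (nat \<Rightarrow> nat \<Rightarrow> 'w \<Rightarrow> 'a)
    \<Rightarrow> (nat \<Rightarrow> 'w \<Rightarrow> nat set) set" where
  "procedures M \<mu> K X = {S.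
     (\<forall>\<omega>\<in>space M. S 1 \<omega> = {..<K}) \<and>
     (\<forall>t\<ge>1. \<forall>\<omega>\<in>space M. S (Suc t) \<omega> \<subseteq> S t \<omega>) \<and>
     (\<forall>t\<ge>1. \<forall>A. {\<omega> \<in> space M. S (Suc t) \<omega> = A} \<in> sets (filt M \<mu> X S t))}"

definition FNP :: "(nat \<Rightarrow> 'w \<Rightarrow> enat) \<Rightarrow> (nat \<Rightarrow> 'w \<Rightarrow> nat set) \<Rightarrow> nat \<Rightarrow> 'w \<Rightarrow> real" where
  "FNP \<tau> S t \<omega> =
     (\<Sum>k\<in>S (Suc t) \<omega>. indicator {\<omega>'. \<tau> k \<omega>' < enat t} \<omega>) / real (max (card (S (Suc t) \<omega>)) 1)"

text \<open>LFNR_{t+1} = E(FNP_{t+1} | F_t).\<close>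
definition LFNR :: "'w measure \<Rightarrow> 'a measure \<Rightarrow> (nat \<Rightarrow> nat \<Rightarrow> 'w \<Rightarrow> 'a) \<Rightarrow> (nat \<Rightarrow> 'w \<Rightarrow> enat)
    \<Rightarrow> (nat \<Rightarrow> 'w \<Rightarrow> nat set) \<Rightarrow> nat \<Rightarrow> 'w \<Rightarrow> real" where
  "LFNR M \<mu> X \<tau> S t = real_cond_exp M (filt M \<mu> X S t) (FNP \<tau> S t)"

text \<open>The class \<T>_alpha (LFNR_1 = 0 <= alpha holds trivially).\<close>
definition procedures_alpha :: "'w measure \<Rightarrow> 'a measure \<Rightarrow> nat \<Rightarrow> (nat \<Rightarrow> nat \<Rightarrow> 'w \<Rightarrow> 'a)
    \<Rightarrow> (nat \<Rightarrow> 'w \<Rightarrow> enat) \<Rightarrow> real \<Rightarrow> (nat \<Rightarrow> 'w \<Rightarrow> nat set) set" where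
  "procedures_alpha M \<mu> K X \<tau> \<alpha> = {S \<in> procedures M \<mu> K X.
     \<forall>t\<ge>1. AE \<omega> in M. LFNR M \<mu> X \<tau> S t \<omega> \<le> \<alpha>}"

definition post :: "'w measure \<Rightarrow> 'a measure \<Rightarrow> (nat \<Rightarrow> nat \<Rightarrow> 'w \<Rightarrow> 'a) \<Rightarrow> (nat \<Rightarrow> 'w \<Rightarrow> enat)
    \<Rightarrow> (nat \<Rightarrow> 'w \<Rightarrow> nat set) \<Rightarrow> nat \<Rightarrow> nat \<Rightarrow> 'w \<Rightarrow> real" where
  "post M \<mu> X \<tau> S k t = real_cond_exp M (filt M \<mu> X S t) (indicator {\<omega>. \<tau> k \<omega> < enat t})"

definition update :: "real \<Rightarrow> nat set \<Rightarrow> (nat \<Rightarrow> real) \<Rightarrow> nat set" where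
  "update \<alpha> S W =
     (let ks = (THE ks. distinct ks \<and> set ks = S \<and>
                  sorted_wrt (\<lambda>i j. W i < W j \<or> (W i = W j \<and> i < j)) ks);
          R = (\<lambda>n. sum_list (map W (take n ks)) / real n);
          n = Max {n. n \<le> length ks \<and> R n \<le> \<alpha>}
      in set (take n ks))"

text \<open>Construction of T*: tstar_aux n agrees with T* at times 1..n+1.\<close>
primrec tstar_aux :: "'w measure \<Rightarrow> 'a measure \<Rightarrow> nat \<Rightarrow> (nat \<Rightarrow> nat \<Rightarrow> 'w \<Rightarrow> 'a)
    \<Rightarrow> (nat \<Rightarrow> 'w \<Rightarrow> enat) \<Rightarrow> real \<Rightarrow> nat \<Rightarrow> (nat \<Rightarrow> 'w \<Rightarrow> nat set)" where
  "tstar_aux M \<mu> K X \<tau> \<alpha> 0 = (\<lambda>s \<omega>. {..<K})"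
| "tstar_aux M \<mu> K X \<tau> \<alpha> (Suc n) =
     (let S = tstar_aux M \<mu> K X \<tau> \<alpha> n
      in S(Suc (Suc n) := (\<lambda>\<omega>. update \<alpha> (S (Suc n) \<omega>) (\<lambda>k. post M \<mu> X \<tau> S k (Suc n) \<omega>))))"

definition tstar :: "'w measure \<Rightarrow> 'a measure \<Rightarrow> nat \<Rightarrow> (nat \<Rightarrow> nat \<Rightarrow> 'w \<Rightarrow> 'a)
    \<Rightarrow> (nat \<Rightarrow> 'w \<Rightarrow> enat) \<Rightarrow> real \<Rightarrow> nat \<Rightarrow> 'w \<Rightarrow> nat set" where
  "tstar M \<mu> K X \<tau> \<alpha> t = tstar_aux M \<mu> K X \<tau> \<alpha> t t"

definition stop_time :: "(nat \<Rightarrow> 'w \<Rightarrow> nat set) \<Rightarrow> nat \<Rightarrow> 'w \<Rightarrow> enat" where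
  "stop_time S k \<omega> = Sup {enat s | s. 1 \<le> s \<and> k \<in> S s \<omega>}"

definition RL :: "nat \<Rightarrow> (nat \<Rightarrow> 'w \<Rightarrow> enat) \<Rightarrow> (nat \<Rightarrow> 'w \<Rightarrow> nat set) \<Rightarrow> nat \<Rightarrow> 'w \<Rightarrow> real" where
  "RL K \<tau> S t \<omega> = (\<Sum>k<K. real (the_enat (min (min (stop_time S k \<omega>) (\<tau> k \<omega>)) (enat t))))"

definition CD :: "nat \<Rightarrow> (nat \<Rightarrow> 'w \<Rightarrow> nat set) \<Rightarrow> nat \<Rightarrow> 'w \<Rightarrow> real" where
  "CD K S t \<omega> = real K - real (card (S t \<omega>))"

end

theory Submission
  imports Defs
begin

text \<open>
  Work with the full filtration of all observations. The posterior probability \<open>v\<close> that a stream has not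
  yet changed evolves, independently over streams, as a Markov chain whose one-step kernel depends only on
  \<open>v\<close>, and on the active streams it coincides with the posterior given the (smaller) filtration of the
  procedure. The constraint on the local false non-discovery rate says that the chosen set is feasible:
  the average of \<open>1 - v\<close> over it is at most \<open>\<alpha>\<close>. Both criteria are, time by time, expectations of
  \<open>\<Sum>k\<in>S (Suc n). c (v k)\<close> with \<open>c\<close> isotone, so they are bounded by the value of a dynamic programme whose
  value function is monotone in the active set, symmetric in the streams and, by a monotone likelihood ratio
  argument, isotone in \<open>v\<close>. The greedy update selects a feasible set of maximal cardinality consisting of
  the streams with the largest \<open>v\<close>; an exchange argument shows that it dominates every feasible choice in
  the value function. Hence it attains the value of the programme at every step.
\<close>

section \<open>The greedy update\<close>

text \<open>Optimality at one time could conflict with optimality at another. It does not, because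
  the exchange argument uses of the terminal reward \<open>c\<close> only that it is isotone and
  finite: one greedy rule, which knows neither the horizon nor the reward, is optimal for all of
  them. The run length is a sum over times of rewards with \<open>c v = (1 - \<theta>) * v\<close>,
  the chance that a stream survives one more period; the number of active streams is the case
  \<open>c v = 1\<close>. The obstacle is that different procedures generate different
  sigma-algebras. Letting every stream run on, observed or not, gives one chain common to all
  procedures, each of which merely selects nested sets of its coordinates. Nothing is gained by this
  extra information, since the state of a dropped stream never enters again; isotonicity restricted
  to the active set expresses exactly that. Bayes' rule and the Markov property are stated as
  identities of integrals against test functions, so that regular conditional distributions do not
  occur.\<close>

lemma sum_le_sum_exchange:
  fixes W :: "'a \<Rightarrow> real"
  assumes "finite A" "finite B" and card: "card B = card A"
    and le: "\<And>x y. x \<in> B - A \<Longrightarrow> y \<in> A - B \<Longrightarrow> W x \<le> W y"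
  shows "sum W B \<le> sum W A"
proof -
  have fin: "finite (B - A)" "finite (A - B)" using assms by auto
  have c: "card (B - A) = card (A - B)"
    using assms card_Diff_subset_Int[of B A] card_Diff_subset_Int[of A B] by (simp add: Int_commute)
  have "sum W (B - A) \<le> sum W (A - B)"
  proof (cases "B - A = {}")
    case True
    then have "A - B = {}" using c fin by (metis card_0_eq card.empty)
    then show ?thesis using True by (metis order_refl)
  next
    case False
    define m where "m = Max (W ` (B - A))"
    have "sum W (B - A) \<le> real (card (B - A)) * m"
      by (rule sum_bounded_above) (simp add: m_def fin)
    also have "\<dots> = real (card (A - B)) * m" using c by simp
    also have "\<dots> \<le> sum W (A - B)"
    proof (rule sum_bounded_below)
      fix y assume "y \<in> A - B"
      then show "m \<le> W y" unfolding m_def using fin False le by (subst Max_le_iff) auto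
    qed
    finally show ?thesis .
  qed
  moreover have "sum W B = sum W (B \<inter> A) + sum W (B - A)"
    using assms(2) by (metis sum.Int_Diff)
  moreover have "sum W A = sum W (B \<inter> A) + sum W (A - B)"
    using assms(1) by (metis sum.Int_Diff Int_commute)
  ultimately show ?thesis by simp
qed

abbreviation rank_less :: "(nat \<Rightarrow> real) \<Rightarrow> nat \<Rightarrow> nat \<Rightarrow> bool" where
  "rank_less W i j \<equiv> W i < W j \<or> (W i = W j \<and> i < j)"

text \<open>Breaking ties by index makes \<open>rank_less W\<close> a strict linear order, so the
  \<open>THE\<close> in \<open>update\<close> is well defined.\<close>

lemma ex1_ranking:
  assumes "finite S"
  shows "\<exists>!ks. distinct ks \<and> set ks = S \<and> sorted_wrt (rank_less W) ks"
proof -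
  interpret L: linorder "\<lambda>i j. rank_less W i j \<or> i = j" "rank_less W"
    by unfold_locales auto
  show ?thesis
  proof (rule ex_ex1I)
    show "\<exists>ks. distinct ks \<and> set ks = S \<and> sorted_wrt (rank_less W) ks"
      using assms L.distinct_sorted_list_of_set L.set_sorted_list_of_set L.strict_sorted_list_of_set
      by blast
    show "ks = ks'" if "distinct ks \<and> set ks = S \<and> sorted_wrt (rank_less W) ks"
      "distinct ks' \<and> set ks' = S \<and> sorted_wrt (rank_less W) ks'" for ks ks'
      using that L.strict_sorted_equal[of ks ks'] by auto
  qed
qed

text \<open>A description of the update without lists. Maximality is demanded among all feasible
  subsets, not just among initial segments of the ranking; the exchange argument needs this stronger
  form. As a finite combination of inequalities between the \<open>W k\<close> the predicate is
  visibly measurable.\<close>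

definition greedy :: "real \<Rightarrow> nat set \<Rightarrow> (nat \<Rightarrow> real) \<Rightarrow> nat set \<Rightarrow> bool" where
  "greedy \<alpha> S W B \<longleftrightarrow> B \<subseteq> S \<and> (\<forall>b\<in>B. \<forall>x\<in>S - B. rank_less W b x) \<and> sum W B \<le> \<alpha> * real (card B)
     \<and> (\<forall>A\<in>Pow S. sum W A \<le> \<alpha> * real (card A) \<longrightarrow> card A \<le> card B)"

text \<open>A feasible \<open>A\<close> competes with the initial segment of the same size, whose
  sum is smallest; so that segment is feasible too, and \<open>card A\<close> is among the lengths
  over which the update maximises.\<close>

lemma greedy_update:
  assumes S: "finite S" and a: "0 \<le> \<alpha>"
  shows "greedy \<alpha> S W (update \<alpha> S W)"
proof -
  define ks where "ks = (THE ks. distinct ks \<and> set ks = S \<and> sorted_wrt (rank_less W) ks)"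
  have ks: "distinct ks" "set ks = S" "sorted_wrt (rank_less W) ks"
    using theI'[OF ex1_ranking[OF S, of W]] unfolding ks_def by auto
  define R where "R = (\<lambda>n. sum_list (map W (take n ks)) / real n)"
  define N where "N = {n. n \<le> length ks \<and> R n \<le> \<alpha>}"
  define n where "n = Max N"
  define B where "B = set (take n ks)"
  have upd: "update \<alpha> S W = B"
    unfolding update_def Let_def B_def n_def N_def R_def ks_def by simp
  have finN: "finite N" unfolding N_def by (rule finite_subset[of _ "{..length ks}"]) auto
  \<comment> \<open>Here \<open>R 0 = 0 / 0 = 0\<close>, in agreement with the convention for the
    empty selection.\<close>
  have "0 \<in> N" using a by (simp add: N_def R_def)
  then have nN: "n \<in> N" unfolding n_def using finN by (intro Max_in) auto
  have sumlist: "sum_list (map W (take m ks)) = sum W (set (take m ks))" for m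
    using ks(1) by (simp add: sum_list_distinct_conv_sum_set)
  have cardm: "card (set (take m ks)) = m" if "m \<le> length ks" for m
    using ks(1) that by (simp add: distinct_card)
  have seg: "rank_less W b x" if "b \<in> set (take m ks)" "x \<in> S - set (take m ks)" for m b x
  proof -
    have "x \<in> set (drop m ks)" using that ks(2) by (metis DiffE UnE append_take_drop_id set_append)
    moreover have "sorted_wrt (rank_less W) (take m ks @ drop m ks)" using ks(3) by simp
    ultimately show ?thesis using that(1) unfolding sorted_wrt_append by blast
  qed
  have cB: "card B = n" using nN cardm by (simp add: B_def N_def)
  have "sum W B \<le> \<alpha> * real (card B)"
  proof (cases "n = 0")
    case True then show ?thesis by (simp add: B_def)
  next
    case False
    then show ?thesis using nN unfolding cB by (simp add: N_def R_def sumlist B_def field_simps)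
  qed
  moreover have "card A \<le> n" if "A \<subseteq> S" "sum W A \<le> \<alpha> * real (card A)" for A
  proof (cases "card A = 0")
    case False
    have le: "card A \<le> length ks" using that(1) S ks by (metis card_mono distinct_card)
    have finA: "finite A" using that(1) S finite_subset by auto
    have "sum W (set (take (card A) ks)) \<le> sum W A"
    proof (rule sum_le_sum_exchange)
      fix x y assume "x \<in> set (take (card A) ks) - A" "y \<in> A - set (take (card A) ks)"
      then have "rank_less W x y" using seg[of x "card A" y] that(1) by blast
      then show "W x \<le> W y" by auto
    qed (use finA cardm[OF le] in auto)
    then have "R (card A) \<le> \<alpha>" using that(2) False by (simp add: R_def sumlist field_simps)
    then have "card A \<in> N" using le by (simp add: N_def)
    then show ?thesis using finN by (simp add: n_def)
  qed simp
  moreover have "B \<subseteq> S" unfolding B_def ks(2)[symmetric] by (rule set_take_subset)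
  moreover have "\<forall>b\<in>B. \<forall>x\<in>S - B. rank_less W b x" unfolding B_def using seg by blast
  ultimately show ?thesis unfolding upd greedy_def cB by simp
qed

text \<open>Two initial segments of one strict ranking are nested, and maximality gives them equal
  cardinality.\<close>

lemma greedy_unique:
  assumes S: "finite S" and B: "greedy \<alpha> S W B" and C: "greedy \<alpha> S W C"
  shows "B = C"
proof -
  have fin: "finite B" "finite C" using S B C unfolding greedy_def by (auto intro: finite_subset)
  have card: "card B = card C"
    using B C unfolding greedy_def by (meson PowI le_antisym)
  have "B \<subseteq> C \<or> C \<subseteq> B"
  proof (rule ccontr)
    assume "\<not> (B \<subseteq> C \<or> C \<subseteq> B)"
    then obtain b c where "b \<in> B" "b \<notin> C" "c \<in> C" "c \<notin> B" by blast
    then have "rank_less W b c" "rank_less W c b"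
      using B C unfolding greedy_def by blast+
    then show False by auto
  qed
  then show ?thesis using fin card by (metis card_subset_eq)
qed

lemma update_eq_iff:
  "finite S \<Longrightarrow> 0 \<le> \<alpha> \<Longrightarrow> update \<alpha> S W = B \<longleftrightarrow> greedy \<alpha> S W B"
  using greedy_update greedy_unique by blast

text \<open>Posteriors agree with the states of the chain only on the active set; this locality lets
  one replace the other.\<close>

lemma greedy_cong:
  assumes "\<And>k. k \<in> S \<Longrightarrow> W k = W' k"
  shows "greedy \<alpha> S W B = greedy \<alpha> S W' B"
proof -
  have "sum W A = sum W' A" if "A \<subseteq> S" for A
    using that assms by (intro sum.cong) auto
  moreover have "rank_less W b x = rank_less W' b x" if "b \<in> S" "x \<in> S" for b x
    using that assms by simp
  ultimately show ?thesis unfolding greedy_def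
    by (intro conj_cong refl ball_cong) (auto simp: subset_iff)
qed

section \<open>The Markov kernel and the dynamic programme\<close>

abbreviation reals :: "(nat \<Rightarrow> real) measure" where
  "reals \<equiv> PiM UNIV (\<lambda>_. borel)"

lemma space_reals [simp]: "space reals = UNIV"
  by (simp add: space_PiM PiE_UNIV_domain)

definition in_unit :: "(nat \<Rightarrow> real) \<Rightarrow> bool" where
  "in_unit w \<longleftrightarrow> (\<forall>k. 0 \<le> w k \<and> w k \<le> 1)"

text \<open>The order is compared on \<open>A\<close> only, so an isotone \<open>f\<close> takes
  equal values at points of the unit cube that agree on \<open>A\<close>. Finiteness at the top
  point bounds \<open>f\<close> on the cube and licenses cancellation in
  \<open>ennreal\<close>.\<close>

definition isotone :: "nat set \<Rightarrow> ((nat \<Rightarrow> real) \<Rightarrow> ennreal) \<Rightarrow> bool" where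
  "isotone A f \<longleftrightarrow> f (\<lambda>_. 1) < \<infinity> \<and>
     (\<forall>w w'. in_unit w \<longrightarrow> in_unit w' \<longrightarrow> (\<forall>k\<in>A. w k \<le> w' k) \<longrightarrow> f w \<le> f w')"

definition feasible :: "real \<Rightarrow> nat set \<Rightarrow> (nat \<Rightarrow> real) \<Rightarrow> bool" where
  "feasible \<alpha> A w \<longleftrightarrow> (\<Sum>k\<in>A. 1 - w k) \<le> \<alpha> * real (card A)"

text \<open>The state of a stream is the posterior probability \<open>v\<close> that it has not changed before
  the current time; \<open>pred_dens v\<close> is the density of its next observation given the past and \<open>refresh v y\<close>
  is the new state after observing \<open>y\<close>. Where the predictive density vanishes \<open>refresh\<close> has the
  junk value 0, which keeps it isotone in \<open>v\<close>.\<close>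

locale likelihoods = finite_measure \<nu> for \<nu> :: "'a measure" +
  fixes a b :: "'a \<Rightarrow> real" and \<theta> :: real
  assumes meas_a [measurable]: "a \<in> borel_measurable \<nu>" and meas_b [measurable]: "b \<in> borel_measurable \<nu>"
    and a_nonneg: "\<And>y. 0 \<le> a y" and b_nonneg: "\<And>y. 0 \<le> b y"
    and int_a: "(\<integral>\<^sup>+y. ennreal (a y) \<partial>\<nu>) = 1" and int_b: "(\<integral>\<^sup>+y. ennreal (b y) \<partial>\<nu>) = 1"
    and \<theta>_pos: "0 < \<theta>" and \<theta>_less_1: "\<theta> < 1"
begin

section \<open>Bayes update of a single stream\<close>

definition pred_dens :: "real \<Rightarrow> 'a \<Rightarrow> real" where
  "pred_dens v y = (1 - \<theta>) * v * a y + (1 - (1 - \<theta>) * v) * b y"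

definition refresh :: "real \<Rightarrow> 'a \<Rightarrow> real" where
  "refresh v y = (1 - \<theta>) * v * a y / pred_dens v y"

lemma measurable_pred_dens [measurable (raw)]:
  assumes [measurable]: "f \<in> borel_measurable N" "Y \<in> measurable N \<nu>"
  shows "(\<lambda>x. pred_dens (f x) (Y x)) \<in> borel_measurable N"
  unfolding pred_dens_def by measurable

lemma measurable_refresh [measurable (raw)]:
  assumes [measurable]: "f \<in> borel_measurable N" "Y \<in> measurable N \<nu>"
  shows "(\<lambda>x. refresh (f x) (Y x)) \<in> borel_measurable N"
  unfolding refresh_def by measurable

lemma prior_bounds:
  assumes "0 \<le> v" "v \<le> 1"
  shows "0 \<le> (1 - \<theta>) * v" "(1 - \<theta>) * v < 1"
proof -
  show "0 \<le> (1 - \<theta>) * v" using assms \<theta>_less_1 by simp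
  have "(1 - \<theta>) * v \<le> (1 - \<theta>) * 1" using assms \<theta>_less_1 by (intro mult_left_mono) auto
  then show "(1 - \<theta>) * v < 1" using \<theta>_pos by simp
qed

lemma pred_dens_nonneg: "0 \<le> v \<Longrightarrow> v \<le> 1 \<Longrightarrow> 0 \<le> pred_dens v y"
  unfolding pred_dens_def using prior_bounds[of v] a_nonneg[of y] b_nonneg[of y] \<theta>_less_1
  by (intro add_nonneg_nonneg mult_nonneg_nonneg) auto

lemma refresh_nonneg: "0 \<le> v \<Longrightarrow> v \<le> 1 \<Longrightarrow> 0 \<le> refresh v y"
  unfolding refresh_def using prior_bounds[of v] a_nonneg[of y] pred_dens_nonneg[of v y]
  by simp

lemma refresh_le_1: "0 \<le> v \<Longrightarrow> v \<le> 1 \<Longrightarrow> refresh v y \<le> 1"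
  unfolding refresh_def using pred_dens_nonneg[of v y] prior_bounds[of v] b_nonneg[of y]
  by (auto simp: divide_le_eq_1 pred_dens_def)

text \<open>Bayes' rule with the denominator cleared. It survives where the predictive density
  vanishes, since then both of its nonnegative summands do.\<close>

lemma refresh_times_pred_dens:
  "0 \<le> v \<Longrightarrow> v \<le> 1 \<Longrightarrow> refresh v y * pred_dens v y = (1 - \<theta>) * v * a y"
proof (cases "pred_dens v y = 0")
  case True
  assume v: "0 \<le> v" "v \<le> 1"
  have "0 \<le> (1 - \<theta>) * v * a y" "0 \<le> (1 - (1 - \<theta>) * v) * b y"
    using prior_bounds[OF v] a_nonneg[of y] b_nonneg[of y] by (auto intro!: mult_nonneg_nonneg)
  then have "(1 - \<theta>) * v * a y = 0" using True unfolding pred_dens_def by linarith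
  then show ?thesis unfolding True by simp
qed (simp add: refresh_def)

text \<open>With prior \<open>s = (1 - \<theta>) * v\<close>, Bayes' rule multiplies the odds
  \<open>s / (1 - s)\<close> by the likelihood ratio \<open>a y / b y\<close>, and the odds increase
  with \<open>s\<close>. Cross-multiplication avoids dividing by \<open>b y\<close>.\<close>

lemma refresh_mono:
  assumes v: "0 \<le> v" "v \<le> v'" "v' \<le> 1"
  shows "refresh v y \<le> refresh v' y"
proof -
  define s where "s = (1 - \<theta>) * v"
  define s' where "s' = (1 - \<theta>) * v'"
  have s: "0 \<le> s" "s < 1" "0 \<le> s'" "s' < 1" using prior_bounds[of v] prior_bounds[of v'] v by (auto simp: s_def s'_def)
  have ss: "s \<le> s'" unfolding s_def s'_def using v \<theta>_less_1 by (intro mult_left_mono) auto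
  have P: "pred_dens v y = s * a y + (1 - s) * b y" "pred_dens v' y = s' * a y + (1 - s') * b y"
    by (simp_all add: pred_dens_def s_def s'_def)
  have nn: "0 \<le> a y" "0 \<le> b y" by (simp_all add: a_nonneg b_nonneg)
  consider "pred_dens v y = 0" | "0 < pred_dens v y" "pred_dens v' y = 0" | "0 < pred_dens v y" "0 < pred_dens v' y"
    using pred_dens_nonneg[of v y] pred_dens_nonneg[of v' y] v by fastforce
  then show ?thesis
  proof cases
    case 1
    then show ?thesis using refresh_nonneg[of v' y] v by (simp add: refresh_def)
  next
    case 2
    have "0 \<le> s' * a y" "0 \<le> (1 - s') * b y" using s nn by auto
    then have "s' * a y = 0" "(1 - s') * b y = 0" using 2(2) P by linarith+
    then have "s * a y = 0" using s ss by auto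
    then have "refresh v y = 0" by (simp add: refresh_def s_def)
    then show ?thesis using refresh_nonneg[of v' y] v by simp
  next
    case 3
    have "s * (1 - s') \<le> s' * (1 - s)" using ss by (simp add: algebra_simps)
    then have "s * (1 - s') * (a y * b y) \<le> s' * (1 - s) * (a y * b y)"
      using nn by (intro mult_right_mono) auto
    then have "(s * a y) * pred_dens v' y \<le> (s' * a y) * pred_dens v y"
      unfolding P by (simp add: algebra_simps)
    then show ?thesis unfolding refresh_def s_def[symmetric] s'_def[symmetric] using 3 by (simp add: frac_le_eq divide_le_eq le_divide_eq mult.commute field_simps)
  qed
qed

text \<open>The predictive density is an average of \<open>a y\<close> and \<open>b y\<close>, hence
  at most \<open>a y\<close> in the first case and at least \<open>a y\<close> in the second. So the
  prior separates the posteriors after the two kinds of observation.\<close>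

lemma refresh_cases:
  assumes v: "0 \<le> v" "v \<le> 1"
  shows "b y < a y \<Longrightarrow> (1 - \<theta>) * v \<le> refresh v y" "a y \<le> b y \<Longrightarrow> refresh v y \<le> (1 - \<theta>) * v"
proof -
  define s where "s = (1 - \<theta>) * v"
  have s: "0 \<le> s" "s < 1" using prior_bounds[OF v] by (auto simp: s_def)
  have P: "pred_dens v y = s * a y + (1 - s) * b y" by (simp add: pred_dens_def s_def)
  have nn: "0 \<le> a y" "0 \<le> b y" by (simp_all add: a_nonneg b_nonneg)
  have U: "refresh v y = s * a y / pred_dens v y" by (simp add: refresh_def s_def)
  have pos: "pred_dens v y = 0 \<or> 0 < pred_dens v y" using pred_dens_nonneg[OF v, of y] by linarith
  show "(1 - \<theta>) * v \<le> refresh v y" if "b y < a y"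
    using pos
  proof
    assume "pred_dens v y = 0"
    moreover have "0 \<le> s * a y" "0 \<le> (1 - s) * b y" using s nn by auto
    ultimately have "s * a y = 0" using P by linarith
    then have "s = 0" using that nn by simp
    then show ?thesis using U unfolding s_def[symmetric] by simp
  next
    assume *: "0 < pred_dens v y"
    have "pred_dens v y \<le> s * a y + (1 - s) * a y" unfolding P using that s by (intro add_left_mono mult_left_mono) auto
    then have "pred_dens v y \<le> a y" by (simp add: algebra_simps)
    then have "s * pred_dens v y \<le> s * a y" using s by (intro mult_left_mono) auto
    then show ?thesis unfolding U s_def[symmetric] using * by (simp add: le_divide_eq)
  qed
  show "refresh v y \<le> (1 - \<theta>) * v" if "a y \<le> b y"
    using pos
  proof
    assume "pred_dens v y = 0"
    then show ?thesis using s unfolding U s_def[symmetric] by simp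
  next
    assume *: "0 < pred_dens v y"
    have "s * a y + (1 - s) * a y \<le> pred_dens v y" unfolding P using that s by (intro add_left_mono mult_left_mono) auto
    then have "a y \<le> pred_dens v y" by (simp add: algebra_simps)
    then have "s * a y \<le> s * pred_dens v y" using s by (intro mult_left_mono) auto
    then show ?thesis unfolding U s_def[symmetric] using * by (simp add: divide_le_eq)
  qed
qed

lemma nn_integral_pred_dens:
  assumes v: "0 \<le> v" "v \<le> 1" and [measurable]: "h \<in> borel_measurable \<nu>"
  shows "(\<integral>\<^sup>+y. h y * ennreal (pred_dens v y) \<partial>\<nu>)
    = ennreal ((1 - \<theta>) * v) * (\<integral>\<^sup>+y. h y * ennreal (a y) \<partial>\<nu>)
      + ennreal (1 - (1 - \<theta>) * v) * (\<integral>\<^sup>+y. h y * ennreal (b y) \<partial>\<nu>)"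
proof -
  have "ennreal (pred_dens v y) = ennreal ((1 - \<theta>) * v) * ennreal (a y) + ennreal (1 - (1 - \<theta>) * v) * ennreal (b y)" for y
    unfolding pred_dens_def using prior_bounds[OF v] a_nonneg[of y] b_nonneg[of y]
    by (subst ennreal_plus) (auto simp: ennreal_mult intro!: mult_nonneg_nonneg)
  then have "(\<integral>\<^sup>+y. h y * ennreal (pred_dens v y) \<partial>\<nu>)
      = (\<integral>\<^sup>+y. ennreal ((1 - \<theta>) * v) * (h y * ennreal (a y)) + ennreal (1 - (1 - \<theta>) * v) * (h y * ennreal (b y)) \<partial>\<nu>)"
    by (simp add: distrib_left mult_ac)
  also have "\<dots> = ennreal ((1 - \<theta>) * v) * (\<integral>\<^sup>+y. h y * ennreal (a y) \<partial>\<nu>)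
      + ennreal (1 - (1 - \<theta>) * v) * (\<integral>\<^sup>+y. h y * ennreal (b y) \<partial>\<nu>)"
    by (simp add: nn_integral_add nn_integral_cmult)
  finally show ?thesis .
qed

lemma int_pred_dens:
  assumes v: "0 \<le> v" "v \<le> 1"
  shows "(\<integral>\<^sup>+y. ennreal (pred_dens v y) \<partial>\<nu>) = 1"
  using nn_integral_pred_dens[OF v, of "\<lambda>_. 1"] prior_bounds[OF v]
  by (simp add: int_a int_b ennreal_plus[symmetric] del: ennreal_plus)

text \<open>Monotone likelihood ratio: a larger \<open>v\<close> shifts weight towards the observations with
  \<open>a y > b y\<close>, for which \<open>refresh v y\<close> exceeds the prior \<open>(1 - \<theta>) * v\<close>; comparing with the value of
  \<open>g\<close> at the prior gives the inequality.\<close>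

lemma kernel_mono:
  assumes v: "0 \<le> v" "v \<le> v'" "v' \<le> 1"
    and g: "\<And>x x'. 0 \<le> x \<Longrightarrow> x \<le> x' \<Longrightarrow> x' \<le> 1 \<Longrightarrow> g x \<le> g x'" "g 1 < \<infinity>"
    and [measurable]: "g \<in> borel_measurable borel"
  shows "(\<integral>\<^sup>+y. g (refresh v y) * ennreal (pred_dens v y) \<partial>\<nu>) \<le> (\<integral>\<^sup>+y. g (refresh v' y) * ennreal (pred_dens v' y) \<partial>\<nu>)"
proof -
  have v1: "v \<le> 1" "0 \<le> v'" using v by auto
  define s where "s = (1 - \<theta>) * v"
  define d where "d = (1 - \<theta>) * (v' - v)"
  have d: "0 \<le> d" using v \<theta>_less_1 by (simp add: d_def)
  have s: "0 \<le> s" "s < 1" using prior_bounds[OF v(1) v1(1)] by (auto simp: s_def)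
  have fin: "g s < \<infinity>" using g(1)[of s 1] g(2) s by (auto intro: le_less_trans)
  \<comment> \<open>As \<open>pred_dens v' y - pred_dens v y = d * (a y - b y)\<close>, this
    rearranges the fact that \<open>g (refresh v y) - g s\<close> times
    \<open>d * (a y - b y)\<close> is nonnegative. The form with sums avoids the truncated
    subtraction of \<open>ennreal\<close>.\<close>
  have pw: "g (refresh v y) * ennreal (pred_dens v y) + g s * (ennreal d * ennreal (a y))
     \<le> g (refresh v y) * ennreal (pred_dens v' y) + g s * (ennreal d * ennreal (b y))" for y
  proof -
    have nn: "0 \<le> a y" "0 \<le> b y" by (simp_all add: a_nonneg b_nonneg)
    have diff: "pred_dens v' y + d * b y = pred_dens v y + d * a y" by (simp add: pred_dens_def d_def algebra_simps)
    show ?thesis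
    proof (cases "b y < a y")
      case True
      have "g s \<le> g (refresh v y)"
        using g(1)[of s "refresh v y"] s refresh_cases(1)[OF v(1) v1(1) True] refresh_le_1[OF v(1) v1(1)] by (simp add: s_def)
      have e1: "pred_dens v' y = pred_dens v y + d * (a y - b y)" using diff by (simp add: algebra_simps)
      have "d * a y = d * (a y - b y) + d * b y" by (simp add: algebra_simps)
      then have e2: "ennreal d * ennreal (a y) = ennreal (d * (a y - b y)) + ennreal d * ennreal (b y)"
        using True nn d by (simp add: ennreal_mult[symmetric] ennreal_plus[symmetric] del: ennreal_plus)
      have e3: "ennreal (pred_dens v' y) = ennreal (pred_dens v y) + ennreal (d * (a y - b y))"
        unfolding e1 using True d pred_dens_nonneg[OF v(1) v1(1)] by (intro ennreal_plus) auto
      have "g s * ennreal (d * (a y - b y)) \<le> g (refresh v y) * ennreal (d * (a y - b y))"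
        by (intro mult_right_mono \<open>g s \<le> g (refresh v y)\<close>) auto
      then show ?thesis unfolding e2 e3 by (simp add: distrib_left add.assoc add_mono)
    next
      case False
      have "g (refresh v y) \<le> g s"
        using g(1)[of "refresh v y" s] s refresh_cases(2)[OF v(1) v1(1), of y] False refresh_nonneg[OF v(1) v1(1)] by (simp add: s_def)
      have e1: "pred_dens v y = pred_dens v' y + d * (b y - a y)" using diff by (simp add: algebra_simps)
      have "d * b y = d * (b y - a y) + d * a y" by (simp add: algebra_simps)
      then have e2: "ennreal d * ennreal (b y) = ennreal (d * (b y - a y)) + ennreal d * ennreal (a y)"
        using False nn d by (simp add: ennreal_mult[symmetric] ennreal_plus[symmetric] del: ennreal_plus)
      have e3: "ennreal (pred_dens v y) = ennreal (pred_dens v' y) + ennreal (d * (b y - a y))"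
        unfolding e1 using False d pred_dens_nonneg[OF v1(2) v(3)] by (intro ennreal_plus) auto
      have "g (refresh v y) * ennreal (d * (b y - a y)) \<le> g s * ennreal (d * (b y - a y))"
        by (intro mult_right_mono \<open>g (refresh v y) \<le> g s\<close>) auto
      then show ?thesis unfolding e2 e3 by (simp add: distrib_left add.assoc add_mono)
    qed
  qed
  \<comment> \<open>Both correction terms have the same finite integral, because \<open>a\<close>
    and \<open>b\<close> are probability densities, so they cancel.\<close>
  have ia: "(\<integral>\<^sup>+y. g s * (ennreal d * ennreal (a y)) \<partial>\<nu>) = g s * ennreal d"
    "(\<integral>\<^sup>+y. g s * (ennreal d * ennreal (b y)) \<partial>\<nu>) = g s * ennreal d"
    by (simp_all add: nn_integral_cmult int_a int_b)
  have "(\<integral>\<^sup>+y. g (refresh v y) * ennreal (pred_dens v y) \<partial>\<nu>) + g s * ennreal d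
      = (\<integral>\<^sup>+y. g (refresh v y) * ennreal (pred_dens v y) + g s * (ennreal d * ennreal (a y)) \<partial>\<nu>)"
    unfolding ia(1)[symmetric] by (rule nn_integral_add[symmetric]) measurable
  also have "\<dots> \<le> (\<integral>\<^sup>+y. g (refresh v y) * ennreal (pred_dens v' y) + g s * (ennreal d * ennreal (b y)) \<partial>\<nu>)"
    by (intro nn_integral_mono pw)
  also have "\<dots> = (\<integral>\<^sup>+y. g (refresh v y) * ennreal (pred_dens v' y) \<partial>\<nu>) + g s * ennreal d"
    unfolding ia(2)[symmetric] by (rule nn_integral_add) measurable
  finally have "(\<integral>\<^sup>+y. g (refresh v y) * ennreal (pred_dens v y) \<partial>\<nu>) \<le> (\<integral>\<^sup>+y. g (refresh v y) * ennreal (pred_dens v' y) \<partial>\<nu>)"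
    using fin by (subst (asm) (1 2) add.commute, subst (asm) ennreal_add_left_cancel_le) (auto simp: ennreal_mult_eq_top_iff)
  \<comment> \<open>So far only the law of the observation has moved from \<open>v\<close> to
    \<open>v'\<close>; now the updated state moves as well.\<close>
  also have "\<dots> \<le> (\<integral>\<^sup>+y. g (refresh v' y) * ennreal (pred_dens v' y) \<partial>\<nu>)"
    by (intro nn_integral_mono mult_right_mono g(1) refresh_nonneg refresh_le_1 refresh_mono)
       (use v in auto)
  finally show ?thesis .
qed

section \<open>Transition operator of the chain\<close>

text \<open>Only coordinate \<open>i\<close> moves. By independence of the streams, folding
  \<open>step\<close> over \<open>[0..<K]\<close> gives the transition of the whole chain as
  iterated integrals.\<close>

definition step :: "nat \<Rightarrow> ((nat \<Rightarrow> real) \<Rightarrow> ennreal) \<Rightarrow> (nat \<Rightarrow> real) \<Rightarrow> ennreal" where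
  "step i f w = (\<integral>\<^sup>+y. f (w(i := refresh (w i) y)) * ennreal (pred_dens (w i) y) \<partial>\<nu>)"

lemma measurable_upd_reals:
  assumes [measurable]: "g \<in> measurable N reals" "h \<in> borel_measurable N"
  shows "(\<lambda>x. (g x)(i := h x)) \<in> measurable N reals"
  by (rule measurable_fun_upd[where J = UNIV]) auto

lemma measurable_step_integrand:
  assumes [measurable]: "f \<in> borel_measurable reals" "g \<in> measurable N reals" "Y \<in> measurable N \<nu>"
  shows "(\<lambda>x. f ((g x)(i := refresh (g x i) (Y x))) * ennreal (pred_dens (g x i) (Y x))) \<in> borel_measurable N"
proof -
  have "(\<lambda>x. (g x)(i := refresh (g x i) (Y x))) \<in> measurable N reals"
    by (rule measurable_upd_reals) measurable
  from measurable_compose[OF this assms(1)] show ?thesis by measurable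
qed

lemma measurable_step [measurable]:
  assumes [measurable]: "f \<in> borel_measurable reals"
  shows "step i f \<in> borel_measurable reals"
  unfolding step_def
  by (rule borel_measurable_nn_integral)
    (use measurable_step_integrand[OF assms measurable_fst measurable_snd, of i] in \<open>simp add: case_prod_beta'\<close>)

lemma measurable_steps [measurable]:
  "f \<in> borel_measurable reals \<Longrightarrow> foldr step L f \<in> borel_measurable reals"
  by (induction L) auto

text \<open>The kernels of distinct streams do not interact, and Fubini for the finite measure
  \<open>\<nu>\<close> swaps them. Commutation makes the folded operator symmetric in the
  streams.\<close>

lemma step_commute:
  assumes f [measurable]: "f \<in> borel_measurable reals"
  shows "step i (step j f) = step j (step i f)"
proof (cases "i = j")
  case ij: False
  interpret pair_sigma_finite \<nu> \<nu> ..
  have meas: "(\<lambda>(y, z). f (w(i := refresh (w i) y, j := refresh (w j) z)) * ennreal (pred_dens (w j) z)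
      * ennreal (pred_dens (w i) y)) \<in> borel_measurable (\<nu> \<Otimes>\<^sub>M \<nu>)" for w i j
  proof -
    have m: "(\<lambda>x. w(i := refresh (w i) (fst x), j := refresh (w j) (snd x))) \<in> measurable (\<nu> \<Otimes>\<^sub>M \<nu>) reals"
      by (intro measurable_upd_reals) measurable
    show ?thesis using measurable_compose[OF m f] unfolding case_prod_beta' by measurable
  qed
  have inner: "(\<integral>\<^sup>+z. f (w(i := u, j := refresh (w j) z)) * ennreal (pred_dens (w j) z) \<partial>\<nu>) * c
      = (\<integral>\<^sup>+z. f (w(i := u, j := refresh (w j) z)) * ennreal (pred_dens (w j) z) * c \<partial>\<nu>)" for w u c i j
  proof (rule nn_integral_multc[symmetric])
    have m: "(\<lambda>z. w(i := u, j := refresh (w j) z)) \<in> measurable \<nu> reals"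
      by (intro measurable_upd_reals) measurable
    show "(\<lambda>z. f (w(i := u, j := refresh (w j) z)) * ennreal (pred_dens (w j) z)) \<in> borel_measurable \<nu>"
      using measurable_compose[OF m f] by measurable
  qed
  show ?thesis
  proof
    fix w
    have "step i (step j f) w = (\<integral>\<^sup>+y. \<integral>\<^sup>+z. f (w(i := refresh (w i) y, j := refresh (w j) z)) * ennreal (pred_dens (w j) z)
        * ennreal (pred_dens (w i) y) \<partial>\<nu> \<partial>\<nu>)"
      using ij by (simp add: step_def inner)
    also have "\<dots> = (\<integral>\<^sup>+z. \<integral>\<^sup>+y. f (w(i := refresh (w i) y, j := refresh (w j) z)) * ennreal (pred_dens (w j) z)
        * ennreal (pred_dens (w i) y) \<partial>\<nu> \<partial>\<nu>)"
      using Fubini'[OF meas] by simp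
    also have "\<dots> = step j (step i f) w"
    proof -
      have "f (w(i := refresh (w i) y, j := refresh (w j) z)) * ennreal (pred_dens (w j) z) * ennreal (pred_dens (w i) y)
          = f (w(j := refresh (w j) z, i := refresh (w i) y)) * ennreal (pred_dens (w i) y) * ennreal (pred_dens (w j) z)" for y z
        using ij by (simp add: fun_upd_twist mult_ac)
      moreover have "step j (step i f) w = (\<integral>\<^sup>+z. \<integral>\<^sup>+y. f (w(j := refresh (w j) z, i := refresh (w i) y))
          * ennreal (pred_dens (w i) y) * ennreal (pred_dens (w j) z) \<partial>\<nu> \<partial>\<nu>)"
        using ij by (simp add: step_def inner)
      ultimately show ?thesis by simp
    qed
    finally show "step i (step j f) w = step j (step i f) w" .
  qed
qed simp

lemma steps_move:
  assumes "f \<in> borel_measurable reals"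
  shows "foldr step L (step x f) = step x (foldr step L f)"
  by (induction L) (use assms in \<open>auto simp: step_commute\<close>)

lemma steps_mset_eq:
  assumes "mset L = mset L'" and f: "f \<in> borel_measurable reals"
  shows "foldr step L f = foldr step L' f"
  using assms(1)
proof (induction L arbitrary: L')
  case (Cons x L)
  then obtain us vs where L': "L' = us @ x # vs" by (metis list.set_intros(1) set_mset_mset split_list)
  with Cons.prems have "mset L = mset (us @ vs)" by simp
  from Cons.IH[OF this] show ?case using L' f by (simp add: steps_move)
qed simp

lemma step_permute:
  assumes "\<And>k. \<pi> (\<pi> k) = k"
  shows "step i (\<lambda>w. f (w \<circ> \<pi>)) = (\<lambda>w. step (\<pi> i) f (w \<circ> \<pi>))"
proof
  fix w :: "nat \<Rightarrow> real"
  have "(w(i := z)) \<circ> \<pi> = (w \<circ> \<pi>)(\<pi> i := z)" for z using assms by (force simp: fun_eq_iff)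
  then show "step i (\<lambda>w. f (w \<circ> \<pi>)) w = step (\<pi> i) f (w \<circ> \<pi>)" by (simp add: step_def assms)
qed

lemma steps_permute:
  assumes "\<And>k. \<pi> (\<pi> k) = k"
  shows "foldr step L (\<lambda>w. f (w \<circ> \<pi>)) = (\<lambda>w. foldr step (map \<pi> L) f (w \<circ> \<pi>))"
proof (induction L)
  case (Cons i L)
  have "foldr step (i # L) (\<lambda>w. f (w \<circ> \<pi>)) = step i (\<lambda>w. foldr step (map \<pi> L) f (w \<circ> \<pi>))"
    unfolding foldr_Cons comp_apply Cons.IH ..
  also have "\<dots> = (\<lambda>w. step (\<pi> i) (foldr step (map \<pi> L) f) (w \<circ> \<pi>))"
    by (rule step_permute[OF assms])
  finally show ?case unfolding list.map foldr_Cons comp_apply .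
qed simp

text \<open>All streams have the same kernel, so relabelling merely permutes the list
  \<open>[0..<K]\<close>, and the order of the steps is immaterial.\<close>

lemma steps_permute_all:
  assumes "\<And>k. \<pi> (\<pi> k) = k" and "\<And>k. k < K \<Longrightarrow> \<pi> k < K" and f: "f \<in> borel_measurable reals"
  shows "foldr step [0..<K] (\<lambda>w. f (w \<circ> \<pi>)) w = foldr step [0..<K] f (w \<circ> \<pi>)"
proof -
  have inj: "inj \<pi>" using assms(1) by (metis injI)
  have "\<pi> ` {0..<K} = {0..<K}" 
  proof (intro set_eqI iffI)
    show "k \<in> \<pi> ` {0..<K}" if "k \<in> {0..<K}" for k
      using assms(1)[of k] assms(2)[of k] that by (intro image_eqI[of _ _ "\<pi> k"]) auto
  qed (use assms(2) in auto)
  then have "mset (map \<pi> [0..<K]) = mset [0..<K]"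
    using inj by (intro iffD1[OF set_eq_iff_mset_eq_distinct]) (auto simp: distinct_map inj_on_def)
  from steps_mset_eq[OF this f] show ?thesis by (simp add: steps_permute[OF assms(1)])
qed

text \<open>For \<open>i\<close> in \<open>A\<close>, first the start of stream \<open>i\<close> is
  raised inside the kernel by \<open>kernel_mono\<close>, then the other coordinates are raised
  pointwise. For \<open>i\<close> outside \<open>A\<close>, the function ignores the coordinate, and
  \<open>step i\<close> acts as the identity on the unit cube.\<close>

lemma isotone_step:
  assumes iso: "isotone A f" and [measurable]: "f \<in> borel_measurable reals"
  shows "isotone A (step i f)"
proof -
  have mono: "f w \<le> f w'" if "in_unit w" "in_unit w'" "\<And>k. k \<in> A \<Longrightarrow> w k \<le> w' k" for w w'
    using iso that unfolding isotone_def by blast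
  have fin: "f (\<lambda>_. 1) < \<infinity>" using iso unfolding isotone_def by blast
  have unit1: "in_unit (\<lambda>_. 1)" by (simp add: in_unit_def)
  have upd: "in_unit (w(i := x))" if "in_unit w" "0 \<le> x" "x \<le> 1" for w x
    using that by (simp add: in_unit_def)
  have "step i f w \<le> step i f w'" if w: "in_unit w" and w': "in_unit w'" and le: "\<And>k. k \<in> A \<Longrightarrow> w k \<le> w' k" for w w'
  proof -
    have b: "0 \<le> w i" "w i \<le> 1" "0 \<le> w' i" "w' i \<le> 1" using w w' by (auto simp: in_unit_def)
    show ?thesis
    proof (cases "i \<in> A")
      case True
      have m: "(\<lambda>x. f (w(i := x))) \<in> borel_measurable borel"
        using measurable_compose[OF measurable_upd_reals[of "\<lambda>_. w" borel "\<lambda>x. x" i] assms(2)] by simp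
      have "step i f w \<le> (\<integral>\<^sup>+y. f (w(i := refresh (w' i) y)) * ennreal (pred_dens (w' i) y) \<partial>\<nu>)"
        unfolding step_def
      proof (rule kernel_mono[where g = "\<lambda>x. f (w(i := x))"])
        show "f (w(i := x)) \<le> f (w(i := x'))" if "0 \<le> x" "x \<le> x'" "x' \<le> 1" for x x'
          using that by (intro mono upd w) auto
        have "f (w(i := 1)) \<le> f (\<lambda>_. 1)" using w by (intro mono upd unit1 w) (auto simp: in_unit_def)
        then show "f (w(i := 1)) < \<infinity>" using fin by (rule le_less_trans)
      qed (use b True le m in auto)
      also have "\<dots> \<le> step i f w'" unfolding step_def
        using b le by (intro nn_integral_mono mult_right_mono mono upd w w' refresh_nonneg refresh_le_1) auto
      finally show ?thesis .
    next
      case False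
      have eq: "step i f x = f x" if x: "in_unit x" for x
      proof -
        have xi: "0 \<le> x i" "x i \<le> 1" using x by (auto simp: in_unit_def)
        have "f (x(i := refresh (x i) y)) = f x" for y
          using False x xi by (intro antisym mono upd refresh_nonneg refresh_le_1) auto
        then show ?thesis unfolding step_def using int_pred_dens[OF xi]
          by (simp add: nn_integral_cmult)
      qed
      show ?thesis using mono[OF w w' le] by (simp add: eq w w')
    qed
  qed
  moreover have "step i f (\<lambda>_. 1) < \<infinity>"
  proof -
    have "step i f (\<lambda>_. 1) \<le> (\<integral>\<^sup>+y. f (\<lambda>_. 1) * ennreal (pred_dens 1 y) \<partial>\<nu>)"
      unfolding step_def
      by (intro nn_integral_mono mult_right_mono mono upd unit1 refresh_nonneg refresh_le_1) (auto simp: refresh_le_1)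
    also have "\<dots> = f (\<lambda>_. 1)" using int_pred_dens[of 1] by (subst nn_integral_cmult) auto
    finally show ?thesis using fin by (rule le_less_trans)
  qed
  ultimately show ?thesis unfolding isotone_def by blast
qed

lemma isotone_steps:
  assumes "isotone A f" "f \<in> borel_measurable reals"
  shows "isotone A (foldr step L f)"
  by (induction L) (use assms in \<open>auto intro: isotone_step\<close>)

lemma steps_mono:
  assumes "\<And>w. f w \<le> g w"
  shows "foldr step L f w \<le> foldr step L g w"
  by (induction L arbitrary: w) (use assms in \<open>auto simp: step_def intro!: nn_integral_mono mult_right_mono\<close>)

section \<open>The dynamic programme and its exchange property\<close>

lemma feasible_mono:
  assumes "feasible \<alpha> B w" "\<And>k. k \<in> B \<Longrightarrow> w k \<le> w' k"
  shows "feasible \<alpha> B w'"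
proof -
  have "(\<Sum>k\<in>B. 1 - w' k) \<le> (\<Sum>k\<in>B. 1 - w k)" using assms(2) by (intro sum_mono) auto
  then show ?thesis using assms(1) unfolding feasible_def by linarith
qed

text \<open>\<open>reward K \<alpha> c h A w\<close> is the optimal value with \<open>h\<close> updates to go when the streams in \<open>A\<close> are
  active with states \<open>w\<close>; infeasible choices contribute 0.\<close>

primrec reward :: "nat \<Rightarrow> real \<Rightarrow> (real \<Rightarrow> ennreal) \<Rightarrow> nat \<Rightarrow> nat set \<Rightarrow> (nat \<Rightarrow> real) \<Rightarrow> ennreal" where
  "reward K \<alpha> c 0 = (\<lambda>A w. \<Sum>k\<in>A. c (w k))"
| "reward K \<alpha> c (Suc h) = (\<lambda>A. foldr step [0..<K]
     (\<lambda>w. SUP B\<in>Pow A. if feasible \<alpha> B w then reward K \<alpha> c h B w else 0))"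

lemma measurable_choice:
  assumes "finite A" "\<And>B. B \<subseteq> A \<Longrightarrow> g B \<in> borel_measurable reals"
  shows "(\<lambda>w. SUP B\<in>Pow A. if feasible \<alpha> B w then g B w else (0::ennreal)) \<in> borel_measurable reals"
proof (rule borel_measurable_SUP)
  show "countable (Pow A)" using assms(1) by (intro countable_finite) auto
  fix B assume "B \<in> Pow A"
  then have [measurable]: "g B \<in> borel_measurable reals" using assms(2) by simp
  show "(\<lambda>w. if feasible \<alpha> B w then g B w else 0) \<in> borel_measurable reals"
    unfolding feasible_def by measurable
qed

lemma measurable_reward [measurable]:
  assumes [measurable]: "c \<in> borel_measurable borel"
  shows "finite A \<Longrightarrow> reward K \<alpha> c h A \<in> borel_measurable reals"
proof (induction h arbitrary: A)
  case (Suc h)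
  then have "\<And>B. B \<subseteq> A \<Longrightarrow> reward K \<alpha> c h B \<in> borel_measurable reals" by (meson finite_subset)
  from measurable_choice[OF Suc.prems this] show ?case by (simp add: measurable_steps)
qed simp

text \<open>Raising the states on \<open>A\<close> keeps feasible sets feasible, so every choice
  available at the lower point is available at the upper one and pays at least as much.\<close>

lemma isotone_reward:
  assumes c: "\<And>x x'. 0 \<le> x \<Longrightarrow> x \<le> x' \<Longrightarrow> x' \<le> 1 \<Longrightarrow> c x \<le> c x'" "c 1 < \<infinity>"
    and mc: "c \<in> borel_measurable borel"
  shows "finite A \<Longrightarrow> isotone A (reward K \<alpha> c h A)"
proof (induction h arbitrary: A)
  case 0
  then show ?case using c unfolding isotone_def in_unit_def by (auto intro!: sum_mono simp: ennreal_mult_less_top of_nat_less_top)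
next
  case (Suc h)
  have finB: "finite B" if "B \<subseteq> A" for B using that Suc.prems by (rule finite_subset)
  note iso = Suc.IH[OF finB]
  have "isotone A (\<lambda>w. SUP B\<in>Pow A. if feasible \<alpha> B w then reward K \<alpha> c h B w else 0)"
    unfolding isotone_def
  proof (intro conjI allI impI)
    have "reward K \<alpha> c h B (\<lambda>_. 1) < \<infinity>" if "B \<subseteq> A" for B
      using iso[OF that] unfolding isotone_def by blast
    then show "(SUP B\<in>Pow A. if feasible \<alpha> B (\<lambda>_. 1) then reward K \<alpha> c h B (\<lambda>_. 1) else 0) < \<infinity>"
      using Suc.prems by (subst finite_Sup_less_iff) auto
  next
    fix w w' assume w: "in_unit w" "in_unit w'" "\<forall>k\<in>A. w k \<le> w' k"
    show "(SUP B\<in>Pow A. if feasible \<alpha> B w then reward K \<alpha> c h B w else 0)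
       \<le> (SUP B\<in>Pow A. if feasible \<alpha> B w' then reward K \<alpha> c h B w' else 0)"
    proof (rule SUP_mono, intro bexI)
      fix B assume B: "B \<in> Pow A"
      have "feasible \<alpha> B w \<Longrightarrow> feasible \<alpha> B w'" using w(3) B by (blast intro: feasible_mono)
      moreover have "reward K \<alpha> c h B w \<le> reward K \<alpha> c h B w'"
        using iso[of B] w B unfolding isotone_def by blast
      ultimately show "(if feasible \<alpha> B w then reward K \<alpha> c h B w else 0) \<le> (if feasible \<alpha> B w' then reward K \<alpha> c h B w' else 0)"
        by simp
    qed
  qed
  then show ?case unfolding reward.simps
    using measurable_choice[OF Suc.prems measurable_reward[OF mc finB]] by (rule isotone_steps)
qed

lemma reward_subset:
  assumes "A \<subseteq> A'" "finite A'"
  shows "reward K \<alpha> c h A w \<le> reward K \<alpha> c h A' w"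
proof (cases h)
  case 0
  then show ?thesis using assms by (auto intro!: sum_mono2)
next
  case (Suc h)
  show ?thesis unfolding Suc reward.simps by (intro steps_mono SUP_subset_mono) (use assms in auto)
qed

text \<open>Exchangeability of the streams: terminal reward, feasibility and kernel are each
  invariant under relabelling by an involution.\<close>

lemma reward_permute:
  assumes \<pi>: "\<And>k. \<pi> (\<pi> k) = k" "\<And>k. k < K \<Longrightarrow> \<pi> k < K" and mc: "c \<in> borel_measurable borel"
  shows "finite A \<Longrightarrow> reward K \<alpha> c h (\<pi> ` A) w = reward K \<alpha> c h A (w \<circ> \<pi>)"
proof (induction h arbitrary: A w)
  case 0
  have "inj_on \<pi> A" using \<pi>(1) by (metis inj_onI)
  then show ?case by (simp add: sum.reindex)
next
  case (Suc h)
  have feas: "feasible \<alpha> (\<pi> ` B) w = feasible \<alpha> B (w \<circ> \<pi>)" for B w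
  proof -
    have "inj_on \<pi> B" using \<pi>(1) by (metis inj_onI)
    then show ?thesis by (simp add: feasible_def sum.reindex card_image)
  qed
  let ?g = "\<lambda>A w. SUP B\<in>Pow A. if feasible \<alpha> B w then reward K \<alpha> c h B w else 0"
  have "?g (\<pi> ` A) w = ?g A (w \<circ> \<pi>)" for w
  proof -
    have "Pow (\<pi> ` A) = (`) \<pi> ` Pow A" by (rule image_Pow_surj[symmetric]) simp
    then have "?g (\<pi> ` A) w = (SUP B\<in>Pow A. if feasible \<alpha> (\<pi> ` B) w then reward K \<alpha> c h (\<pi> ` B) w else 0)"
      by (simp only: image_image)
    also have "\<dots> = ?g A (w \<circ> \<pi>)"
      using Suc.IH Suc.prems by (intro SUP_cong refl) (simp add: feas finite_subset comp_def)
    finally show ?thesis .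
  qed
  moreover have "?g A \<in> borel_measurable reals"
    using Suc.prems by (intro measurable_choice measurable_reward[OF mc]) (auto intro: finite_subset)
  ultimately have "foldr step [0..<K] (?g (\<pi> ` A)) w = foldr step [0..<K] (?g A) (w \<circ> \<pi>)"
    using steps_permute_all[OF \<pi>, of "?g A" w] by presburger
  then show ?case unfolding reward.simps .
qed

text \<open>Induction on the number of streams of \<open>A\<close> outside \<open>B\<close>.
  Replacing such an \<open>x\<close> by some \<open>b\<close> of \<open>B\<close> outside
  \<open>A\<close> is a swap of names followed by a rise of one state, so it cannot lower the value.
  Once nothing is left to replace, \<open>A\<close> is a subset of \<open>B\<close>.\<close>

lemma reward_exchange:
  assumes c: "\<And>x x'. 0 \<le> x \<Longrightarrow> x \<le> x' \<Longrightarrow> x' \<le> 1 \<Longrightarrow> c x \<le> c x'" "c 1 < \<infinity>"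
    and mc: "c \<in> borel_measurable borel" and w: "in_unit w"
    and "A \<subseteq> {..<K}" and B: "B \<subseteq> {..<K}" and "card A \<le> card B"
    and "\<And>b x. b \<in> B \<Longrightarrow> x \<in> A - B \<Longrightarrow> w x \<le> w b"
  shows "reward K \<alpha> c h A w \<le> reward K \<alpha> c h B w"
  using assms(5,7,8)
proof (induction "card (A - B)" arbitrary: A)
  case 0
  then have "finite (A - B)" by (meson finite_Diff finite_lessThan finite_subset)
  then have "A \<subseteq> B" using 0 by auto
  then show ?case using B by (intro reward_subset) (auto intro: finite_subset)
next
  case (Suc n)
  have fin: "finite A" "finite B" using Suc.prems(1) B by (auto intro: finite_subset)
  obtain x where x: "x \<in> A" "x \<notin> B" using Suc.hyps(2) by (metis Diff_iff card.empty equals0I nat.distinct(1))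
  have "\<not> B \<subseteq> A" using fin x Suc.prems(2) by (metis card_seteq)
  then obtain b where b: "b \<in> B" "b \<notin> A" by blast
  \<comment> \<open>The swap turns \<open>A\<close> with states \<open>w\<close> into
    \<open>A'\<close> with states \<open>w \<circ> \<pi>\<close>. On \<open>A'\<close> these differ
    from \<open>w\<close> only at \<open>b\<close>, where \<open>w x\<close> stands in place of the
    larger \<open>w b\<close>.\<close>
  define \<pi> where "\<pi> = Transposition.transpose x b"
  define A' where "A' = insert b (A - {x})"
  have imA: "\<pi> ` A' = A" using x b by (auto simp: \<pi>_def A'_def Transposition.transpose_def image_iff)
  have xb: "x < K" "b < K" using x b Suc.prems(1) B by auto
  have "w x \<le> w b" using Suc.prems(3) x b by blast
  have A': "A' \<subseteq> {..<K}" "finite A'" using fin Suc.prems(1) xb by (auto simp: A'_def)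
  have "reward K \<alpha> c h A w = reward K \<alpha> c h A' (w \<circ> \<pi>)"
    unfolding imA[symmetric]
    by (rule reward_permute) (use xb mc A'(2) in \<open>auto simp: \<pi>_def Transposition.transpose_def\<close>)
  also have "\<dots> \<le> reward K \<alpha> c h A' w"
  proof -
    have "in_unit (w \<circ> \<pi>)" using w by (simp add: in_unit_def)
    moreover have "(w \<circ> \<pi>) k \<le> w k" if "k \<in> A'" for k
      using that \<open>w x \<le> w b\<close> by (auto simp: A'_def \<pi>_def Transposition.transpose_def)
    ultimately show ?thesis using isotone_reward[OF c mc A'(2), of K \<alpha> h] w unfolding isotone_def by blast
  qed
  also have "\<dots> \<le> reward K \<alpha> c h B w"
  proof (rule Suc.hyps(1))
    have "A' - B = (A - B) - {x}" using x b by (auto simp: A'_def)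
    then show "n = card (A' - B)" using Suc.hyps(2) x fin by (simp add: card_Diff_singleton)
    have "card A > 0" using x fin by (auto simp: card_gt_0_iff)
    then show "card A' \<le> card B" using Suc.prems(2) fin x b by (simp add: A'_def card_insert_if)
    show "w x' \<le> w b'" if "b' \<in> B" "x' \<in> A' - B" for b' x'
      using that Suc.prems(3) b by (auto simp: A'_def)
  qed (use A' in auto)
  finally show ?case .
qed

end

section \<open>The joint law of change points and observations\<close>

text \<open>Normalising the baseline measure to the density \<open>p + q\<close> makes it finite, and hence Fubini applicable,
  although \<open>\<mu>\<close> itself need not be sigma-finite.\<close>

definition base :: "'a measure \<Rightarrow> ('a \<Rightarrow> real) \<Rightarrow> ('a \<Rightarrow> real) \<Rightarrow> 'a measure" where
  "base \<mu> p q = density \<mu> (\<lambda>y. ennreal (p y + q y))"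

text \<open>The density of \<open>r\<close> relative to \<open>base\<close>. The indicator keeps it
  nonnegative off the space, where the model does not constrain \<open>p\<close> and
  \<open>q\<close>.\<close>

definition lik :: "'a measure \<Rightarrow> ('a \<Rightarrow> real) \<Rightarrow> ('a \<Rightarrow> real) \<Rightarrow> ('a \<Rightarrow> real) \<Rightarrow> 'a \<Rightarrow> real" where
  "lik \<mu> p q r y = indicator (space \<mu>) y * (r y / (p y + q y))"

locale change_model = prob_space M for M :: "'w measure" +
  fixes K :: nat and \<theta> :: real and \<mu> :: "'a measure" and p q :: "'a \<Rightarrow> real"
    and \<tau> :: "nat \<Rightarrow> 'w \<Rightarrow> enat" and X :: "nat \<Rightarrow> nat \<Rightarrow> 'w \<Rightarrow> 'a"
  assumes model: "model_s M K \<theta> \<mu> p q \<tau> X"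
begin

abbreviation "\<nu> \<equiv> base \<mu> p q"
abbreviation "a \<equiv> lik \<mu> p q p"
abbreviation "b \<equiv> lik \<mu> p q q"

lemma
  shows theta_pos: "0 < \<theta>" and theta_less_1: "\<theta> < 1"
    and meas_p [measurable]: "p \<in> borel_measurable \<mu>" and meas_q [measurable]: "q \<in> borel_measurable \<mu>"
    and p_nonneg: "\<And>y. y \<in> space \<mu> \<Longrightarrow> 0 \<le> p y" and q_nonneg: "\<And>y. y \<in> space \<mu> \<Longrightarrow> 0 \<le> q y"
    and int_p: "(\<integral>\<^sup>+ x. ennreal (p x) \<partial>\<mu>) = 1" and int_q: "(\<integral>\<^sup>+ x. ennreal (q x) \<partial>\<mu>) = 1"
    and meas_tau [measurable]: "\<And>k. \<tau> k \<in> measurable M (count_space UNIV)"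
    and meas_X [measurable]: "\<And>k t. X k t \<in> measurable M \<mu>"
  using model unfolding model_s_def by blast+

lemma law:
  assumes "finite F" "F \<subseteq> {(k, t). k < K \<and> 1 \<le> t}" "B ` F \<subseteq> sets \<mu>"
  shows "emeasure M {\<omega> \<in> space M. (\<forall>k<K. \<tau> k \<omega> = enat (m k)) \<and> (\<forall>(k, t)\<in>F. X k t \<omega> \<in> B (k, t))}
        = (\<Prod>k<K. ennreal (\<theta> * (1 - \<theta>) ^ m k)) *
          (\<Prod>(k, t)\<in>F. \<integral>\<^sup>+ x \<in> B (k, t). ennreal (if t \<le> m k then p x else q x) \<partial>\<mu>)"
  using model assms unfolding model_s_def by blast

section \<open>Change of the baseline measure\<close>

lemma sets_base [measurable_cong, simp]: "sets \<nu> = sets \<mu>"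
  by (simp add: base_def)

lemma space_base [simp]: "space \<nu> = space \<mu>"
  by (simp add: base_def)

lemma meas_lik:
  assumes [measurable]: "r \<in> borel_measurable \<mu>"
  shows "lik \<mu> p q r \<in> borel_measurable \<mu>"
  unfolding lik_def by measurable

lemma nn_integral_lik:
  assumes [measurable]: "r \<in> borel_measurable \<mu>" "h \<in> borel_measurable \<mu>"
    and r: "\<And>y. y \<in> space \<mu> \<Longrightarrow> 0 \<le> r y \<and> r y \<le> p y + q y"
  shows "(\<integral>\<^sup>+y. h y * ennreal (lik \<mu> p q r y) \<partial>\<nu>) = (\<integral>\<^sup>+y. h y * ennreal (r y) \<partial>\<mu>)"
proof -
  note meas_lik[OF assms(1), measurable]
  have "(\<integral>\<^sup>+y. h y * ennreal (lik \<mu> p q r y) \<partial>\<nu>) = (\<integral>\<^sup>+y. ennreal (p y + q y) * (h y * ennreal (lik \<mu> p q r y)) \<partial>\<mu>)"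
    unfolding base_def by (rule nn_integral_density) measurable
  also have "\<dots> = (\<integral>\<^sup>+y. h y * ennreal (r y) \<partial>\<mu>)"
  proof (rule nn_integral_cong)
    fix y assume y: "y \<in> space \<mu>"
    \<comment> \<open>Where \<open>p + q\<close> vanishes, the bounds
      \<open>0 \<le> r \<le> p + q\<close> force \<open>r = 0\<close>, so the value 0 of the
      quotient is right.\<close>
    have "(p y + q y) * lik \<mu> p q r y = r y"
      using y r[OF y] by (auto simp: lik_def)
    then have "ennreal (p y + q y) * ennreal (lik \<mu> p q r y) = ennreal (r y)"
      using r[OF y] by (metis ennreal_mult' order_trans)
    then show "ennreal (p y + q y) * (h y * ennreal (lik \<mu> p q r y)) = h y * ennreal (r y)"
      by (metis mult.left_commute)
  qed
  finally show ?thesis .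
qed

lemma nn_integral_a: "h \<in> borel_measurable \<mu> \<Longrightarrow> (\<integral>\<^sup>+y. h y * ennreal (a y) \<partial>\<nu>) = (\<integral>\<^sup>+y. h y * ennreal (p y) \<partial>\<mu>)"
  using p_nonneg q_nonneg by (intro nn_integral_lik) auto

lemma nn_integral_b: "h \<in> borel_measurable \<mu> \<Longrightarrow> (\<integral>\<^sup>+y. h y * ennreal (b y) \<partial>\<nu>) = (\<integral>\<^sup>+y. h y * ennreal (q y) \<partial>\<mu>)"
  using p_nonneg q_nonneg by (intro nn_integral_lik) auto

lemma finite_base: "finite_measure \<nu>"
proof (rule finite_measureI)
  have "emeasure \<nu> (space \<nu>) = (\<integral>\<^sup>+y. ennreal (p y) + ennreal (q y) \<partial>\<mu>)"
    unfolding base_def using p_nonneg q_nonneg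
    by (subst emeasure_density) (auto intro!: nn_integral_cong)
  also have "\<dots> = 2" using int_p int_q by (subst nn_integral_add) auto
  finally show "emeasure \<nu> (space \<nu>) \<noteq> \<infinity>" by simp
qed

sublocale likelihoods \<nu> a b \<theta>
proof (intro likelihoods.intro likelihoods_axioms.intro finite_base)
  show "0 \<le> a y" for y using p_nonneg[of y] q_nonneg[of y] by (auto simp: lik_def indicator_def)
  show "0 \<le> b y" for y using p_nonneg[of y] q_nonneg[of y] by (auto simp: lik_def indicator_def)
  show "(\<integral>\<^sup>+y. ennreal (a y) \<partial>\<nu>) = 1" using nn_integral_a[of "\<lambda>_. 1"] int_p by simp
  show "(\<integral>\<^sup>+y. ennreal (b y) \<partial>\<nu>) = 1" using nn_integral_b[of "\<lambda>_. 1"] int_q by simp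
  have "a \<in> borel_measurable \<mu>" "b \<in> borel_measurable \<mu>" by (rule meas_lik, measurable)+
  then show "a \<in> borel_measurable \<nu>" "b \<in> borel_measurable \<nu>" by measurable
qed (rule theta_pos theta_less_1)+

section \<open>Sigma-algebras generated by observations\<close>

definition rect :: "(nat \<times> nat) set \<Rightarrow> (nat \<times> nat \<Rightarrow> 'a set) \<Rightarrow> 'w set" where
  "rect F B = {\<omega> \<in> space M. \<forall>(k, s)\<in>F. X k s \<omega> \<in> B (k, s)}"

text \<open>Finite cylinders, in the form in which the model prescribes probabilities; they are an
  intersection-stable generator.\<close>

definition rects :: "(nat \<times> nat) set \<Rightarrow> 'w set set" where
  "rects I = {rect F B | F B. finite F \<and> F \<subseteq> I \<and> B ` F \<subseteq> sets \<mu>}"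

definition obs :: "(nat \<times> nat) set \<Rightarrow> 'w measure" where
  "obs I = sigma (space M) (rects I)"

lemma rect_alt: "rect F B = {\<omega> \<in> space M. \<forall>i\<in>F. X (fst i) (snd i) \<omega> \<in> B i}"
  by (simp add: rect_def case_prod_beta')

lemma rect_in_sets:
  assumes "finite F" "B ` F \<subseteq> sets \<mu>"
  shows "rect F B \<in> sets M"
proof -
  have "{\<omega> \<in> space M. X (fst i) (snd i) \<omega> \<in> B i} \<in> sets M" if "i \<in> F" for i
    using measurable_sets[OF meas_X, of "B i" "fst i" "snd i"] assms(2) that by (auto simp: vimage_def Int_def conj_commute)
  then show ?thesis unfolding rect_alt using assms(1) by (intro sets.sets_Collect_finite_All) auto
qed

lemma rects_sub: "rects I \<subseteq> sets M"
  unfolding rects_def using rect_in_sets by auto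

lemma space_obs [simp]: "space (obs I) = space M"
  unfolding obs_def using rects_sub sets.sets_into_space by (intro space_measure_of) blast

lemma sets_obs: "sets (obs I) = sigma_sets (space M) (rects I)"
  unfolding obs_def using rects_sub sets.sets_into_space by (intro sets_measure_of) blast

lemma sets_obs_sub: "sets (obs I) \<subseteq> sets M"
  unfolding sets_obs using rects_sub by (rule sets.sigma_sets_subset)

lemma sets_obs_mono: "I \<subseteq> J \<Longrightarrow> sets (obs I) \<subseteq> sets (obs J)"
  unfolding sets_obs rects_def by (intro sigma_sets_mono') blast

lemma measurable_obs_M: "f \<in> measurable (obs I) N \<Longrightarrow> f \<in> measurable M N"
  using sets_obs_sub by (auto simp: measurable_def)

lemma measurable_X_obs:
  assumes "(k, s) \<in> I"
  shows "X k s \<in> measurable (obs I) \<mu>"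
proof (rule measurableI)
  fix C assume C: "C \<in> sets \<mu>"
  have "X k s -` C \<inter> space (obs I) = rect {(k, s)} (\<lambda>_. C)" by (auto simp: rect_def)
  also have "\<dots> \<in> rects I" using C assms unfolding rects_def by blast
  finally show "X k s -` C \<inter> space (obs I) \<in> sets (obs I)" unfolding sets_obs by auto
qed (use measurable_space[OF meas_X] in auto)

lemma Int_stable_rects: "Int_stable (rects I)"
proof (rule Int_stableI)
  fix R R' assume "R \<in> rects I" "R' \<in> rects I"
  then obtain F B F' B' where R: "R = rect F B" "finite F" "F \<subseteq> I" "B ` F \<subseteq> sets \<mu>"
    and R': "R' = rect F' B'" "finite F'" "F' \<subseteq> I" "B' ` F' \<subseteq> sets \<mu>" unfolding rects_def by blast
  define C where "C i = (if i \<in> F then B i else space \<mu>) \<inter> (if i \<in> F' then B' i else space \<mu>)" for i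
  have "R \<inter> R' = rect (F \<union> F') C"
    using measurable_space[OF meas_X] unfolding R R' rect_alt C_def by (auto split: if_splits)
  moreover have "C ` (F \<union> F') \<subseteq> sets \<mu>" using R R' by (auto simp: C_def)
  ultimately show "R \<inter> R' \<in> rects I" unfolding rects_def using R R' by blast
qed

text \<open>A substitute for conditional expectation: \<open>g\<close> and \<open>g'\<close> are
  weights on the whole space, and equality of their integrals over cylinders extends to all test
  functions by uniqueness of finite measures on a generator.\<close>

lemma obs_integral_eq:
  assumes g [measurable]: "g \<in> borel_measurable M" "g' \<in> borel_measurable M"
    and fin: "(\<integral>\<^sup>+\<omega>. g \<omega> \<partial>M) < \<infinity>"
    and eq: "\<And>R. R \<in> rects I \<Longrightarrow> (\<integral>\<^sup>+\<omega>. indicator R \<omega> * g \<omega> \<partial>M) = (\<integral>\<^sup>+\<omega>. indicator R \<omega> * g' \<omega> \<partial>M)"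
    and f: "f \<in> borel_measurable (obs I)"
  shows "(\<integral>\<^sup>+\<omega>. f \<omega> * g \<omega> \<partial>M) = (\<integral>\<^sup>+\<omega>. f \<omega> * g' \<omega> \<partial>M)"
proof -
  define N where "N h = distr (density M h) (obs I) (\<lambda>\<omega>. \<omega>)" for h :: "'w \<Rightarrow> ennreal"
  have id: "(\<lambda>\<omega>. \<omega>) \<in> measurable (density M h) (obs I)" for h
    using sets_obs_sub by (auto simp: measurable_def sets.sets_into_space)
  have em: "emeasure (N h) A = (\<integral>\<^sup>+\<omega>. indicator A \<omega> * h \<omega> \<partial>M)" if "A \<in> sets (obs I)" and [measurable]: "h \<in> borel_measurable M" for h A
  proof -
    have [measurable]: "A \<in> sets M" using that(1) sets_obs_sub by blast
    have "emeasure (N h) A = emeasure (density M h) A"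
      unfolding N_def using that(1) by (subst emeasure_distr[OF id]) (auto dest: sets.sets_into_space intro!: arg_cong2[where f = emeasure])
    then show ?thesis by (simp add: emeasure_density mult.commute)
  qed
  have "N g = N g'"
  proof (rule measure_eqI_generator_eq[OF Int_stable_rects[of I], where \<Omega> = "space M" and A = "\<lambda>_. space M"])
    show "rects I \<subseteq> Pow (space M)" using rects_sub sets.sets_into_space by blast
    show "sets (N g) = sigma_sets (space M) (rects I)" "sets (N g') = sigma_sets (space M) (rects I)"
      by (simp_all add: N_def sets_obs)
    have "space M = rect {} (\<lambda>_. {})" by (auto simp: rect_def)
    also have "\<dots> \<in> rects I" unfolding rects_def by blast
    finally show "range (\<lambda>_::nat. space M) \<subseteq> rects I" by auto
    have "emeasure (N g) (space M) = (\<integral>\<^sup>+\<omega>. indicator (space M) \<omega> * g \<omega> \<partial>M)"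
      using sets.top[of "obs I"] by (intro em) auto
    also have "\<dots> = (\<integral>\<^sup>+\<omega>. g \<omega> \<partial>M)" by (intro nn_integral_cong) auto
    finally show "emeasure (N g) (space M) \<noteq> \<infinity>" using fin by simp
    show "emeasure (N g) R = emeasure (N g') R" if "R \<in> rects I" for R
      using that em[of R] eq by (auto simp: sets_obs)
  qed auto
  moreover have "(\<integral>\<^sup>+\<omega>. f \<omega> \<partial>N h) = (\<integral>\<^sup>+\<omega>. f \<omega> * h \<omega> \<partial>M)" if [measurable]: "h \<in> borel_measurable M" for h
  proof -
    have [measurable]: "f \<in> borel_measurable M" using f by (rule measurable_obs_M)
    have "f \<in> borel_measurable (distr (density M h) (obs I) (\<lambda>\<omega>. \<omega>))" using f by simp
    from nn_integral_distr[OF id this] show ?thesis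
      unfolding N_def by (simp add: nn_integral_density mult.commute)
  qed
  ultimately show ?thesis using g by metis
qed

section \<open>Decomposition along the values of the change points\<close>

text \<open>Fixing \<open>m\<close> to be 0 beyond the streams makes different \<open>m\<close>
  describe disjoint events, and makes this set the support of a product of geometric laws, hence
  countable.\<close>

definition taus :: "(nat \<Rightarrow> nat) set" where
  "taus = {m. \<forall>k. k \<notin> {..<K} \<longrightarrow> m k = 0}"

definition tau_is :: "(nat \<Rightarrow> nat) \<Rightarrow> 'w set" where
  "tau_is m = {\<omega> \<in> space M. \<forall>k<K. \<tau> k \<omega> = enat (m k)}"

lemma tau_is_in_sets [measurable]: "tau_is m \<in> sets M"
  unfolding tau_is_def by measurable

lemma disjoint_tau_is: "disjoint_family_on tau_is taus"
proof -
  have "m = m'" if "m \<in> taus" "m' \<in> taus" "\<omega> \<in> tau_is m" "\<omega> \<in> tau_is m'" for m m' \<omega>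
  proof
    show "m k = m' k" for k using that unfolding taus_def tau_is_def by (cases "k < K") auto
  qed
  then show ?thesis unfolding disjoint_family_on_def by blast
qed

lemma taus_eq_set_pmf: "taus = set_pmf (Pi_pmf {..<K} 0 (\<lambda>_. geometric_pmf \<theta>))"
  using theta_pos theta_less_1 by (auto simp: set_Pi_pmf taus_def PiE_dflt_def set_pmf_geometric)

lemma countable_taus: "countable taus"
  unfolding taus_eq_set_pmf by simp

lemma emeasure_tau_is: "m \<in> taus \<Longrightarrow> emeasure M (tau_is m) = ennreal (pmf (Pi_pmf {..<K} 0 (\<lambda>_. geometric_pmf \<theta>)) m)"
  using law[of "{}" "\<lambda>_. {}" m] theta_pos theta_less_1
  by (simp add: tau_is_def pmf_Pi taus_def prod_ennreal mult.commute)

text \<open>The probabilities of the atoms \<open>tau_is m\<close> are those of a product of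
  geometric laws and sum to 1. So almost surely all change points are finite, and each event splits
  into countably many pieces on which the product formula of the model applies.\<close>

lemma emeasure_split:
  assumes [measurable]: "E \<in> sets M"
  shows "emeasure M E = (\<integral>\<^sup>+m. emeasure M (E \<inter> tau_is m) \<partial>count_space taus)"
proof -
  let ?P = "Pi_pmf {..<K} 0 (\<lambda>_. geometric_pmf \<theta>)"
  have UN: "(\<Union>m\<in>taus. tau_is m) \<in> sets M" using countable_taus by (intro sets.countable_UN') auto
  have "emeasure M (\<Union>m\<in>taus. tau_is m) = (\<integral>\<^sup>+m. emeasure M (tau_is m) \<partial>count_space taus)"
    using countable_taus disjoint_tau_is by (intro emeasure_UN_countable) auto
  also have "\<dots> = (\<integral>\<^sup>+m. ennreal (pmf ?P m) \<partial>count_space taus)"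
    by (intro nn_integral_cong) (simp add: emeasure_tau_is)
  also have "\<dots> = 1"
    unfolding taus_eq_set_pmf by (subst nn_integral_pmf) (simp add: measure_pmf.emeasure_eq_1_AE AE_measure_pmf)
  finally have ae: "AE \<omega> in M. \<omega> \<in> (\<Union>m\<in>taus. tau_is m)"
    using UN by (intro AE_in_set_eq_1[THEN iffD2]) (auto simp: measure_def)
  have "emeasure M E = emeasure M (\<Union>m\<in>taus. E \<inter> tau_is m)"
    using ae UN countable_taus by (intro emeasure_eq_AE) (auto intro!: sets.countable_UN')
  also have "\<dots> = (\<integral>\<^sup>+m. emeasure M (E \<inter> tau_is m) \<partial>count_space taus)"
    using countable_taus disjoint_tau_is
    by (intro emeasure_UN_countable) (auto simp: disjoint_family_on_def)
  finally show ?thesis .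
qed

text \<open>All other streams are included with their whole future. Hence streams can be advanced
  one after another: when stream \<open>j\<close> moves, others may already have moved.\<close>

definition past :: "nat \<Rightarrow> nat \<Rightarrow> (nat \<times> nat) set" where
  "past j t = {(k, s). k < K \<and> 1 \<le> s \<and> (k = j \<longrightarrow> s \<le> t)}"

abbreviation mass :: "('a \<Rightarrow> real) \<Rightarrow> 'a set \<Rightarrow> ennreal" where
  "mass r C \<equiv> \<integral>\<^sup>+y. indicator C y * ennreal (r y) \<partial>\<nu>"

lemma rect_tau_is:
  assumes "finite F" "F \<subseteq> {(k, t). k < K \<and> 1 \<le> t}" "B ` F \<subseteq> sets \<mu>"
  shows "emeasure M (rect F B \<inter> tau_is m) = (\<Prod>k<K. ennreal (\<theta> * (1 - \<theta>) ^ m k)) *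
          (\<Prod>(k, t)\<in>F. mass (if t \<le> m k then a else b) (B (k, t)))"
proof -
  have "rect F B \<inter> tau_is m = {\<omega> \<in> space M. (\<forall>k<K. \<tau> k \<omega> = enat (m k)) \<and> (\<forall>(k, t)\<in>F. X k t \<omega> \<in> B (k, t))}"
    by (auto simp: rect_def tau_is_def)
  moreover have "(\<integral>\<^sup>+ x \<in> B (k, t). ennreal (if t \<le> m k then p x else q x) \<partial>\<mu>) = mass (if t \<le> m k then a else b) (B (k, t))"
    if "(k, t) \<in> F" for k t
  proof -
    have "(indicator (B (k, t)) :: 'a \<Rightarrow> ennreal) \<in> borel_measurable \<mu>" using that assms(3) by auto
    then show ?thesis by (simp add: nn_integral_a nn_integral_b mult.commute[of "ennreal _"])
  qed
  ultimately show ?thesis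
    by (simp only: law[OF assms]) (intro arg_cong2[where f = times] prod.cong, auto)
qed

lemma rect_tau_is_insert:
  assumes F: "finite F" "F \<subseteq> past j t" "B ` F \<subseteq> sets \<mu>" and j: "j < K" and C: "C \<in> sets \<mu>"
  shows "emeasure M (rect F B \<inter> {\<omega> \<in> space M. X j (Suc t) \<omega> \<in> C} \<inter> tau_is m)
    = mass (if Suc t \<le> m j then a else b) C * emeasure M (rect F B \<inter> tau_is m)"
proof -
  have nin: "(j, Suc t) \<notin> F" using F(2) by (auto simp: past_def)
  define B' where "B' = B((j, Suc t) := C)"
  have B': "B' i = B i" if "i \<in> F" for i using nin that by (auto simp: B'_def)
  have sub: "F \<subseteq> {(k, t). k < K \<and> 1 \<le> t}" using F(2) by (auto simp: past_def)
  have "rect F B \<inter> {\<omega> \<in> space M. X j (Suc t) \<omega> \<in> C} = rect (insert (j, Suc t) F) B'"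
    using nin by (auto simp: rect_def B'_def)
  moreover have "emeasure M (rect (insert (j, Suc t) F) B' \<inter> tau_is m) = (\<Prod>k<K. ennreal (\<theta> * (1 - \<theta>) ^ m k)) *
          (\<Prod>(k, t)\<in>insert (j, Suc t) F. mass (if t \<le> m k then a else b) (B' (k, t)))"
    using F sub j C B' by (intro rect_tau_is) (auto simp: B'_def)
  moreover have "(\<Prod>(k, t)\<in>insert (j, Suc t) F. mass (if t \<le> m k then a else b) (B' (k, t)))
     = mass (if Suc t \<le> m j then a else b) C * (\<Prod>(k, t)\<in>F. mass (if t \<le> m k then a else b) (B (k, t)))"
    using F(1) nin B' by (auto simp: B'_def intro!: prod.cong arg_cong2[where f = times])
  ultimately show ?thesis
    by (simp only: rect_tau_is[OF F(1) sub F(3)] mult_ac)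
qed

text \<open>On every atom of this event the observation at \<open>Suc t\<close> is post-change, so
  the same factor \<open>mass b C\<close> comes out of the sum over atoms.\<close>

lemma after_change:
  assumes F: "finite F" "F \<subseteq> past j t" "B ` F \<subseteq> sets \<mu>" and j: "j < K" and C: "C \<in> sets \<mu>"
  shows "emeasure M (rect F B \<inter> {\<omega> \<in> space M. X j (Suc t) \<omega> \<in> C} \<inter> {\<omega> \<in> space M. \<tau> j \<omega> < enat (Suc t)})
    = mass b C * emeasure M (rect F B \<inter> {\<omega> \<in> space M. \<tau> j \<omega> < enat (Suc t)})"
proof -
  note [measurable] = rect_in_sets[OF F(1,3)] C
  have at: "E \<inter> {\<omega> \<in> space M. \<tau> j \<omega> < enat (Suc t)} \<inter> tau_is m = (if m j < Suc t then E \<inter> tau_is m else {})" for E m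
    using j by (auto simp: tau_is_def)
  show ?thesis
    unfolding emeasure_split[of "rect F B \<inter> {\<omega> \<in> space M. X j (Suc t) \<omega> \<in> C} \<inter> {\<omega> \<in> space M. \<tau> j \<omega> < enat (Suc t)}", simplified]
      emeasure_split[of "rect F B \<inter> {\<omega> \<in> space M. \<tau> j \<omega> < enat (Suc t)}", simplified]
    by (subst nn_integral_cmult[symmetric]) (auto simp: at rect_tau_is_insert[OF F j C] intro!: nn_integral_cong)
qed

text \<open>Memorylessness of the geometric law: raising \<open>m j\<close> by one maps the atoms
  with \<open>t \<le> m j\<close> bijectively onto those with \<open>Suc t \<le> m j\<close> and
  multiplies the prior weight by \<open>1 - \<theta>\<close>. The likelihood of \<open>F\<close> is
  unaffected, since its observations of stream \<open>j\<close> end at \<open>t\<close> and are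
  pre-change either way.\<close>

lemma before_change:
  assumes F: "finite F" "F \<subseteq> past j t" "B ` F \<subseteq> sets \<mu>" and j: "j < K" and C: "C \<in> sets \<mu>"
  shows "emeasure M (rect F B \<inter> {\<omega> \<in> space M. X j (Suc t) \<omega> \<in> C} \<inter> {\<omega> \<in> space M. enat (Suc t) \<le> \<tau> j \<omega>})
    = ennreal (1 - \<theta>) * mass a C * emeasure M (rect F B \<inter> {\<omega> \<in> space M. enat t \<le> \<tau> j \<omega>})"
proof -
  note [measurable] = rect_in_sets[OF F(1,3)] C
  have sub: "F \<subseteq> {(k, t). k < K \<and> 1 \<le> t}" using F(2) by (auto simp: past_def)
  define f where "f m = emeasure M (rect F B \<inter> tau_is m)" for m
  have at: "E \<inter> {\<omega> \<in> space M. enat u \<le> \<tau> j \<omega>} \<inter> tau_is m = (if u \<le> m j then E \<inter> tau_is m else {})" for E m u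
    using j by (auto simp: tau_is_def)
  let ?up = "\<lambda>m. m(j := Suc (m j))"
  have bij: "bij_betw ?up {m \<in> taus. t \<le> m j} {m \<in> taus. Suc t \<le> m j}"
    by (rule bij_betw_byWitness[where f' = "\<lambda>m. m(j := m j - 1)"])
       (use j in \<open>auto simp: taus_def fun_eq_iff\<close>)
  have shift: "f (?up m) = ennreal (1 - \<theta>) * f m" if "t \<le> m j" for m
  proof -
    have "(\<Prod>k<K. ennreal (\<theta> * (1 - \<theta>) ^ ?up m k)) = ennreal (1 - \<theta>) * (\<Prod>k<K. ennreal (\<theta> * (1 - \<theta>) ^ m k))"
    proof -
      have rem: "(\<Prod>k<K. g k) = g j * (\<Prod>k\<in>{..<K} - {j}. g k)" for g :: "nat \<Rightarrow> ennreal"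
        using j by (intro prod.remove) auto
      have "(\<Prod>k\<in>{..<K} - {j}. ennreal (\<theta> * (1 - \<theta>) ^ ?up m k)) = (\<Prod>k\<in>{..<K} - {j}. ennreal (\<theta> * (1 - \<theta>) ^ m k))"
        by (intro prod.cong) auto
      moreover have "ennreal (\<theta> * (1 - \<theta>) ^ ?up m j) = ennreal (1 - \<theta>) * ennreal (\<theta> * (1 - \<theta>) ^ m j)"
        using theta_pos theta_less_1 by (simp add: ennreal_mult[symmetric] mult_ac)
      ultimately show ?thesis unfolding rem by (simp only: mult.assoc)
    qed
    moreover have "(\<Prod>(k, s)\<in>F. mass (if s \<le> ?up m k then a else b) (B (k, s))) = (\<Prod>(k, s)\<in>F. mass (if s \<le> m k then a else b) (B (k, s)))"
      using F(2) that by (intro prod.cong) (auto simp: past_def)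
    ultimately show ?thesis unfolding f_def rect_tau_is[OF F(1) sub F(3)] by (simp only: mult_ac)
  qed
  have restr: "(\<integral>\<^sup>+m. (if u \<le> m j then g m else 0) \<partial>count_space taus) = (\<integral>\<^sup>+m. g m \<partial>count_space {m \<in> taus. u \<le> m j})"
    for u and g :: "_ \<Rightarrow> ennreal"
    by (subst nn_integral_count_space_indicator) (auto simp: nn_integral_count_space_indicator indicator_def intro!: nn_integral_cong)
  have "emeasure M (rect F B \<inter> {\<omega> \<in> space M. X j (Suc t) \<omega> \<in> C} \<inter> {\<omega> \<in> space M. enat (Suc t) \<le> \<tau> j \<omega>})
      = (\<integral>\<^sup>+m. (if Suc t \<le> m j then mass a C * f m else 0) \<partial>count_space taus)"
    by (subst emeasure_split) (auto simp: at rect_tau_is_insert[OF F j C] f_def intro!: nn_integral_cong)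
  also have "\<dots> = mass a C * (\<integral>\<^sup>+m. f m \<partial>count_space {m \<in> taus. Suc t \<le> m j})"
    unfolding restr by (simp add: nn_integral_cmult)
  also have "(\<integral>\<^sup>+m. f m \<partial>count_space {m \<in> taus. Suc t \<le> m j}) = (\<integral>\<^sup>+m. f (?up m) \<partial>count_space {m \<in> taus. t \<le> m j})"
    by (rule nn_integral_bij_count_space[OF bij, symmetric])
  also have "\<dots> = ennreal (1 - \<theta>) * (\<integral>\<^sup>+m. f m \<partial>count_space {m \<in> taus. t \<le> m j})"
    by (subst nn_integral_cmult[symmetric]) (auto simp: shift intro!: nn_integral_cong)
  also have "(\<integral>\<^sup>+m. f m \<partial>count_space {m \<in> taus. t \<le> m j}) = emeasure M (rect F B \<inter> {\<omega> \<in> space M. enat t \<le> \<tau> j \<omega>})"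
    unfolding restr[symmetric]
    by (subst emeasure_split) (auto simp: at f_def intro!: nn_integral_cong)
  finally show ?thesis by (simp only: mult_ac)
qed

section \<open>Recursive posterior of a stream\<close>

text \<open>The start value is 1 because \<open>0 \<le> \<tau> j\<close> is certain. Only
  observations of stream \<open>j\<close> enter: by independence the others carry no information
  about it.\<close>

primrec surv :: "nat \<Rightarrow> nat \<Rightarrow> 'w \<Rightarrow> real" where
  "surv j 0 = (\<lambda>\<omega>. 1)"
| "surv j (Suc t) = (\<lambda>\<omega>. refresh (surv j t \<omega>) (X j (Suc t) \<omega>))"

lemma surv_bounds: "0 \<le> surv j t \<omega>" "surv j t \<omega> \<le> 1"
  by (induction t) (auto intro: refresh_nonneg refresh_le_1)

lemma measurable_surv_obs:
  "(\<And>s. 1 \<le> s \<Longrightarrow> s \<le> t \<Longrightarrow> (j, s) \<in> I) \<Longrightarrow> surv j t \<in> borel_measurable (obs I)"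
proof (induction t)
  case (Suc t)
  then have [measurable]: "surv j t \<in> borel_measurable (obs I)" by simp
  have [measurable]: "X j (Suc t) \<in> measurable (obs I) \<nu>"
    using measurable_X_obs[of j "Suc t" I] Suc.prems by simp
  show ?case by simp
qed simp

lemma measurable_surv [measurable]: "surv j t \<in> borel_measurable M"
  using measurable_surv_obs[of t j UNIV] by (auto intro: measurable_obs_M)

lemma measurable_surv_past: "j < K \<Longrightarrow> surv j t \<in> borel_measurable (obs (past j t))"
  by (rule measurable_surv_obs) (simp add: past_def)

text \<open>Bayes' rule in integrated form: \<open>surv j t\<close> is the conditional probability of \<open>\<tau> j \<ge> t\<close> given
  the other streams and the first \<open>t\<close> observations of stream \<open>j\<close>.\<close>

definition is_posterior :: "nat \<Rightarrow> nat \<Rightarrow> bool" where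
  "is_posterior j t \<longleftrightarrow> (\<forall>f \<in> borel_measurable (obs (past j t)).
     (\<integral>\<^sup>+\<omega>. f \<omega> * indicator {\<omega> \<in> space M. enat t \<le> \<tau> j \<omega>} \<omega> \<partial>M) = (\<integral>\<^sup>+\<omega>. f \<omega> * ennreal (surv j t \<omega>) \<partial>M))"

text \<open>Either the stream survives to \<open>Suc t\<close>, with conditional weight
  \<open>(1 - \<theta>) * surv j t\<close>, and the observation has density \<open>a\<close>, or it
  has changed and the density is \<open>b\<close>. The mixture is the predictive density.\<close>

lemma next_observation_set:
  assumes j: "j < K" and post: "is_posterior j t" and C: "C \<in> sets \<mu>"
    and f: "f \<in> borel_measurable (obs (past j t))"
  shows "(\<integral>\<^sup>+\<omega>. f \<omega> * indicator C (X j (Suc t) \<omega>) \<partial>M)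
    = (\<integral>\<^sup>+\<omega>. f \<omega> * (\<integral>\<^sup>+y. indicator C y * ennreal (pred_dens (surv j t \<omega>) y) \<partial>\<nu>) \<partial>M)"
proof (rule obs_integral_eq[OF _ _ _ _ f])
  note [measurable] = C
  have [measurable]: "indicator C \<in> borel_measurable \<nu>" using C by simp
  have pr: "(\<integral>\<^sup>+y. indicator C y * ennreal (pred_dens (surv j t \<omega>) y) \<partial>\<nu>)
    = ennreal ((1 - \<theta>) * surv j t \<omega>) * mass a C + ennreal (1 - (1 - \<theta>) * surv j t \<omega>) * mass b C" for \<omega>
    by (rule nn_integral_pred_dens[OF surv_bounds]) measurable
  show "(\<lambda>\<omega>. \<integral>\<^sup>+y. indicator C y * ennreal (pred_dens (surv j t \<omega>) y) \<partial>\<nu>) \<in> borel_measurable M"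
    unfolding pr by measurable
  show "(\<lambda>\<omega>. indicator C (X j (Suc t) \<omega>)) \<in> borel_measurable M" by measurable
  have "(\<integral>\<^sup>+\<omega>. indicator C (X j (Suc t) \<omega>) \<partial>M) \<le> (\<integral>\<^sup>+\<omega>. 1 \<partial>M)"
    by (intro nn_integral_mono) (auto simp: indicator_def)
  then show "(\<integral>\<^sup>+\<omega>. indicator C (X j (Suc t) \<omega>) \<partial>M) < \<infinity>" by (simp add: emeasure_space_1 order_le_less_trans)
  fix R assume R: "R \<in> rects (past j t)"
  then obtain F B where FB: "R = rect F B" "finite F" "F \<subseteq> past j t" "B ` F \<subseteq> sets \<mu>" unfolding rects_def by blast
  have [measurable]: "R \<in> sets M" using R rects_sub by blast
  have Robs: "R \<in> sets (obs (past j t))" using R by (simp add: sets_obs)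
  define V where "V = (\<integral>\<^sup>+\<omega>. indicator R \<omega> * ennreal (surv j t \<omega>) \<partial>M)"
  have postR: "emeasure M (R \<inter> {\<omega> \<in> space M. enat t \<le> \<tau> j \<omega>}) = V"
  proof -
    have "(\<integral>\<^sup>+\<omega>. indicator R \<omega> * indicator {\<omega> \<in> space M. enat t \<le> \<tau> j \<omega>} \<omega> \<partial>M) = V"
      using post Robs unfolding is_posterior_def V_def by (auto intro: borel_measurable_indicator)
    then show ?thesis by (subst (asm) indicator_inter_arith[symmetric]) simp
  qed
  have before: "emeasure M (R \<inter> {\<omega> \<in> space M. X j (Suc t) \<omega> \<in> D} \<inter> {\<omega> \<in> space M. enat (Suc t) \<le> \<tau> j \<omega>}) = ennreal (1 - \<theta>) * V * mass a D"
    if "D \<in> sets \<mu>" for D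
    using before_change[OF FB(2-4) j that] postR FB(1) by (simp add: mult_ac)
  have split: "emeasure M E = emeasure M (E \<inter> {\<omega> \<in> space M. enat (Suc t) \<le> \<tau> j \<omega>}) + emeasure M (E \<inter> {\<omega> \<in> space M. \<tau> j \<omega> < enat (Suc t)})"
    if [measurable]: "E \<in> sets M" for E
    using sets.sets_into_space[OF that]
    by (subst plus_emeasure) (auto intro!: arg_cong2[where f = emeasure] simp: not_le)
  define U where "U = (\<integral>\<^sup>+\<omega>. indicator R \<omega> * ennreal (1 - (1 - \<theta>) * surv j t \<omega>) \<partial>M)"
  have lin: "(\<integral>\<^sup>+\<omega>. indicator R \<omega> * ennreal ((1 - \<theta>) * surv j t \<omega>) \<partial>M) = ennreal (1 - \<theta>) * V"
    using theta_less_1 surv_bounds unfolding V_def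
    by (subst nn_integral_cmult[symmetric]) (auto simp: ennreal_mult mult_ac intro!: nn_integral_cong)
  \<comment> \<open>By complement: the pre-change formula for the trivial event
    \<open>space \<mu>\<close> gives the surviving part of \<open>R\<close>, and cancelling this
    finite term from the mass of \<open>R\<close> leaves the changed part.\<close>
  have after: "emeasure M (R \<inter> {\<omega> \<in> space M. \<tau> j \<omega> < enat (Suc t)}) = U"
  proof -
    have "R \<inter> {\<omega> \<in> space M. X j (Suc t) \<omega> \<in> space \<mu>} = R"
      using measurable_space[OF meas_X] sets.sets_into_space[of R M] by auto
    moreover have "mass a (space \<mu>) = 1"
      using int_a by (subst nn_integral_cong[of _ _ "\<lambda>y. ennreal (a y)"]) auto
    ultimately have "emeasure M (R \<inter> {\<omega> \<in> space M. enat (Suc t) \<le> \<tau> j \<omega>}) = ennreal (1 - \<theta>) * V"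
      using before[of "space \<mu>"] by simp
    then have "emeasure M R = ennreal (1 - \<theta>) * V + emeasure M (R \<inter> {\<omega> \<in> space M. \<tau> j \<omega> < enat (Suc t)})"
      using split[of R] by simp
    moreover have "emeasure M R = ennreal (1 - \<theta>) * V + U"
    proof -
      have "ennreal ((1 - \<theta>) * surv j t \<omega>) + ennreal (1 - (1 - \<theta>) * surv j t \<omega>) = 1" for \<omega>
        using prior_bounds[OF surv_bounds] by (simp add: ennreal_plus[symmetric] less_imp_le del: ennreal_plus)
      then have "emeasure M R = (\<integral>\<^sup>+\<omega>. indicator R \<omega> * ennreal ((1 - \<theta>) * surv j t \<omega>) + indicator R \<omega> * ennreal (1 - (1 - \<theta>) * surv j t \<omega>) \<partial>M)"
        by (simp add: distrib_left[symmetric])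
      also have "\<dots> = ennreal (1 - \<theta>) * V + U"
        unfolding lin[symmetric] U_def by (intro nn_integral_add) measurable
      finally show ?thesis .
    qed
    moreover have "ennreal (1 - \<theta>) * V < \<infinity>"
      unfolding postR[symmetric] by (simp add: ennreal_mult_less_top ennreal_mult_eq_top_iff less_top[symmetric])
    ultimately show ?thesis by (metis ennreal_add_left_cancel less_irrefl infinity_ennreal_def)
  qed
  have "(\<integral>\<^sup>+\<omega>. indicator R \<omega> * indicator C (X j (Suc t) \<omega>) \<partial>M) = emeasure M (R \<inter> {\<omega> \<in> space M. X j (Suc t) \<omega> \<in> C})"
  proof -
    have "emeasure M (R \<inter> {\<omega> \<in> space M. X j (Suc t) \<omega> \<in> C})
        = (\<integral>\<^sup>+\<omega>. indicator (R \<inter> {\<omega> \<in> space M. X j (Suc t) \<omega> \<in> C}) \<omega> \<partial>M)" by simp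
    also have "\<dots> = (\<integral>\<^sup>+\<omega>. indicator R \<omega> * indicator C (X j (Suc t) \<omega>) \<partial>M)"
      by (intro nn_integral_cong) (auto simp: indicator_def)
    finally show ?thesis by simp
  qed
  also have "\<dots> = ennreal (1 - \<theta>) * V * mass a C + mass b C * U"
    using before[OF C] after_change[OF FB(2-4) j C, folded FB(1)] after
    by (subst split) auto
  also have "\<dots> = (\<integral>\<^sup>+\<omega>. indicator R \<omega> * ennreal ((1 - \<theta>) * surv j t \<omega>) * mass a C
      + indicator R \<omega> * ennreal (1 - (1 - \<theta>) * surv j t \<omega>) * mass b C \<partial>M)"
    unfolding lin[symmetric] U_def mult.commute[of "mass b C"]
    by (subst nn_integral_add) (auto simp: nn_integral_multc)
  finally show "(\<integral>\<^sup>+\<omega>. indicator R \<omega> * indicator C (X j (Suc t) \<omega>) \<partial>M)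
    = (\<integral>\<^sup>+\<omega>. indicator R \<omega> * (\<integral>\<^sup>+y. indicator C y * ennreal (pred_dens (surv j t \<omega>) y) \<partial>\<nu>) \<partial>M)"
    unfolding pr by (simp add: distrib_left mult.assoc)
qed

text \<open>Both sides are integrals with respect to measures on pairs of past and observation;
  these agree on rectangles, hence everywhere. Jointly measurable \<open>f\<close> are required
  because \<open>refresh\<close> mixes the past with the new observation.\<close>

lemma next_observation:
  assumes j: "j < K" and post: "is_posterior j t"
    and f: "f \<in> borel_measurable (obs (past j t) \<Otimes>\<^sub>M \<mu>)"
  shows "(\<integral>\<^sup>+\<omega>. f (\<omega>, X j (Suc t) \<omega>) \<partial>M)
    = (\<integral>\<^sup>+\<omega>. \<integral>\<^sup>+y. f (\<omega>, y) * ennreal (pred_dens (surv j t \<omega>) y) \<partial>\<nu> \<partial>M)"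
proof -
  let ?O = "obs (past j t) \<Otimes>\<^sub>M \<mu>"
  let ?d = "\<lambda>(\<omega>, y). ennreal (pred_dens (surv j t \<omega>) y)"
  define N1 where "N1 = distr M ?O (\<lambda>\<omega>. (\<omega>, X j (Suc t) \<omega>))"
  \<comment> \<open>The iterated integral read as a measure: a density on the product with the
    finite \<open>\<nu>\<close>, where Tonelli applies, then restricted to the sigma-algebra of the
    past.\<close>
  define N2 where "N2 = distr (density (M \<Otimes>\<^sub>M \<nu>) ?d) ?O (\<lambda>z. z)"
  have idM: "(\<lambda>\<omega>. \<omega>) \<in> measurable M (obs (past j t))"
    by (rule measurable_obs_M[of _ "past j t"]) simp
  have id1: "(\<lambda>\<omega>. (\<omega>, X j (Suc t) \<omega>)) \<in> measurable M ?O"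
    using idM by measurable
  have id2': "(\<lambda>z. z) \<in> measurable (M \<Otimes>\<^sub>M \<nu>) ?O"
    using measurable_Pair[OF measurable_compose[OF measurable_fst idM] measurable_snd, of \<nu>]
    by (simp cong: measurable_cong_sets)
  then have id2: "(\<lambda>z. z) \<in> measurable (density (M \<Otimes>\<^sub>M \<nu>) ?d) ?O" by simp
  have int1: "(\<integral>\<^sup>+z. g z \<partial>N1) = (\<integral>\<^sup>+\<omega>. g (\<omega>, X j (Suc t) \<omega>) \<partial>M)" if "g \<in> borel_measurable ?O" for g
    unfolding N1_def using that by (intro nn_integral_distr[OF id1]) simp
  have int2: "(\<integral>\<^sup>+z. g z \<partial>N2) = (\<integral>\<^sup>+\<omega>. \<integral>\<^sup>+y. g (\<omega>, y) * ennreal (pred_dens (surv j t \<omega>) y) \<partial>\<nu> \<partial>M)" if g: "g \<in> borel_measurable ?O" for g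
  proof -
    have [measurable]: "g \<in> borel_measurable (M \<Otimes>\<^sub>M \<nu>)" using measurable_compose[OF id2' g] by simp
    have "(\<integral>\<^sup>+z. g z \<partial>N2) = (\<integral>\<^sup>+z. g z \<partial>density (M \<Otimes>\<^sub>M \<nu>) ?d)"
      unfolding N2_def using g by (intro nn_integral_distr[OF id2]) simp
    also have "\<dots> = (\<integral>\<^sup>+z. ?d z * g z \<partial>(M \<Otimes>\<^sub>M \<nu>))"
      by (rule nn_integral_density) measurable
    also have "\<dots> = (\<integral>\<^sup>+\<omega>. \<integral>\<^sup>+y. ?d (\<omega>, y) * g (\<omega>, y) \<partial>\<nu> \<partial>M)"
      by (rule nn_integral_fst[symmetric]) measurable
    finally show ?thesis by (simp add: mult.commute)
  qed
  have "N1 = N2"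
  proof (rule measure_eqI_generator_eq[OF Int_stable_pair_measure_generator[of "obs (past j t)" \<mu>],
      where \<Omega> = "space M \<times> space \<mu>" and A = "\<lambda>_. space M \<times> space \<mu>"])
    show "{A \<times> C |A C. A \<in> sets (obs (past j t)) \<and> C \<in> sets \<mu>} \<subseteq> Pow (space M \<times> space \<mu>)"
      using sets.sets_into_space[of _ "obs (past j t)"] sets.sets_into_space[of _ \<mu>] by fastforce
    show "sets N1 = sigma_sets (space M \<times> space \<mu>) {A \<times> C |A C. A \<in> sets (obs (past j t)) \<and> C \<in> sets \<mu>}"
      "sets N2 = sigma_sets (space M \<times> space \<mu>) {A \<times> C |A C. A \<in> sets (obs (past j t)) \<and> C \<in> sets \<mu>}"
      by (simp_all add: N1_def N2_def sets_pair_measure)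
    show "range (\<lambda>_::nat. space M \<times> space \<mu>) \<subseteq> {A \<times> C |A C. A \<in> sets (obs (past j t)) \<and> C \<in> sets \<mu>}"
      using sets.top[of "obs (past j t)"] sets.top[of \<mu>] by auto
    have "prob_space N1" unfolding N1_def by (rule prob_space_distr[OF id1])
    then interpret N1: prob_space N1 .
    show "emeasure N1 (space M \<times> space \<mu>) \<noteq> \<infinity>" by simp
    fix E assume "E \<in> {A \<times> C |A C. A \<in> sets (obs (past j t)) \<and> C \<in> sets \<mu>}"
    then obtain A C where E: "E = A \<times> C" and A: "A \<in> sets (obs (past j t))" and C: "C \<in> sets \<mu>" by blast
    then have Eset: "E \<in> sets ?O" by simp
    then have iE: "indicator E \<in> borel_measurable ?O" by simp
    have "emeasure N1 E = (\<integral>\<^sup>+z. indicator E z \<partial>N1)" using Eset by (simp add: N1_def)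
    also have "\<dots> = (\<integral>\<^sup>+\<omega>. indicator A \<omega> * indicator C (X j (Suc t) \<omega>) \<partial>M)"
      using int1[OF iE] by (simp add: E indicator_times)
    also have "\<dots> = (\<integral>\<^sup>+\<omega>. indicator A \<omega> * (\<integral>\<^sup>+y. indicator C y * ennreal (pred_dens (surv j t \<omega>) y) \<partial>\<nu>) \<partial>M)"
      by (rule next_observation_set[OF j post C]) (use A in simp)
    also have "\<dots> = (\<integral>\<^sup>+z. indicator E z \<partial>N2)"
      unfolding int2[OF iE] using C
      by (intro nn_integral_cong) (simp add: E indicator_times mult.assoc nn_integral_cmult)
    also have "\<dots> = emeasure N2 E" using Eset by (simp add: N2_def)
    finally show "emeasure N1 E = emeasure N2 E" .
  qed auto
  then show ?thesis using int1[OF f] int2[OF f] by simp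
qed

text \<open>By \<open>before_change\<close> and the induction hypothesis, a cylinder has weight
  \<open>(1 - \<theta>) * surv j t\<close> times the \<open>a\<close>-mass of its last factor.
  Writing this integrand as \<open>refresh\<close> times \<open>pred_dens\<close> turns it, by
  \<open>next_observation\<close>, into the integral of the refreshed posterior.\<close>

lemma posterior:
  assumes j: "j < K"
  shows "is_posterior j t"
proof (induction t)
  case 0
  have "{\<omega> \<in> space M. enat 0 \<le> \<tau> j \<omega>} = space M" by (simp add: enat_0)
  then show ?case unfolding is_posterior_def by (auto intro!: nn_integral_cong)
next
  case (Suc t)
  show ?case unfolding is_posterior_def
  proof (rule ballI, rule obs_integral_eq)
    have "(\<integral>\<^sup>+\<omega>. indicator {\<omega> \<in> space M. enat (Suc t) \<le> \<tau> j \<omega>} \<omega> \<partial>M) \<le> (\<integral>\<^sup>+\<omega>. 1 \<partial>M)"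
      by (intro nn_integral_mono) (auto simp: indicator_def)
    then show "(\<integral>\<^sup>+\<omega>. indicator {\<omega> \<in> space M. enat (Suc t) \<le> \<tau> j \<omega>} \<omega> \<partial>M) < \<infinity>"
      by (simp add: emeasure_space_1 order_le_less_trans)
  next
    fix R assume "R \<in> rects (past j (Suc t))"
    then obtain F B where FB: "R = rect F B" "finite F" "F \<subseteq> past j (Suc t)" "B ` F \<subseteq> sets \<mu>" unfolding rects_def by blast
    \<comment> \<open>The condition on stream \<open>j\<close> at time \<open>Suc t\<close> is split
      off; if there is none, \<open>space \<mu>\<close> takes its place.\<close>
    define F' where "F' = F - {(j, Suc t)}"
    define C where "C = (if (j, Suc t) \<in> F then B (j, Suc t) else space \<mu>)"
    have C [measurable]: "C \<in> sets \<mu>" using FB(4) by (auto simp: C_def)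
    have F': "finite F'" "F' \<subseteq> past j t" "B ` F' \<subseteq> sets \<mu>"
      using FB by (auto simp: F'_def past_def le_Suc_eq)
    define A where "A = rect F' B"
    have Aobs: "A \<in> sets (obs (past j t))" using F' unfolding A_def sets_obs rects_def by blast
    then have [measurable]: "A \<in> sets M" using sets_obs_sub by blast
    have R: "R = A \<inter> {\<omega> \<in> space M. X j (Suc t) \<omega> \<in> C}"
      using measurable_space[OF meas_X] unfolding FB(1) A_def rect_alt by (auto simp: F'_def C_def split: if_splits)
    have "(\<integral>\<^sup>+\<omega>. indicator R \<omega> * indicator {\<omega> \<in> space M. enat (Suc t) \<le> \<tau> j \<omega>} \<omega> \<partial>M)
        = emeasure M (A \<inter> {\<omega> \<in> space M. X j (Suc t) \<omega> \<in> C} \<inter> {\<omega> \<in> space M. enat (Suc t) \<le> \<tau> j \<omega>})"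
      unfolding R by (subst indicator_inter_arith[symmetric]) simp
    also have "\<dots> = ennreal (1 - \<theta>) * mass a C * emeasure M (A \<inter> {\<omega> \<in> space M. enat t \<le> \<tau> j \<omega>})"
      unfolding A_def by (rule before_change[OF F' j C])
    also have "emeasure M (A \<inter> {\<omega> \<in> space M. enat t \<le> \<tau> j \<omega>}) = (\<integral>\<^sup>+\<omega>. indicator A \<omega> * indicator {\<omega> \<in> space M. enat t \<le> \<tau> j \<omega>} \<omega> \<partial>M)"
      by (subst indicator_inter_arith[symmetric]) simp
    also have "\<dots> = (\<integral>\<^sup>+\<omega>. indicator A \<omega> * ennreal (surv j t \<omega>) \<partial>M)"
      using Suc.IH Aobs unfolding is_posterior_def by (auto intro: borel_measurable_indicator)
    also have "ennreal (1 - \<theta>) * mass a C * \<dots> = (\<integral>\<^sup>+\<omega>. ennreal (1 - \<theta>) * mass a C * (indicator A \<omega> * ennreal (surv j t \<omega>)) \<partial>M)"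
      by (rule nn_integral_cmult[symmetric]) measurable
    also have "\<dots> = (\<integral>\<^sup>+\<omega>. \<integral>\<^sup>+y. (indicator A \<omega> * (indicator C y * ennreal (refresh (surv j t \<omega>) y))) * ennreal (pred_dens (surv j t \<omega>) y) \<partial>\<nu> \<partial>M)"
    proof (rule nn_integral_cong)
      fix \<omega>
      let ?v = "surv j t \<omega>"
      note v = surv_bounds[of j t \<omega>]
      have [measurable]: "indicator C \<in> borel_measurable \<nu>" using C by simp
      have "ennreal (refresh ?v y) * ennreal (pred_dens ?v y) = ennreal (1 - \<theta>) * ennreal ?v * ennreal (a y)" for y
        using refresh_times_pred_dens[OF v, of y] v theta_less_1 refresh_nonneg[OF v] pred_dens_nonneg[OF v]
        by (simp add: ennreal_mult'[symmetric])
      then have "(\<integral>\<^sup>+y. (indicator A \<omega> * (indicator C y * ennreal (refresh ?v y))) * ennreal (pred_dens ?v y) \<partial>\<nu>)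
         = (\<integral>\<^sup>+y. (indicator A \<omega> * ennreal (1 - \<theta>) * ennreal ?v) * (indicator C y * ennreal (a y)) \<partial>\<nu>)"
        by (simp add: mult_ac)
      also have "\<dots> = (indicator A \<omega> * ennreal (1 - \<theta>) * ennreal ?v) * mass a C"
        by (rule nn_integral_cmult) measurable
      finally show "ennreal (1 - \<theta>) * mass a C * (indicator A \<omega> * ennreal ?v)
        = (\<integral>\<^sup>+y. (indicator A \<omega> * (indicator C y * ennreal (refresh ?v y))) * ennreal (pred_dens ?v y) \<partial>\<nu>)"
        by (simp add: mult_ac)
    qed
    also have "\<dots> = (\<integral>\<^sup>+\<omega>. indicator A \<omega> * (indicator C (X j (Suc t) \<omega>) * ennreal (refresh (surv j t \<omega>) (X j (Suc t) \<omega>))) \<partial>M)"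
    proof -
      note [measurable] = Aobs measurable_surv_past[OF j, of t]
      have [measurable]: "snd \<in> measurable (obs (past j t) \<Otimes>\<^sub>M \<mu>) \<nu>" by measurable
      have "(\<lambda>(\<omega>, y). indicator A \<omega> * (indicator C y * ennreal (refresh (surv j t \<omega>) y))) \<in> borel_measurable (obs (past j t) \<Otimes>\<^sub>M \<mu>)"
        by measurable
      from next_observation[OF j Suc.IH this] show ?thesis by simp
    qed
    also have "\<dots> = (\<integral>\<^sup>+\<omega>. indicator R \<omega> * ennreal (surv j (Suc t) \<omega>) \<partial>M)"
      unfolding R by (intro nn_integral_cong) (auto simp: indicator_def)
    finally show "(\<integral>\<^sup>+\<omega>. indicator R \<omega> * indicator {\<omega> \<in> space M. enat (Suc t) \<le> \<tau> j \<omega>} \<omega> \<partial>M)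
       = (\<integral>\<^sup>+\<omega>. indicator R \<omega> * ennreal (surv j (Suc t) \<omega>) \<partial>M)" .
  qed measurable
qed

end

section \<open>Posterior probabilities and procedures\<close>

context change_model
begin

section \<open>Markov property of the joint state\<close>

text \<open>The value 1 beyond the streams keeps every state in the unit cube and makes the initial
  state constant.\<close>

definition state :: "nat \<Rightarrow> 'w \<Rightarrow> nat \<Rightarrow> real" where
  "state t \<omega> k = (if k < K then surv k t \<omega> else 1)"

definition mixed :: "nat \<Rightarrow> nat \<Rightarrow> 'w \<Rightarrow> nat \<Rightarrow> real" where
  "mixed n t \<omega> k = (if k < n then state (Suc t) \<omega> k else state t \<omega> k)"

abbreviation joint :: "nat \<Rightarrow> 'w measure" where
  "joint t \<equiv> obs ({..<K} \<times> {1..t})"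

lemma in_unit_state: "in_unit (state t \<omega>)"
  using surv_bounds by (simp add: in_unit_def state_def)

lemma measurable_realsI:
  "(\<And>k. (\<lambda>x. g x k) \<in> borel_measurable N) \<Longrightarrow> g \<in> measurable N reals"
  by (rule measurable_PiM_single') auto

lemma measurable_state [measurable]: "state t \<in> measurable M reals"
proof (rule measurable_realsI)
  show "(\<lambda>\<omega>. state t \<omega> k) \<in> borel_measurable M" for k
    unfolding state_def by (cases "k < K") simp_all
qed

lemma measurable_mixed:
  assumes "n < K"
  shows "mixed n t \<in> measurable (obs (past n t)) reals"
proof (rule measurable_realsI)
  fix k
  have "surv k (Suc t) \<in> borel_measurable (obs (past n t))" if "k < n"
    using that assms by (intro measurable_surv_obs) (auto simp: past_def)
  moreover have "surv k t \<in> borel_measurable (obs (past n t))" if "k < K"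
    using that assms by (intro measurable_surv_obs) (auto simp: past_def)
  ultimately show "(\<lambda>\<omega>. mixed n t \<omega> k) \<in> borel_measurable (obs (past n t))"
    using assms unfolding mixed_def state_def by (cases "k < n"; cases "k < K") simp_all
qed

lemma joint_sub_past: "n < K \<Longrightarrow> sets (joint t) \<subseteq> sets (obs (past n t))"
  by (rule sets_obs_mono) (auto simp: past_def)

text \<open>One use of \<open>next_observation\<close> per stream. When stream \<open>n\<close>
  moves, \<open>D\<close> and the partly advanced state are measurable in \<open>past n t\<close>,
  so the move integrates out to \<open>step n\<close>; the induction hypothesis is then applied to
  \<open>step n f\<close>.\<close>

lemma mixed_transition:
  assumes "n \<le> K" "f \<in> borel_measurable reals" "D \<in> sets (joint t)"
  shows "(\<integral>\<^sup>+\<omega>. indicator D \<omega> * f (mixed n t \<omega>) \<partial>M) = (\<integral>\<^sup>+\<omega>. indicator D \<omega> * foldr step [0..<n] f (state t \<omega>) \<partial>M)"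
  using assms(1,2)
proof (induction n arbitrary: f)
  case 0
  then show ?case by (simp add: mixed_def)
next
  case (Suc n)
  then have n: "n < K" by simp
  have D: "D \<in> sets (obs (past n t))" using joint_sub_past[OF n] assms(3) by blast
  note [measurable] = Suc.prems(2) measurable_mixed[OF n, of t] measurable_surv_past[OF n, of t] D
  have [measurable]: "snd \<in> measurable (obs (past n t) \<Otimes>\<^sub>M \<mu>) \<nu>" by measurable
  have upd: "mixed (Suc n) t \<omega> = (mixed n t \<omega>)(n := refresh (surv n t \<omega>) (X n (Suc t) \<omega>))" for \<omega>
    using n by (auto simp: mixed_def state_def fun_eq_iff less_Suc_eq)
  have at_n: "mixed n t \<omega> n = surv n t \<omega>" for \<omega> using n by (simp add: mixed_def state_def)
  have "(\<lambda>z. (mixed n t (fst z))(n := refresh (surv n t (fst z)) (snd z))) \<in> measurable (obs (past n t) \<Otimes>\<^sub>M \<mu>) reals"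
    by (rule measurable_upd_reals) measurable
  from measurable_compose[OF this Suc.prems(2)]
  have [measurable]: "(\<lambda>z. f ((mixed n t (fst z))(n := refresh (surv n t (fst z)) (snd z)))) \<in> borel_measurable (obs (past n t) \<Otimes>\<^sub>M \<mu>)" .
  have meas: "(\<lambda>(\<omega>, y). indicator D \<omega> * f ((mixed n t \<omega>)(n := refresh (surv n t \<omega>) y))) \<in> borel_measurable (obs (past n t) \<Otimes>\<^sub>M \<mu>)"
    unfolding case_prod_beta' by measurable
  have "(\<integral>\<^sup>+\<omega>. indicator D \<omega> * f (mixed (Suc n) t \<omega>) \<partial>M)
      = (\<integral>\<^sup>+\<omega>. \<integral>\<^sup>+y. indicator D \<omega> * f ((mixed n t \<omega>)(n := refresh (surv n t \<omega>) y)) * ennreal (pred_dens (surv n t \<omega>) y) \<partial>\<nu> \<partial>M)"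
    using next_observation[OF n posterior[OF n] meas] by (simp add: upd)
  also have "\<dots> = (\<integral>\<^sup>+\<omega>. indicator D \<omega> * step n f (mixed n t \<omega>) \<partial>M)"
  proof (rule nn_integral_cong)
    fix \<omega>
    have [measurable]: "(\<lambda>y. f ((mixed n t \<omega>)(n := refresh (surv n t \<omega>) y))) \<in> borel_measurable \<nu>"
      by (rule measurable_compose[OF measurable_upd_reals Suc.prems(2)]) measurable
    show "(\<integral>\<^sup>+y. indicator D \<omega> * f ((mixed n t \<omega>)(n := refresh (surv n t \<omega>) y)) * ennreal (pred_dens (surv n t \<omega>) y) \<partial>\<nu>)
        = indicator D \<omega> * step n f (mixed n t \<omega>)"
      unfolding step_def at_n by (subst nn_integral_cmult[symmetric]) (auto simp: mult.assoc)
  qed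
  also have "\<dots> = (\<integral>\<^sup>+\<omega>. indicator D \<omega> * foldr step [0..<n] (step n f) (state t \<omega>) \<partial>M)"
    using Suc.IH[of "step n f"] Suc.prems by simp
  finally show ?case by simp
qed

lemma state_transition:
  assumes "f \<in> borel_measurable reals" "D \<in> sets (joint t)"
  shows "(\<integral>\<^sup>+\<omega>. indicator D \<omega> * f (state (Suc t) \<omega>) \<partial>M) = (\<integral>\<^sup>+\<omega>. indicator D \<omega> * foldr step [0..<K] f (state t \<omega>) \<partial>M)"
proof -
  have "mixed K t \<omega> = state (Suc t) \<omega>" for \<omega> by (auto simp: mixed_def state_def)
  then show ?thesis using mixed_transition[OF order_refl assms] by simp
qed

lemma integrable_unit_bounded:
  fixes h :: "'w \<Rightarrow> real"
  assumes "h \<in> borel_measurable M" "\<And>\<omega>. \<omega> \<in> space M \<Longrightarrow> \<bar>h \<omega>\<bar> \<le> 1"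
  shows "integrable M h"
  using assms by (intro finite_measure.integrable_const_bound[OF prob_space.axioms(1)[OF prob_space_axioms], of _ 1]) auto

section \<open>Filtration of a procedure and its posteriors\<close>

abbreviation "\<F> S t \<equiv> filt M \<mu> X S t"

abbreviation filt_gen :: "(nat \<Rightarrow> 'w \<Rightarrow> nat set) \<Rightarrow> nat \<Rightarrow> 'w set set" where
  "filt_gen S t \<equiv> sets (\<F> S t)
      \<union> {{\<omega> \<in> space M. S (Suc t) \<omega> = A} | A. True}
      \<union> {{\<omega> \<in> space M. k \<in> S (Suc t) \<omega> \<and> X k (Suc t) \<omega> \<in> B} | k B. B \<in> sets \<mu>}"

lemma space_filt [simp]: "space (\<F> S t) = space M"
proof (induction t)
  case (Suc t)
  have "filt_gen S t \<subseteq> Pow (space M)" using sets.sets_into_space[of _ "\<F> S t"] Suc by auto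
  then show ?case by (simp add: space_measure_of)
qed simp

lemma sets_filt_Suc: "sets (\<F> S (Suc t)) = sigma_sets (space M) (filt_gen S t)"
proof -
  have "filt_gen S t \<subseteq> Pow (space M)" using sets.sets_into_space[of _ "\<F> S t"] by auto
  then show ?thesis by (simp add: sets_measure_of)
qed

lemma filt_mono: "sets (\<F> S t) \<subseteq> sets (\<F> S (Suc t))"
  unfolding sets_filt_Suc by blast

lemma active_set_filt: "1 \<le> t \<Longrightarrow> {\<omega> \<in> space M. S t \<omega> = A} \<in> sets (\<F> S t)"
  by (cases t) (auto simp: sets_filt_Suc simp del: filt.simps)

lemma filt_cong:
  "(\<And>s. 1 \<le> s \<Longrightarrow> s \<le> t \<Longrightarrow> S s = S' s) \<Longrightarrow> \<F> S t = \<F> S' t"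
  by (induction t) simp_all

context
  fixes S
  assumes S: "S \<in> procedures M \<mu> K X"
begin

lemma active_first: "\<omega> \<in> space M \<Longrightarrow> S (Suc 0) \<omega> = {..<K}"
  using S unfolding procedures_def by simp

lemma active_antimono: "1 \<le> t \<Longrightarrow> \<omega> \<in> space M \<Longrightarrow> S (Suc t) \<omega> \<subseteq> S t \<omega>"
  using S unfolding procedures_def by blast

lemma active_sub: "\<omega> \<in> space M \<Longrightarrow> S (Suc t) \<omega> \<subseteq> {..<K}"
  by (induction t) (use active_first active_antimono in \<open>auto, fastforce\<close>)

lemma active_predictable: "{\<omega> \<in> space M. S (Suc t) \<omega> = A} \<in> sets (\<F> S t)"
proof (cases "t = 0")
  case True
  have "{\<omega> \<in> space M. S (Suc 0) \<omega> = A} = (if A = {..<K} then space M else {})"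
    using active_first by auto
  then show ?thesis using True sets.top[of "\<F> S 0"] by (simp del: filt.simps)
next
  case False
  then show ?thesis using S unfolding procedures_def by simp
qed

lemma measurable_active: "S (Suc t) \<in> measurable (\<F> S t) (count_space (Pow {..<K}))"
proof (subst measurable_count_space_eq2)
  show "S (Suc t) \<in> space (\<F> S t) \<rightarrow> Pow {..<K} \<and> (\<forall>A\<in>Pow {..<K}. S (Suc t) -` {A} \<inter> space (\<F> S t) \<in> sets (\<F> S t))"
  proof (intro conjI ballI)
    fix A
    have "S (Suc t) -` {A} \<inter> space (\<F> S t) = {\<omega> \<in> space M. S (Suc t) \<omega> = A}" by auto
    then show "S (Suc t) -` {A} \<inter> space (\<F> S t) \<in> sets (\<F> S t)" using active_predictable by simp
  qed (use active_sub in auto)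
qed simp

lemma active_mem: "{\<omega> \<in> space M. k \<in> S (Suc t) \<omega>} \<in> sets (\<F> S t)"
proof -
  have "Measurable.pred (\<F> S t) (\<lambda>\<omega>. k \<in> S (Suc t) \<omega>)"
    by (rule measurable_compose[OF measurable_active]) simp
  then show ?thesis by (simp add: pred_def)
qed

text \<open>Active sets are predictable, so by induction a procedure knows no more than all
  observations up to \<open>t\<close>; indices beyond \<open>K\<close> are never active.\<close>

lemma filt_sub_joint: "sets (\<F> S t) \<subseteq> sets (joint t)"
proof (induction t)
  case 0
  have "sets (\<F> S 0) = {{}, space M}" by (simp add: sigma_sets_empty_eq)
  then show ?case using sets.top[of "joint 0"] by auto
next
  case (Suc t)
  have mono: "sets (joint t) \<subseteq> sets (joint (Suc t))" by (rule sets_obs_mono) auto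
  have "{\<omega> \<in> space M. k \<in> S (Suc t) \<omega> \<and> X k (Suc t) \<omega> \<in> B} \<in> sets (joint (Suc t))" if B: "B \<in> sets \<mu>" for k B
  proof (cases "k < K")
    case True
    have "{\<omega> \<in> space M. k \<in> S (Suc t) \<omega> \<and> X k (Suc t) \<omega> \<in> B} = {\<omega> \<in> space M. k \<in> S (Suc t) \<omega>} \<inter> (X k (Suc t) -` B \<inter> space (joint (Suc t)))"
      by auto
    also have "\<dots> \<in> sets (joint (Suc t))"
    proof (rule sets.Int)
      show "{\<omega> \<in> space M. k \<in> S (Suc t) \<omega>} \<in> sets (joint (Suc t))" using active_mem Suc mono by blast
      show "X k (Suc t) -` B \<inter> space (joint (Suc t)) \<in> sets (joint (Suc t))"
        using True by (intro measurable_sets[OF measurable_X_obs B]) auto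
    qed
    finally show ?thesis .
  next
    case False
    then have empty: "{\<omega> \<in> space M. k \<in> S (Suc t) \<omega> \<and> X k (Suc t) \<omega> \<in> B} = {}" using active_sub by fastforce
    show ?thesis unfolding empty by (rule sets.empty_sets)
  qed
  moreover have "{\<omega> \<in> space M. S (Suc t) \<omega> = A} \<in> sets (joint (Suc t))" for A
    using Suc mono active_predictable[of t A] by blast
  ultimately have "filt_gen S t \<subseteq> sets (joint (Suc t))"
    using Suc mono by blast
  then have "sigma_sets (space (joint (Suc t))) (filt_gen S t) \<subseteq> sets (joint (Suc t))" by (rule sets.sigma_sets_subset)
  then show ?case unfolding sets_filt_Suc by simp
qed

lemma subalgebra_filt: "subalgebra M (\<F> S t)"
  unfolding subalgebra_def using filt_sub_joint[of t] sets_obs_sub by auto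

lemma measurable_filt_M: "f \<in> measurable (\<F> S t) N \<Longrightarrow> f \<in> measurable M N"
  using subalgebra_filt[of t] by (rule measurable_from_subalg)

text \<open>After a drop, \<open>surv k t\<close> depends on observations the procedure has not
  made. While \<open>k\<close> is active all its observations have been seen, since active sets
  decrease; putting a fixed point \<open>y\<close> for unseen values gives a measurable version that
  is correct on the active event.\<close>

lemma surv_version:
  assumes k: "k < K"
  shows "\<exists>Z \<in> borel_measurable (\<F> S t). \<forall>\<omega>\<in>space M. t = 0 \<or> k \<in> S t \<omega> \<longrightarrow> Z \<omega> = surv k t \<omega>"
proof (induction t)
  case 0
  then show ?case by (intro bexI[of _ "\<lambda>_. 1"]) auto
next
  case (Suc t)
  then obtain Z where Z: "Z \<in> borel_measurable (\<F> S t)" "\<And>\<omega>. \<omega> \<in> space M \<Longrightarrow> t = 0 \<or> k \<in> S t \<omega> \<Longrightarrow> Z \<omega> = surv k t \<omega>" by blast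
  have [measurable]: "Z \<in> borel_measurable (\<F> S (Suc t))"
    using Z(1) filt_mono[of S t] by (auto simp: measurable_def simp del: filt.simps)
  have "space \<mu> \<noteq> {}" using int_p by (metis nn_integral_empty zero_neq_one)
  then obtain y where y: "y \<in> space \<mu>" by blast
  define Y where "Y \<omega> = (if k \<in> S (Suc t) \<omega> then X k (Suc t) \<omega> else y)" for \<omega>
  have "Y \<in> measurable (\<F> S (Suc t)) \<mu>"
  proof (rule measurableI)
    fix B assume B: "B \<in> sets \<mu>"
    have 1: "{\<omega> \<in> space M. k \<in> S (Suc t) \<omega> \<and> X k (Suc t) \<omega> \<in> B} \<in> sets (\<F> S (Suc t))"
      unfolding sets_filt_Suc using B by blast
    have "{\<omega> \<in> space M. k \<in> S (Suc t) \<omega>} \<in> sets (\<F> S (Suc t))" using active_mem filt_mono by blast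
    then have "space (\<F> S (Suc t)) - {\<omega> \<in> space M. k \<in> S (Suc t) \<omega>} \<in> sets (\<F> S (Suc t))" by blast
    then have 2: "{\<omega> \<in> space M. k \<notin> S (Suc t) \<omega>} \<in> sets (\<F> S (Suc t))" by (simp add: set_diff_eq del: filt.simps cong: conj_cong)
    have "Y -` B \<inter> space (\<F> S (Suc t)) = {\<omega> \<in> space M. k \<in> S (Suc t) \<omega> \<and> X k (Suc t) \<omega> \<in> B} \<union> (if y \<in> B then {\<omega> \<in> space M. k \<notin> S (Suc t) \<omega>} else {})"
      by (auto simp: Y_def simp del: filt.simps split: if_splits)
    then show "Y -` B \<inter> space (\<F> S (Suc t)) \<in> sets (\<F> S (Suc t))" using 1 2 by (auto simp del: filt.simps)
  qed (use y measurable_space[OF meas_X] in \<open>auto simp: Y_def simp del: filt.simps\<close>)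
  then have [measurable]: "Y \<in> measurable (\<F> S (Suc t)) \<nu>" by (simp cong: measurable_cong_sets del: filt.simps)
  show ?case
  proof (intro bexI ballI impI)
    show "(\<lambda>\<omega>. refresh (Z \<omega>) (Y \<omega>)) \<in> borel_measurable (\<F> S (Suc t))" by measurable
    fix \<omega> assume \<omega>: "\<omega> \<in> space M" "Suc t = 0 \<or> k \<in> S (Suc t) \<omega>"
    then have "t = 0 \<or> k \<in> S t \<omega>" using active_antimono[of t \<omega>] by (cases t) auto
    then show "refresh (Z \<omega>) (Y \<omega>) = surv k (Suc t) \<omega>" using \<omega> Z(2) by (simp add: Y_def)
  qed
qed

text \<open>That \<open>k\<close> is active is known to the procedure, and on this event so is
  \<open>surv k t\<close>. The posterior identity for the full past therefore restricts to the
  smaller sigma-algebra after multiplication with the indicator \<open>I\<close>.\<close>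

lemma post_eq_surv:
  assumes k: "k < K" and t: "1 \<le> t"
  shows "AE \<omega> in M. k \<in> S t \<omega> \<longrightarrow> post M \<mu> X \<tau> S k t \<omega> = 1 - surv k t \<omega>"
proof -
  interpret finite_measure_subalgebra M "\<F> S t"
    by unfold_locales (rule subalgebra_filt)
  obtain Z where Z: "Z \<in> borel_measurable (\<F> S t)" "\<And>\<omega>. \<omega> \<in> space M \<Longrightarrow> k \<in> S t \<omega> \<Longrightarrow> Z \<omega> = surv k t \<omega>"
    using surv_version[OF k, of t] by blast
  have kS: "{\<omega> \<in> space M. k \<in> S t \<omega>} \<in> sets (\<F> S t)"
    using active_mem[of k "t - 1"] filt_mono[of S "t - 1"] t by auto
  define I :: "'w \<Rightarrow> real" where "I = indicator {\<omega> \<in> space M. k \<in> S t \<omega>}"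
  have IF: "I \<in> borel_measurable (\<F> S t)" unfolding I_def using kS by simp
  note [measurable] = IF Z(1) measurable_filt_M[OF IF] measurable_filt_M[OF Z(1)]
  let ?c = "indicator {\<omega>. \<tau> k \<omega> < enat t} :: 'w \<Rightarrow> real"
  \<comment> \<open>The event in \<open>post\<close> ranges over the whole type; its indicator is
    measurable because it agrees on \<open>space M\<close> with that of a measurable event.\<close>
  have ind: "?c \<in> borel_measurable M \<longleftrightarrow> indicator {\<omega> \<in> space M. \<tau> k \<omega> < enat t} \<in> (borel_measurable M :: ('w \<Rightarrow> real) set)"
    by (rule measurable_cong) (auto simp: indicator_def)
  have [measurable]: "?c \<in> borel_measurable M" unfolding ind by measurable
  have Ic: "integrable M (\<lambda>\<omega>. I \<omega> * ?c \<omega>)"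
  proof (rule integrable_unit_bounded)
    show "(\<lambda>\<omega>. I \<omega> * ?c \<omega>) \<in> borel_measurable M" by measurable
  qed (auto simp: I_def indicator_def)
  have mult: "AE \<omega> in M. real_cond_exp M (\<F> S t) (\<lambda>\<omega>. I \<omega> * ?c \<omega>) \<omega> = I \<omega> * post M \<mu> X \<tau> S k t \<omega>"
    unfolding post_def
  proof (rule real_cond_exp_mult)
    show "integrable M (\<lambda>\<omega>. I \<omega> * ?c \<omega>)" by (rule Ic)
  qed measurable
  have Z1: "I \<omega> * (1 - Z \<omega>) = I \<omega> * (1 - surv k t \<omega>)" if "\<omega> \<in> space M" for \<omega>
    using Z(2) that by (auto simp: I_def indicator_def)
  have char: "AE \<omega> in M. real_cond_exp M (\<F> S t) (\<lambda>\<omega>. I \<omega> * ?c \<omega>) \<omega> = I \<omega> * (1 - Z \<omega>)"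
  proof (rule real_cond_exp_charact)
    show "integrable M (\<lambda>\<omega>. I \<omega> * ?c \<omega>)" by (rule Ic)
    show "integrable M (\<lambda>\<omega>. I \<omega> * (1 - Z \<omega>))"
    proof (rule integrable_unit_bounded)
      show "(\<lambda>\<omega>. I \<omega> * (1 - Z \<omega>)) \<in> borel_measurable M" by measurable
      show "\<bar>I \<omega> * (1 - Z \<omega>)\<bar> \<le> 1" if "\<omega> \<in> space M" for \<omega>
        unfolding Z1[OF that] using surv_bounds[of k t \<omega>] by (auto simp: I_def indicator_def)
    qed
    fix A assume A: "A \<in> sets (\<F> S t)"
    define E where "E = A \<inter> {\<omega> \<in> space M. k \<in> S t \<omega>}"
    have EF: "E \<in> sets (\<F> S t)" unfolding E_def using A kS by blast
    then have "E \<in> sets (obs (past k t))" using filt_sub_joint joint_sub_past[OF k] by blast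
    then have "(\<integral>\<^sup>+\<omega>. indicator E \<omega> * indicator {\<omega> \<in> space M. enat t \<le> \<tau> k \<omega>} \<omega> \<partial>M) = (\<integral>\<^sup>+\<omega>. indicator E \<omega> * ennreal (surv k t \<omega>) \<partial>M)"
      using posterior[OF k, of t] unfolding is_posterior_def by auto
    moreover have [measurable]: "E \<in> sets M" using EF subalgebra_filt[of t] unfolding subalgebra_def by blast
    then have "(\<integral>\<omega>. indicator E \<omega> * indicator {\<omega> \<in> space M. enat t \<le> \<tau> k \<omega>} \<omega> \<partial>M) = enn2real (\<integral>\<^sup>+\<omega>. indicator E \<omega> * indicator {\<omega> \<in> space M. enat t \<le> \<tau> k \<omega>} \<omega> \<partial>M)"
      by (subst integral_eq_nn_integral) (auto intro!: arg_cong[where f = enn2real] nn_integral_cong simp: indicator_def)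
    moreover have "(\<integral>\<omega>. indicator E \<omega> * surv k t \<omega> \<partial>M) = enn2real (\<integral>\<^sup>+\<omega>. indicator E \<omega> * ennreal (surv k t \<omega>) \<partial>M)"
      using surv_bounds by (subst integral_eq_nn_integral) (auto intro!: arg_cong[where f = enn2real] nn_integral_cong simp: indicator_def)
    ultimately have eq: "(\<integral>\<omega>. indicator E \<omega> * indicator {\<omega> \<in> space M. enat t \<le> \<tau> k \<omega>} \<omega> \<partial>M) = (\<integral>\<omega>. indicator E \<omega> * surv k t \<omega> \<partial>M)" by simp
    have int1: "integrable M (\<lambda>\<omega>. indicator E \<omega> * (indicator {\<omega> \<in> space M. enat t \<le> \<tau> k \<omega>} \<omega> :: real))"
      by (rule integrable_unit_bounded) (auto simp: indicator_def)
    have int2: "integrable M (\<lambda>\<omega>. indicator E \<omega> * surv k t \<omega>)"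
      using surv_bounds by (intro integrable_unit_bounded) (auto simp: indicator_def)
    have int0: "integrable M (indicator E :: 'w \<Rightarrow> real)"
      by (rule integrable_unit_bounded) (auto simp: indicator_def)
    have "(\<integral>\<omega>\<in>A. I \<omega> * ?c \<omega> \<partial>M) = (\<integral>\<omega>. indicator E \<omega> - indicator E \<omega> * indicator {\<omega> \<in> space M. enat t \<le> \<tau> k \<omega>} \<omega> \<partial>M)"
      unfolding set_lebesgue_integral_def by (intro Bochner_Integration.integral_cong) (auto simp: indicator_def I_def E_def)
    also have "\<dots> = (\<integral>\<omega>. indicator E \<omega> - indicator E \<omega> * surv k t \<omega> \<partial>M)"
      using eq int0 int1 int2 by (simp add: Bochner_Integration.integral_diff)
    also have "\<dots> = (\<integral>\<omega>\<in>A. I \<omega> * (1 - Z \<omega>) \<partial>M)"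
      unfolding set_lebesgue_integral_def by (intro Bochner_Integration.integral_cong) (auto simp: Z(2) indicator_def I_def E_def)
    finally show "(\<integral>\<omega>\<in>A. I \<omega> * ?c \<omega> \<partial>M) = (\<integral>\<omega>\<in>A. I \<omega> * (1 - Z \<omega>) \<partial>M)" .
  qed measurable
  show ?thesis using mult char AE_space
    by eventually_elim (auto simp: Z(2) I_def indicator_def)
qed

text \<open>The next active set is predictable, so the weights \<open>g k\<close> can be taken out
  of the conditional expectation.\<close>

lemma LFNR_eq_post:
  "AE \<omega> in M. LFNR M \<mu> X \<tau> S t \<omega> = (\<Sum>k\<in>S (Suc t) \<omega>. post M \<mu> X \<tau> S k t \<omega>) / real (max (card (S (Suc t) \<omega>)) 1)"
proof -
  interpret finite_measure_subalgebra M "\<F> S t"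
    by unfold_locales (rule subalgebra_filt)
  define g :: "nat \<Rightarrow> 'w \<Rightarrow> real" where "g k \<omega> = indicator (S (Suc t) \<omega>) k / real (max (card (S (Suc t) \<omega>)) 1)" for k \<omega>
  have gF: "g k \<in> borel_measurable (\<F> S t)" for k
    unfolding g_def by (rule measurable_compose[OF measurable_active]) simp
  have g_bound: "0 \<le> g k \<omega>" "g k \<omega> \<le> 1" for k \<omega>
    by (auto simp: g_def indicator_def divide_le_eq)
  note [measurable] = gF measurable_filt_M[OF gF]
  let ?c = "\<lambda>k. indicator {\<omega>. \<tau> k \<omega> < enat t} :: 'w \<Rightarrow> real"
  have ind: "?c k \<in> borel_measurable M \<longleftrightarrow> indicator {\<omega> \<in> space M. \<tau> k \<omega> < enat t} \<in> (borel_measurable M :: ('w \<Rightarrow> real) set)" for k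
    by (rule measurable_cong) (auto simp: indicator_def)
  have [measurable]: "?c k \<in> borel_measurable M" for k unfolding ind by measurable
  have int: "integrable M (\<lambda>\<omega>. g k \<omega> * ?c k \<omega>)" for k
  proof (rule integrable_unit_bounded)
    show "(\<lambda>\<omega>. g k \<omega> * ?c k \<omega>) \<in> borel_measurable M" by measurable
  qed (use g_bound in \<open>auto simp: indicator_def\<close>)
  have sum_g: "(\<Sum>k<K. g k \<omega> * h k) = (\<Sum>k\<in>S (Suc t) \<omega>. h k) / real (max (card (S (Suc t) \<omega>)) 1)" if "\<omega> \<in> space M" for h \<omega>
  proof -
    have "(\<Sum>k<K. g k \<omega> * h k) = (\<Sum>k<K. indicator (S (Suc t) \<omega>) k * h k) / real (max (card (S (Suc t) \<omega>)) 1)"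
      by (simp only: g_def sum_divide_distrib times_divide_eq_left)
    also have "(\<Sum>k<K. indicator (S (Suc t) \<omega>) k * h k) = (\<Sum>k\<in>S (Suc t) \<omega>. h k)"
      using active_sub[OF that, of t] by (intro sum.mono_neutral_cong_right) (auto simp: indicator_def)
    finally show ?thesis .
  qed
  have FNP_g: "FNP \<tau> S t \<omega> = (\<Sum>k<K. g k \<omega> * ?c k \<omega>)" if "\<omega> \<in> space M" for \<omega>
    unfolding FNP_def by (rule sum_g[OF that, symmetric])
  have "AE \<omega> in M. LFNR M \<mu> X \<tau> S t \<omega> = real_cond_exp M (\<F> S t) (\<lambda>\<omega>. \<Sum>k<K. g k \<omega> * ?c k \<omega>) \<omega>"
    unfolding LFNR_def
  proof (rule real_cond_exp_cong)
    show "AE \<omega> in M. FNP \<tau> S t \<omega> = (\<Sum>k<K. g k \<omega> * ?c k \<omega>)"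
      by (intro AE_I2 FNP_g)
    have "FNP \<tau> S t \<in> borel_measurable M \<longleftrightarrow> (\<lambda>\<omega>. \<Sum>k<K. g k \<omega> * ?c k \<omega>) \<in> borel_measurable M"
      by (rule measurable_cong) (rule FNP_g)
    moreover have "(\<lambda>\<omega>. \<Sum>k<K. g k \<omega> * ?c k \<omega>) \<in> borel_measurable M" by measurable
    ultimately show "FNP \<tau> S t \<in> borel_measurable M" by (rule iffD2)
  qed measurable
  moreover have "AE \<omega> in M. real_cond_exp M (\<F> S t) (\<lambda>\<omega>. \<Sum>k\<in>{..<K}. g k \<omega> * ?c k \<omega>) \<omega> = (\<Sum>k\<in>{..<K}. real_cond_exp M (\<F> S t) (\<lambda>\<omega>. g k \<omega> * ?c k \<omega>) \<omega>)"
    by (rule real_cond_exp_sum) (rule int)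
  moreover have "AE \<omega> in M. \<forall>k\<in>{..<K}. real_cond_exp M (\<F> S t) (\<lambda>\<omega>. g k \<omega> * ?c k \<omega>) \<omega> = g k \<omega> * post M \<mu> X \<tau> S k t \<omega>"
    unfolding post_def by (intro AE_finite_allI real_cond_exp_mult int) measurable
  ultimately show ?thesis using AE_space
    by eventually_elim (simp add: sum_g)
qed

lemma post_eq_state:
  assumes "1 \<le> t"
  shows "AE \<omega> in M. \<forall>k\<in>S t \<omega>. post M \<mu> X \<tau> S k t \<omega> = 1 - state t \<omega> k"
proof -
  have "AE \<omega> in M. \<forall>k\<in>{..<K}. k \<in> S t \<omega> \<longrightarrow> post M \<mu> X \<tau> S k t \<omega> = 1 - surv k t \<omega>"
    using assms by (intro AE_finite_allI post_eq_surv) auto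
  then show ?thesis using AE_space
  proof eventually_elim
    case (elim \<omega>)
    have "S t \<omega> \<subseteq> {..<K}" using active_sub[OF elim(2), of "t - 1"] assms by simp
    then show ?case using elim(1) by (auto simp: state_def subset_iff)
  qed
qed

text \<open>The set for time \<open>Suc t\<close> lies inside the set for time \<open>t\<close>,
  where states are the posteriors. If it is empty both conditions hold: the rate is 0, and
  feasibility reads \<open>0 \<le> 0\<close>.\<close>

lemma LFNR_le_iff_feasible:
  assumes "1 \<le> t" "0 < \<alpha>"
  shows "AE \<omega> in M. LFNR M \<mu> X \<tau> S t \<omega> \<le> \<alpha> \<longleftrightarrow> feasible \<alpha> (S (Suc t) \<omega>) (state t \<omega>)"
  using LFNR_eq_post[of t] post_eq_state[OF assms(1)] AE_space
proof eventually_elim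
  case (elim \<omega>)
  have eq: "(\<Sum>k\<in>S (Suc t) \<omega>. post M \<mu> X \<tau> S k t \<omega>) = (\<Sum>k\<in>S (Suc t) \<omega>. 1 - state t \<omega> k)"
    using elim active_antimono[OF assms(1) elim(3)] by (intro sum.cong) auto
  moreover have fin: "finite (S (Suc t) \<omega>)" using active_sub[OF elim(3), of t] by (rule finite_subset) simp
  ultimately show ?case using elim(1) assms(2)
  proof (cases "S (Suc t) \<omega> = {}")
    case False
    then have "0 < card (S (Suc t) \<omega>)" using fin by (simp add: card_gt_0_iff)
    moreover from this have "max (card (S (Suc t) \<omega>)) 1 = card (S (Suc t) \<omega>)" by simp
    ultimately show ?thesis using elim(1) eq by (simp add: feasible_def divide_le_eq)
  qed (simp add: feasible_def)
qed

end

section \<open>Admissibility of the greedy procedure\<close>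

context
  fixes \<alpha> :: real
  assumes \<alpha>: "0 < \<alpha>"
begin

abbreviation "T \<equiv> tstar M \<mu> K X \<tau> \<alpha>"

lemma tstar_aux_eq: "s \<le> Suc n \<Longrightarrow> tstar_aux M \<mu> K X \<tau> \<alpha> n s = T s"
proof -
  have stable: "s \<le> Suc m \<Longrightarrow> tstar_aux M \<mu> K X \<tau> \<alpha> (m + d) s = tstar_aux M \<mu> K X \<tau> \<alpha> m s" for m d s
    by (induction d) (auto simp: Let_def)
  assume "s \<le> Suc n"
  then consider "s \<le> n" | "s = Suc n" by linarith
  then show ?thesis
  proof cases
    case 1
    then show ?thesis unfolding tstar_def using stable[of s s "n - s"] by simp
  next
    case 2
    then show ?thesis unfolding tstar_def using stable[of s n 1] by simp
  qed
qed

lemma T_first: "T (Suc 0) \<omega> = {..<K}"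
  using tstar_aux_eq[of "Suc 0" 0] by (metis le_refl tstar_aux.simps(1))

text \<open>The filtration at \<open>t\<close> depends only on active sets up to \<open>t\<close>,
  where the partial construction and the final procedure coincide; hence so do their
  posteriors.\<close>

lemma T_Suc:
  assumes "1 \<le> t"
  shows "T (Suc t) \<omega> = update \<alpha> (T t \<omega>) (\<lambda>k. post M \<mu> X \<tau> T k t \<omega>)"
proof -
  obtain n where t: "t = Suc n" using assms by (cases t) auto
  let ?S = "tstar_aux M \<mu> K X \<tau> \<alpha> n"
  have "\<F> ?S t = \<F> T t" using t by (intro filt_cong) (simp add: tstar_aux_eq)
  then have "post M \<mu> X \<tau> ?S k t \<omega> = post M \<mu> X \<tau> T k t \<omega>" for k by (simp add: post_def)
  moreover have "T (Suc t) \<omega> = tstar_aux M \<mu> K X \<tau> \<alpha> (Suc n) (Suc t) \<omega>" using t by (subst tstar_aux_eq) auto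
  ultimately show ?thesis using t tstar_aux_eq[of t n] by (simp add: Let_def)
qed

lemma finite_T: "1 \<le> t \<Longrightarrow> T t \<omega> \<subseteq> {..<K} \<and> finite (T t \<omega>)"
proof (induction t rule: dec_induct)
  case base
  then show ?case using T_first by simp
next
  case (step t)
  then have "greedy \<alpha> (T t \<omega>) (\<lambda>k. post M \<mu> X \<tau> T k t \<omega>) (T (Suc t) \<omega>)"
    using T_Suc[of t \<omega>] \<alpha> by (simp add: greedy_update)
  then have "T (Suc t) \<omega> \<subseteq> T t \<omega>" unfolding greedy_def by blast
  then show ?case using step by (meson finite_subset order_trans)
qed

lemma T_greedy: "1 \<le> t \<Longrightarrow> greedy \<alpha> (T t \<omega>) (\<lambda>k. post M \<mu> X \<tau> T k t \<omega>) (T (Suc t) \<omega>)"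
  using T_Suc[of t \<omega>] finite_T[of t \<omega>] \<alpha> by (simp add: greedy_update)

lemma measurable_greedy:
  assumes [measurable]: "\<And>k. W k \<in> borel_measurable N" and "finite S"
  shows "{\<omega> \<in> space N. greedy \<alpha> S (\<lambda>k. W k \<omega>) A} \<in> sets N"
proof (cases "A \<subseteq> S")
  case True
  have fin: "finite A" "finite (S - A)" "finite (Pow S)" using True assms(2) by (auto intro: finite_subset)
  have "Measurable.pred N (\<lambda>\<omega>. \<forall>b\<in>A. \<forall>x\<in>S - A. rank_less (\<lambda>k. W k \<omega>) b x)"
    by (intro pred_intros_finite fin) measurable
  moreover have "Measurable.pred N (\<lambda>\<omega>. \<forall>B\<in>Pow S. (\<Sum>k\<in>B. W k \<omega>) \<le> \<alpha> * real (card B) \<longrightarrow> card B \<le> card A)"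
    by (intro pred_intros_finite fin) measurable
  ultimately have "Measurable.pred N (\<lambda>\<omega>. greedy \<alpha> S (\<lambda>k. W k \<omega>) A)"
    unfolding greedy_def by measurable
  then show ?thesis by (simp add: pred_def)
qed (simp add: greedy_def)

lemma T_procedure: "T \<in> procedures M \<mu> K X"
  unfolding procedures_def
proof (intro CollectI conjI allI impI ballI)
  show "T 1 \<omega> = {..<K}" for \<omega> using T_first by simp
  show "T (Suc t) \<omega> \<subseteq> T t \<omega>" if "1 \<le> t" for t \<omega>
    using T_greedy[OF that] unfolding greedy_def by blast
  show "{\<omega> \<in> space M. T (Suc t) \<omega> = A} \<in> sets (\<F> T t)" if t: "1 \<le> t" for t A
  proof -
    \<comment> \<open>Splitting along the finitely many active sets replaces the update of a random
      set by the predicate \<open>greedy\<close> for each fixed \<open>B\<close>.\<close>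
    have "{\<omega> \<in> space M. T (Suc t) \<omega> = A} = (\<Union>B\<in>Pow {..<K}. {\<omega> \<in> space M. T t \<omega> = B} \<inter>
        {\<omega> \<in> space (\<F> T t). greedy \<alpha> B (\<lambda>k. post M \<mu> X \<tau> T k t \<omega>) A})"
    proof (rule set_eqI)
      fix \<omega>
      have "T (Suc t) \<omega> = A \<longleftrightarrow> greedy \<alpha> (T t \<omega>) (\<lambda>k. post M \<mu> X \<tau> T k t \<omega>) A"
        unfolding T_Suc[OF t] using finite_T[OF t, of \<omega>] \<alpha> by (intro update_eq_iff) auto
      then show "\<omega> \<in> {\<omega> \<in> space M. T (Suc t) \<omega> = A} \<longleftrightarrow> \<omega> \<in> (\<Union>B\<in>Pow {..<K}. {\<omega> \<in> space M. T t \<omega> = B} \<inter>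
        {\<omega> \<in> space (\<F> T t). greedy \<alpha> B (\<lambda>k. post M \<mu> X \<tau> T k t \<omega>) A})"
        using finite_T[OF t, of \<omega>] by auto
    qed
    also have "\<dots> \<in> sets (\<F> T t)"
    proof (intro sets.finite_UN sets.Int measurable_greedy)
      show "{\<omega> \<in> space M. T t \<omega> = B} \<in> sets (\<F> T t)" for B using t by (rule active_set_filt)
      show "(\<lambda>\<omega>. post M \<mu> X \<tau> T k t \<omega>) \<in> borel_measurable (\<F> T t)" for k
        unfolding post_def by (rule borel_measurable_cond_exp)
    qed (auto intro: finite_subset)
    finally show ?thesis .
  qed
qed

lemma T_greedy_state:
  assumes "1 \<le> t"
  shows "AE \<omega> in M. greedy \<alpha> (T t \<omega>) (\<lambda>k. 1 - state t \<omega> k) (T (Suc t) \<omega>)"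
  using post_eq_state[OF T_procedure assms]
proof eventually_elim
  case (elim \<omega>)
  then show ?case using T_greedy[OF assms, of \<omega>] greedy_cong[of "T t \<omega>" "\<lambda>k. post M \<mu> X \<tau> T k t \<omega>" "\<lambda>k. 1 - state t \<omega> k"]
    by simp
qed

lemma T_procedure_alpha: "T \<in> procedures_alpha M \<mu> K X \<tau> \<alpha>"
  unfolding procedures_alpha_def
proof (intro CollectI conjI T_procedure allI impI)
  fix t :: nat assume t: "1 \<le> t"
  show "AE \<omega> in M. LFNR M \<mu> X \<tau> T t \<omega> \<le> \<alpha>"
    using LFNR_le_iff_feasible[OF T_procedure t \<alpha>] T_greedy_state[OF t]
    by eventually_elim (simp add: greedy_def feasible_def)
qed

lemma procedure_alpha_feasible:
  assumes "S \<in> procedures_alpha M \<mu> K X \<tau> \<alpha>" "1 \<le> t"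
  shows "AE \<omega> in M. feasible \<alpha> (S (Suc t) \<omega>) (state t \<omega>)"
proof -
  have "S \<in> procedures M \<mu> K X" "AE \<omega> in M. LFNR M \<mu> X \<tau> S t \<omega> \<le> \<alpha>"
    using assms unfolding procedures_alpha_def by auto
  from LFNR_le_iff_feasible[OF this(1) assms(2) \<alpha>] this(2) show ?thesis by eventually_elim simp
qed

end

end

section \<open>Optimality of the greedy procedure\<close>

context change_model
begin

lemma state_0: "state 0 \<omega> = (\<lambda>_. 1)"
  by (auto simp: state_def)

text \<open>Reduces a random active set to fixed sets \<open>A\<close>, for which measurability and
  the Markov property are available.\<close>

lemma nn_integral_active:
  assumes S: "S \<in> procedures M \<mu> K X" and [measurable]: "\<And>A. A \<subseteq> {..<K} \<Longrightarrow> g A \<in> borel_measurable M"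
  shows "(\<integral>\<^sup>+\<omega>. g (S (Suc n) \<omega>) \<omega> \<partial>M)
    = (\<Sum>A\<in>Pow {..<K}. \<integral>\<^sup>+\<omega>. indicator {\<omega> \<in> space M. S (Suc n) \<omega> = A} \<omega> * g A \<omega> \<partial>M)"
proof -
  have m: "{\<omega> \<in> space M. S (Suc n) \<omega> = A} \<in> sets M" for A
    using active_predictable[OF S] subalgebra_filt[OF S] unfolding subalgebra_def by blast
  have "(\<integral>\<^sup>+\<omega>. g (S (Suc n) \<omega>) \<omega> \<partial>M)
      = (\<integral>\<^sup>+\<omega>. (\<Sum>A\<in>Pow {..<K}. indicator {\<omega> \<in> space M. S (Suc n) \<omega> = A} \<omega> * g A \<omega>) \<partial>M)"
  proof (rule nn_integral_cong)
    fix \<omega> assume \<omega>: "\<omega> \<in> space M"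
    have "(\<Sum>A\<in>Pow {..<K}. indicator {\<omega> \<in> space M. S (Suc n) \<omega> = A} \<omega> * g A \<omega>)
        = (\<Sum>A\<in>Pow {..<K}. if A = S (Suc n) \<omega> then g A \<omega> else 0)"
      using \<omega> by (intro sum.cong) (auto simp: indicator_def)
    also have "\<dots> = g (S (Suc n) \<omega>) \<omega>" using active_sub[OF S \<omega>, of n] by (subst sum.delta) auto
    finally show "g (S (Suc n) \<omega>) \<omega> = (\<Sum>A\<in>Pow {..<K}. indicator {\<omega> \<in> space M. S (Suc n) \<omega> = A} \<omega> * g A \<omega>)" ..
  qed
  also have "\<dots> = (\<Sum>A\<in>Pow {..<K}. \<integral>\<^sup>+\<omega>. indicator {\<omega> \<in> space M. S (Suc n) \<omega> = A} \<omega> * g A \<omega> \<partial>M)"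
  proof (rule nn_integral_sum)
    fix A assume A: "A \<in> Pow {..<K}"
    then have [measurable]: "g A \<in> borel_measurable M" by simp
    note m[of A, measurable]
    show "(\<lambda>\<omega>. indicator {\<omega> \<in> space M. S (Suc n) \<omega> = A} \<omega> * g A \<omega>) \<in> borel_measurable M" by measurable
  qed
  finally show ?thesis .
qed

section \<open>Comparison of procedures through the programme\<close>

context
  fixes \<alpha> :: real and c :: "real \<Rightarrow> ennreal"
  assumes \<alpha>: "0 < \<alpha>"
    and c: "\<And>x x'. 0 \<le> x \<Longrightarrow> x \<le> x' \<Longrightarrow> x' \<le> 1 \<Longrightarrow> c x \<le> c x'" "c 1 < \<infinity>"
    and mc: "c \<in> borel_measurable borel"
begin

text \<open>The value after the new observations have come in and before the next active set is
  chosen.\<close>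

definition best :: "nat \<Rightarrow> nat set \<Rightarrow> (nat \<Rightarrow> real) \<Rightarrow> ennreal" where
  "best h A w = (SUP B\<in>Pow A. if feasible \<alpha> B w then reward K \<alpha> c h B w else 0)"

text \<open>\<open>S\<close> decides up to the active set for time \<open>Suc n\<close>; the
  remaining \<open>h\<close> updates are optimal. Keeping \<open>n + h\<close> fixed, this
  interpolates between the optimum of the programme at \<open>n = 0\<close> and the actual reward of
  \<open>S\<close> at \<open>h = 0\<close>.\<close>

definition val :: "(nat \<Rightarrow> 'w \<Rightarrow> nat set) \<Rightarrow> nat \<Rightarrow> nat \<Rightarrow> ennreal" where
  "val S n h = (\<integral>\<^sup>+\<omega>. reward K \<alpha> c h (S (Suc n) \<omega>) (state n \<omega>) \<partial>M)"

lemma measurable_best: "finite A \<Longrightarrow> best h A \<in> borel_measurable reals"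
  unfolding best_def by (intro measurable_choice measurable_reward[OF mc]) (auto intro: finite_subset)

text \<open>The active set for time \<open>Suc n\<close> is known at time \<open>n\<close>, so the
  Markov property applies on each event that fixes it.\<close>

lemma val_Suc:
  assumes S: "S \<in> procedures M \<mu> K X"
  shows "val S n (Suc h) = (\<integral>\<^sup>+\<omega>. best h (S (Suc n) \<omega>) (state (Suc n) \<omega>) \<partial>M)"
proof -
  have fin: "finite A" if "A \<subseteq> {..<K}" for A using that by (rule finite_subset) simp
  have eq: "reward K \<alpha> c (Suc h) = (\<lambda>A. foldr step [0..<K] (best h A))"
    unfolding reward.simps best_def[abs_def] ..
  have "val S n (Suc h) = (\<Sum>A\<in>Pow {..<K}. \<integral>\<^sup>+\<omega>. indicator {\<omega> \<in> space M. S (Suc n) \<omega> = A} \<omega> * reward K \<alpha> c (Suc h) A (state n \<omega>) \<partial>M)"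
    unfolding val_def
    by (rule nn_integral_active[OF S]) (use measurable_compose[OF measurable_state measurable_reward[OF mc fin]] in blast)
  also have "\<dots> = (\<Sum>A\<in>Pow {..<K}. \<integral>\<^sup>+\<omega>. indicator {\<omega> \<in> space M. S (Suc n) \<omega> = A} \<omega> * foldr step [0..<K] (best h A) (state n \<omega>) \<partial>M)"
    unfolding eq ..
  also have "\<dots> = (\<Sum>A\<in>Pow {..<K}. \<integral>\<^sup>+\<omega>. indicator {\<omega> \<in> space M. S (Suc n) \<omega> = A} \<omega> * best h A (state (Suc n) \<omega>) \<partial>M)"
  proof (rule sum.cong[OF refl])
    fix A assume "A \<in> Pow {..<K}"
    then have "best h A \<in> borel_measurable reals" using fin by (intro measurable_best) auto
    moreover have "{\<omega> \<in> space M. S (Suc n) \<omega> = A} \<in> sets (joint n)"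
      using active_predictable[OF S] filt_sub_joint[OF S] by blast
    ultimately show "(\<integral>\<^sup>+\<omega>. indicator {\<omega> \<in> space M. S (Suc n) \<omega> = A} \<omega> * foldr step [0..<K] (best h A) (state n \<omega>) \<partial>M)
        = (\<integral>\<^sup>+\<omega>. indicator {\<omega> \<in> space M. S (Suc n) \<omega> = A} \<omega> * best h A (state (Suc n) \<omega>) \<partial>M)"
      using state_transition[of "best h A" "{\<omega> \<in> space M. S (Suc n) \<omega> = A}" n] by simp
  qed
  also have "\<dots> = (\<integral>\<^sup>+\<omega>. best h (S (Suc n) \<omega>) (state (Suc n) \<omega>) \<partial>M)"
    by (rule nn_integral_active[OF S, symmetric]) (use measurable_compose[OF measurable_state measurable_best[OF fin]] in blast)
  finally show ?thesis .
qed

lemma val_0: "S \<in> procedures M \<mu> K X \<Longrightarrow> val S 0 h = reward K \<alpha> c h {..<K} (\<lambda>_. 1)"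
  unfolding val_def
  by (subst nn_integral_cong[of M _ "\<lambda>_. reward K \<alpha> c h {..<K} (\<lambda>_. 1)"]) (simp_all add: active_first state_0 emeasure_space_1)

text \<open>Handing one more decision to \<open>S\<close> cannot raise the value, because its choice
  is almost surely feasible and so a competitor in \<open>best\<close>.\<close>

lemma val_le:
  assumes "S \<in> procedures_alpha M \<mu> K X \<tau> \<alpha>"
  shows "val S n h \<le> val S 0 (n + h)"
proof (induction n arbitrary: h)
  case (Suc n)
  have S: "S \<in> procedures M \<mu> K X" using assms by (simp add: procedures_alpha_def)
  have "AE \<omega> in M. reward K \<alpha> c h (S (Suc (Suc n)) \<omega>) (state (Suc n) \<omega>) \<le> best h (S (Suc n) \<omega>) (state (Suc n) \<omega>)"
    using procedure_alpha_feasible[OF \<alpha> assms, of "Suc n", simplified] AE_space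
  proof eventually_elim
    case (elim \<omega>)
    then have "S (Suc (Suc n)) \<omega> \<in> Pow (S (Suc n) \<omega>)" using active_antimono[OF S, of "Suc n" \<omega>] by simp
    then show ?case unfolding best_def by (rule SUP_upper2) (use elim in simp)
  qed
  then have "val S (Suc n) h \<le> val S n (Suc h)"
    unfolding val_Suc[OF S] by (subst val_def) (rule nn_integral_mono_AE)
  also have "\<dots> \<le> val S 0 (n + Suc h)" by (rule Suc.IH)
  finally show ?case by simp
qed simp

text \<open>For the greedy procedure handing over a decision costs nothing: by
  \<open>reward_exchange\<close> its choice does at least as well as every feasible
  \<open>B\<close>.\<close>

lemma val_T: "val (T \<alpha>) n h = val (T \<alpha>) 0 (n + h)"
proof (induction n arbitrary: h)
  case (Suc n)
  have "AE \<omega> in M. best h (T \<alpha> (Suc n) \<omega>) (state (Suc n) \<omega>) \<le> reward K \<alpha> c h (T \<alpha> (Suc (Suc n)) \<omega>) (state (Suc n) \<omega>)"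
    using T_greedy_state[OF \<alpha>, of "Suc n", simplified]
  proof eventually_elim
    case (elim \<omega>)
    have sub: "T \<alpha> (Suc n) \<omega> \<subseteq> {..<K}" "T \<alpha> (Suc (Suc n)) \<omega> \<subseteq> {..<K}" using finite_T[OF \<alpha>] by auto
    have "reward K \<alpha> c h B (state (Suc n) \<omega>) \<le> reward K \<alpha> c h (T \<alpha> (Suc (Suc n)) \<omega>) (state (Suc n) \<omega>)"
      if B: "B \<subseteq> T \<alpha> (Suc n) \<omega>" "feasible \<alpha> B (state (Suc n) \<omega>)" for B
    proof (rule reward_exchange[OF c mc in_unit_state])
      show "card B \<le> card (T \<alpha> (Suc (Suc n)) \<omega>)" using elim B unfolding greedy_def feasible_def by blast
      show "state (Suc n) \<omega> x \<le> state (Suc n) \<omega> b" if "b \<in> T \<alpha> (Suc (Suc n)) \<omega>" "x \<in> B - T \<alpha> (Suc (Suc n)) \<omega>" for b x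
      proof -
        have "rank_less (\<lambda>k. 1 - state (Suc n) \<omega> k) b x" using elim B that unfolding greedy_def by blast
        then show ?thesis by auto
      qed
    qed (use B sub in auto)
    then show ?case unfolding best_def by (intro SUP_least) auto
  qed
  then have "val (T \<alpha>) n (Suc h) \<le> val (T \<alpha>) (Suc n) h"
    unfolding val_Suc[OF T_procedure[OF \<alpha>]] by (subst val_def) (rule nn_integral_mono_AE)
  then have "val (T \<alpha>) 0 (Suc n + h) \<le> val (T \<alpha>) (Suc n) h" using Suc.IH[of "Suc h"] by simp
  then show ?case using val_le[OF T_procedure_alpha[OF \<alpha>], of "Suc n" h] by (rule antisym[rotated])
qed simp

lemma val_optimal:
  assumes "S \<in> procedures_alpha M \<mu> K X \<tau> \<alpha>"
  shows "val S n 0 \<le> val (T \<alpha>) n 0"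
proof -
  have "S \<in> procedures M \<mu> K X" using assms by (simp add: procedures_alpha_def)
  then show ?thesis using val_le[OF assms, of n 0] val_T[of n 0] val_0 T_procedure[OF \<alpha>] by simp
qed

lemma val_eq_sum:
  assumes S: "S \<in> procedures M \<mu> K X"
  shows "val S n 0 = (\<Sum>k<K. \<integral>\<^sup>+\<omega>. indicator {\<omega> \<in> space M. k \<in> S (Suc n) \<omega>} \<omega> * c (surv k n \<omega>) \<partial>M)"
proof -
  have m [measurable]: "{\<omega> \<in> space M. k \<in> S (Suc n) \<omega>} \<in> sets M" for k
    using active_mem[OF S] subalgebra_filt[OF S] unfolding subalgebra_def by blast
  note [measurable] = mc
  have "val S n 0 = (\<integral>\<^sup>+\<omega>. (\<Sum>k<K. indicator {\<omega> \<in> space M. k \<in> S (Suc n) \<omega>} \<omega> * c (surv k n \<omega>)) \<partial>M)"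
    unfolding val_def
  proof (rule nn_integral_cong)
    fix \<omega> assume \<omega>: "\<omega> \<in> space M"
    show "reward K \<alpha> c 0 (S (Suc n) \<omega>) (state n \<omega>) = (\<Sum>k<K. indicator {\<omega> \<in> space M. k \<in> S (Suc n) \<omega>} \<omega> * c (surv k n \<omega>))"
      using active_sub[OF S \<omega>, of n] \<omega> unfolding reward.simps
      by (intro sum.mono_neutral_cong_left) (auto simp: state_def)
  qed
  also have "\<dots> = (\<Sum>k<K. \<integral>\<^sup>+\<omega>. indicator {\<omega> \<in> space M. k \<in> S (Suc n) \<omega>} \<omega> * c (surv k n \<omega>) \<partial>M)"
    by (rule nn_integral_sum) measurable
  finally show ?thesis .
qed

end

section \<open>Both criteria as sums of rewards\<close>

text \<open>The source of the reward for the run length. Averaged over the next observation, the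
  posterior at \<open>Suc n\<close> returns to its prior \<open>(1 - \<theta>) * surv k n\<close>,
  and being active at \<open>Suc n\<close> is an event of \<open>past k n\<close>.\<close>

lemma active_surviving:
  assumes S: "S \<in> procedures M \<mu> K X" and k: "k < K"
  shows "(\<integral>\<^sup>+\<omega>. indicator {\<omega> \<in> space M. k \<in> S (Suc n) \<omega>} \<omega> * ennreal ((1 - \<theta>) * surv k n \<omega>) \<partial>M)
    = emeasure M {\<omega> \<in> space M. k \<in> S (Suc n) \<omega> \<and> enat (Suc n) \<le> \<tau> k \<omega>}"
proof -
  define E where "E = {\<omega> \<in> space M. k \<in> S (Suc n) \<omega>}"
  have E: "E \<in> sets (obs (past k n))"
    using active_mem[OF S] filt_sub_joint[OF S] joint_sub_past[OF k] unfolding E_def by blast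
  moreover have "sets (obs (past k n)) \<subseteq> sets (obs (past k (Suc n)))"
    by (rule sets_obs_mono) (auto simp: past_def)
  ultimately have E': "E \<in> sets (obs (past k (Suc n)))" by blast
  then have [measurable]: "E \<in> sets M" using sets_obs_sub by blast
  have mean: "(\<integral>\<^sup>+y. ennreal (refresh v y) * ennreal (pred_dens v y) \<partial>\<nu>) = ennreal ((1 - \<theta>) * v)" if v: "0 \<le> v" "v \<le> 1" for v
  proof -
    have "ennreal (refresh v y) * ennreal (pred_dens v y) = ennreal ((1 - \<theta>) * v) * ennreal (a y)" for y
      using refresh_times_pred_dens[OF v, of y] refresh_nonneg[OF v] prior_bounds(1)[OF v]
      by (simp add: ennreal_mult'[symmetric])
    then show ?thesis by (simp add: nn_integral_cmult int_a)
  qed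
  have "emeasure M {\<omega> \<in> space M. k \<in> S (Suc n) \<omega> \<and> enat (Suc n) \<le> \<tau> k \<omega>} = emeasure M (E \<inter> {\<omega> \<in> space M. enat (Suc n) \<le> \<tau> k \<omega>})"
    by (intro arg_cong2[where f = emeasure]) (auto simp: E_def)
  also have "\<dots> = (\<integral>\<^sup>+\<omega>. indicator E \<omega> * indicator {\<omega> \<in> space M. enat (Suc n) \<le> \<tau> k \<omega>} \<omega> \<partial>M)"
    by (subst indicator_inter_arith[symmetric]) simp
  also have "\<dots> = (\<integral>\<^sup>+\<omega>. indicator E \<omega> * ennreal (surv k (Suc n) \<omega>) \<partial>M)"
    using posterior[OF k, of "Suc n"] E' unfolding is_posterior_def by (auto intro: borel_measurable_indicator)
  also have "\<dots> = (\<integral>\<^sup>+\<omega>. \<integral>\<^sup>+y. indicator E \<omega> * ennreal (refresh (surv k n \<omega>) y) * ennreal (pred_dens (surv k n \<omega>) y) \<partial>\<nu> \<partial>M)"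
  proof -
    note [measurable] = E measurable_surv_past[OF k, of n]
    have [measurable]: "snd \<in> measurable (obs (past k n) \<Otimes>\<^sub>M \<mu>) \<nu>" by measurable
    have "(\<lambda>(\<omega>, y). indicator E \<omega> * ennreal (refresh (surv k n \<omega>) y)) \<in> borel_measurable (obs (past k n) \<Otimes>\<^sub>M \<mu>)"
      by measurable
    from next_observation[OF k posterior[OF k] this] show ?thesis by simp
  qed
  also have "\<dots> = (\<integral>\<^sup>+\<omega>. indicator E \<omega> * ennreal ((1 - \<theta>) * surv k n \<omega>) \<partial>M)"
    by (simp add: mult.assoc nn_integral_cmult mean surv_bounds)
  finally show ?thesis unfolding E_def ..
qed

text \<open>Presence at a later time implies presence at all earlier ones. The argument also covers
  an infinite stopping time, where the supremum is not attained.\<close>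

lemma le_stop_time_iff:
  assumes S: "S \<in> procedures M \<mu> K X" and \<omega>: "\<omega> \<in> space M"
  shows "enat (Suc n) \<le> stop_time S k \<omega> \<longleftrightarrow> k \<in> S (Suc n) \<omega>"
proof
  assume "k \<in> S (Suc n) \<omega>"
  then show "enat (Suc n) \<le> stop_time S k \<omega>" unfolding stop_time_def by (intro Sup_upper) auto
next
  assume le: "enat (Suc n) \<le> stop_time S k \<omega>"
  have "\<exists>s. n < s \<and> k \<in> S s \<omega>"
  proof (rule ccontr)
    assume "\<nexists>s. n < s \<and> k \<in> S s \<omega>"
    then have "stop_time S k \<omega> \<le> enat n" unfolding stop_time_def by (intro Sup_least) (auto simp: not_less)
    then have "enat (Suc n) \<le> enat n" using le by (rule order_trans[rotated])
    then show False by simp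
  qed
  then obtain s where s: "Suc n \<le> s" "k \<in> S s \<omega>" by (auto simp: Suc_le_eq)
  from s(1) have "S s \<omega> \<subseteq> S (Suc n) \<omega>"
  proof (induction s rule: dec_induct)
    case (step s)
    then show ?case using active_antimono[OF S, of s \<omega>] \<omega> by auto
  qed simp
  then show "k \<in> S (Suc n) \<omega>" using s(2) by blast
qed

text \<open>The minimum counts the \<open>n < t\<close> for which \<open>Suc n\<close> is at most
  both the stopping time and the change point.\<close>

lemma RL_eq_sum:
  assumes S: "S \<in> procedures M \<mu> K X" and \<omega>: "\<omega> \<in> space M"
  shows "RL K \<tau> S t \<omega> = (\<Sum>n<t. \<Sum>k<K. indicator {\<omega> \<in> space M. k \<in> S (Suc n) \<omega> \<and> enat (Suc n) \<le> \<tau> k \<omega>} \<omega>)"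
proof -
  have "real (the_enat (min (min (stop_time S k \<omega>) (\<tau> k \<omega>)) (enat t)))
      = (\<Sum>n<t. indicator {\<omega> \<in> space M. k \<in> S (Suc n) \<omega> \<and> enat (Suc n) \<le> \<tau> k \<omega>} \<omega>)" for k
  proof -
    have "min (min (stop_time S k \<omega>) (\<tau> k \<omega>)) (enat t) \<le> enat t" by simp
    then obtain m where m: "min (min (stop_time S k \<omega>) (\<tau> k \<omega>)) (enat t) = enat m" by (metis enat_ile)
    have iff: "k \<in> S (Suc n) \<omega> \<and> enat (Suc n) \<le> \<tau> k \<omega> \<longleftrightarrow> n < m" if "n < t" for n
    proof -
      have "enat (Suc n) \<le> enat t" using that by simp
      then have "k \<in> S (Suc n) \<omega> \<and> enat (Suc n) \<le> \<tau> k \<omega> \<longleftrightarrow> enat (Suc n) \<le> min (min (stop_time S k \<omega>) (\<tau> k \<omega>)) (enat t)"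
        unfolding min.bounded_iff le_stop_time_iff[OF S \<omega>] by simp
      then show ?thesis unfolding m by (simp add: Suc_le_eq)
    qed
    have "m \<le> t" using \<open>min (min (stop_time S k \<omega>) (\<tau> k \<omega>)) (enat t) \<le> enat t\<close> m by simp
    have "(\<Sum>n<t. indicator {\<omega> \<in> space M. k \<in> S (Suc n) \<omega> \<and> enat (Suc n) \<le> \<tau> k \<omega>} \<omega>) = (\<Sum>n<t. if n < m then 1 else (0::real))"
      using iff \<omega> by (intro sum.cong) (auto simp: indicator_def)
    also have "\<dots> = (\<Sum>n<m. 1)"
      using \<open>m \<le> t\<close> by (intro sum.mono_neutral_cong_right) auto
    finally show ?thesis by (simp add: m)
  qed
  then show ?thesis unfolding RL_def by (subst sum.swap) simp
qed

context
  fixes S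
  assumes S: "S \<in> procedures M \<mu> K X"
begin

lemma active_mem_M [measurable]: "{\<omega> \<in> space M. k \<in> S (Suc n) \<omega>} \<in> sets M"
  using active_mem[OF S] subalgebra_filt[OF S] unfolding subalgebra_def by blast

lemma active_surviving_M: "{\<omega> \<in> space M. k \<in> S (Suc n) \<omega> \<and> enat (Suc n) \<le> \<tau> k \<omega>} \<in> sets M"
proof -
  have "{\<omega> \<in> space M. k \<in> S (Suc n) \<omega> \<and> enat (Suc n) \<le> \<tau> k \<omega>} = {\<omega> \<in> space M. k \<in> S (Suc n) \<omega>} \<inter> {\<omega> \<in> space M. enat (Suc n) \<le> \<tau> k \<omega>}"
    by auto
  also have "\<dots> \<in> sets M" by measurable
  finally show ?thesis .
qed

lemma integral_RL:
  "(\<integral>\<omega>. RL K \<tau> S t \<omega> \<partial>M) = (\<Sum>n<t. \<Sum>k<K. measure M {\<omega> \<in> space M. k \<in> S (Suc n) \<omega> \<and> enat (Suc n) \<le> \<tau> k \<omega>})"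
proof -
  let ?E = "\<lambda>n k. {\<omega> \<in> space M. k \<in> S (Suc n) \<omega> \<and> enat (Suc n) \<le> \<tau> k \<omega>}"
  note [measurable] = active_surviving_M
  have int: "integrable M (indicator (?E n k) :: 'w \<Rightarrow> real)" for n k
    by (rule integrable_unit_bounded) (auto simp: indicator_def)
  have "(\<integral>\<omega>. RL K \<tau> S t \<omega> \<partial>M) = (\<integral>\<omega>. (\<Sum>n<t. \<Sum>k<K. indicator (?E n k) \<omega>) \<partial>M)"
    by (rule Bochner_Integration.integral_cong[OF refl]) (rule RL_eq_sum[OF S])
  also have "\<dots> = (\<Sum>n<t. \<integral>\<omega>. (\<Sum>k<K. indicator (?E n k) \<omega>) \<partial>M)"
    by (intro Bochner_Integration.integral_sum Bochner_Integration.integrable_sum int)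
  also have "\<dots> = (\<Sum>n<t. \<Sum>k<K. \<integral>\<omega>. indicator (?E n k) \<omega> \<partial>M)"
    by (intro sum.cong refl Bochner_Integration.integral_sum int)
  also have "\<dots> = (\<Sum>n<t. \<Sum>k<K. measure M (?E n k))"
    by (intro sum.cong refl) (auto intro!: arg_cong2[where f = measure])
  finally show ?thesis .
qed

lemma integral_CD:
  "(\<integral>\<omega>. CD K S (Suc n) \<omega> \<partial>M) = real K - (\<Sum>k<K. measure M {\<omega> \<in> space M. k \<in> S (Suc n) \<omega>})"
proof -
  let ?E = "\<lambda>k. {\<omega> \<in> space M. k \<in> S (Suc n) \<omega>}"
  have int: "integrable M (indicator (?E k) :: 'w \<Rightarrow> real)" for k
    by (rule integrable_unit_bounded) (auto simp: indicator_def)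
  have "real (card (S (Suc n) \<omega>)) = (\<Sum>k<K. indicator (?E k) \<omega>)" if "\<omega> \<in> space M" for \<omega>
  proof -
    have "(\<Sum>k<K. indicator (?E k) \<omega>) = (\<Sum>k\<in>S (Suc n) \<omega>. 1::real)"
      using active_sub[OF S that, of n] that by (intro sum.mono_neutral_cong_right) (auto simp: indicator_def)
    then show ?thesis by simp
  qed
  then have "(\<integral>\<omega>. CD K S (Suc n) \<omega> \<partial>M) = (\<integral>\<omega>. real K - (\<Sum>k<K. indicator (?E k) \<omega>) \<partial>M)"
    unfolding CD_def by (intro Bochner_Integration.integral_cong) auto
  also have "\<dots> = (\<integral>\<omega>. real K \<partial>M) - (\<integral>\<omega>. (\<Sum>k<K. indicator (?E k) \<omega>) \<partial>M)"
    by (intro Bochner_Integration.integral_diff Bochner_Integration.integrable_sum int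
      finite_measure.integrable_const[OF prob_space.axioms(1)[OF prob_space_axioms]])
  also have "(\<integral>\<omega>. (\<Sum>k<K. indicator (?E k) \<omega>) \<partial>M) = (\<Sum>k<K. \<integral>\<omega>. indicator (?E k) \<omega> \<partial>M :: real)"
    by (intro Bochner_Integration.integral_sum int)
  also have "\<dots> = (\<Sum>k<K. measure M (?E k))"
    by (intro sum.cong refl) (auto intro!: arg_cong2[where f = measure])
  finally show ?thesis by (simp add: prob_space)
qed

end

lemma emeasure_M: "emeasure M A = ennreal (measure M A)"
  by (rule finite_measure.emeasure_eq_measure[OF prob_space.axioms(1)[OF prob_space_axioms]])

lemma active_count_optimal:
  assumes \<alpha>: "0 < \<alpha>" and Sa: "S \<in> procedures_alpha M \<mu> K X \<tau> \<alpha>"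
  shows "(\<Sum>k<K. measure M {\<omega> \<in> space M. k \<in> S (Suc n) \<omega>}) \<le> (\<Sum>k<K. measure M {\<omega> \<in> space M. k \<in> T \<alpha> (Suc n) \<omega>})"
proof -
  have eq: "val \<alpha> (\<lambda>_. 1) S n 0 = ennreal (\<Sum>k<K. measure M {\<omega> \<in> space M. k \<in> S (Suc n) \<omega>})"
    if S: "S \<in> procedures M \<mu> K X" for S
    using active_mem_M[OF S] by (simp add: val_eq_sum[OF \<alpha> _ _ _ S] emeasure_M)
  have "S \<in> procedures M \<mu> K X" using Sa by (simp add: procedures_alpha_def)
  moreover have "val \<alpha> (\<lambda>_. 1) S n 0 \<le> val \<alpha> (\<lambda>_. 1) (T \<alpha>) n 0"
    by (rule val_optimal[OF \<alpha> _ _ _ Sa]) auto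
  ultimately show ?thesis using T_procedure[OF \<alpha>] by (simp add: eq ennreal_le_iff sum_nonneg)
qed

lemma active_surviving_optimal:
  assumes \<alpha>: "0 < \<alpha>" and Sa: "S \<in> procedures_alpha M \<mu> K X \<tau> \<alpha>"
  shows "(\<Sum>k<K. measure M {\<omega> \<in> space M. k \<in> S (Suc n) \<omega> \<and> enat (Suc n) \<le> \<tau> k \<omega>})
    \<le> (\<Sum>k<K. measure M {\<omega> \<in> space M. k \<in> T \<alpha> (Suc n) \<omega> \<and> enat (Suc n) \<le> \<tau> k \<omega>})"
proof -
  let ?c = "\<lambda>v. ennreal ((1 - \<theta>) * v)"
  have c: "?c x \<le> ?c x'" if "0 \<le> x" "x \<le> x'" "x' \<le> 1" for x x'
    using that theta_less_1 by (intro ennreal_leI mult_left_mono) auto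
  have eq: "val \<alpha> ?c S n 0 = ennreal (\<Sum>k<K. measure M {\<omega> \<in> space M. k \<in> S (Suc n) \<omega> \<and> enat (Suc n) \<le> \<tau> k \<omega>})"
    if S: "S \<in> procedures M \<mu> K X" for S
    using c by (simp add: val_eq_sum[OF \<alpha> _ _ _ S] active_surviving[OF S] emeasure_M)
  have "S \<in> procedures M \<mu> K X" using Sa by (simp add: procedures_alpha_def)
  moreover have "val \<alpha> ?c S n 0 \<le> val \<alpha> ?c (T \<alpha>) n 0"
    by (rule val_optimal[OF \<alpha> c _ _ Sa]) auto
  ultimately show ?thesis using T_procedure[OF \<alpha>] by (simp add: eq ennreal_le_iff sum_nonneg)
qed

end

theorem theorem4:
  fixes M :: "'w measure" and \<mu> :: "'a measure" and K :: nat and \<theta> \<alpha> :: real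
    and p q :: "'a \<Rightarrow> real" and \<tau> :: "nat \<Rightarrow> 'w \<Rightarrow> enat" and X :: "nat \<Rightarrow> nat \<Rightarrow> 'w \<Rightarrow> 'a"
  assumes "1 \<le> K"
    and "model_s M K \<theta> \<mu> p q \<tau> X"
    and "0 < \<alpha>" and "\<alpha> \<le> 1"
    and "1 \<le> t"
  shows "(\<integral>\<omega>. RL K \<tau> (tstar M \<mu> K X \<tau> \<alpha>) t \<omega> \<partial>M)
           = (SUP S \<in> procedures_alpha M \<mu> K X \<tau> \<alpha>. \<integral>\<omega>. RL K \<tau> S t \<omega> \<partial>M)
       \<and> (\<integral>\<omega>. CD K (tstar M \<mu> K X \<tau> \<alpha>) t \<omega> \<partial>M)
           = (INF S \<in> procedures_alpha M \<mu> K X \<tau> \<alpha>. \<integral>\<omega>. CD K S t \<omega> \<partial>M)"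
proof -
  have "prob_space M" using assms(2) by (simp add: model_s_def)
  then interpret change_model M K \<theta> \<mu> p q \<tau> X
    using assms(2) by (simp add: change_model_def change_model_axioms_def)
  let ?P = "procedures_alpha M \<mu> K X \<tau> \<alpha>"
  obtain n where t: "t = Suc n" using assms(5) by (cases t) auto
  have T: "T \<alpha> \<in> ?P" by (rule T_procedure_alpha[OF assms(3)])
  have P: "S \<in> procedures M \<mu> K X" if "S \<in> ?P" for S using that by (simp add: procedures_alpha_def)
  \<comment> \<open>All summands over time are maximised by the same procedure, so the supremum is
    an attained maximum.\<close>
  have "(SUP S \<in> ?P. \<integral>\<omega>. RL K \<tau> S t \<omega> \<partial>M) = (\<integral>\<omega>. RL K \<tau> (T \<alpha>) t \<omega> \<partial>M)"
  proof (rule cSup_eq_maximum)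
    show "x \<le> (\<integral>\<omega>. RL K \<tau> (T \<alpha>) t \<omega> \<partial>M)" if "x \<in> (\<lambda>S. \<integral>\<omega>. RL K \<tau> S t \<omega> \<partial>M) ` ?P" for x
      using that T by (auto simp: integral_RL P intro!: sum_mono active_surviving_optimal[OF assms(3)])
  qed (use T in blast)
  moreover have "(INF S \<in> ?P. \<integral>\<omega>. CD K S t \<omega> \<partial>M) = (\<integral>\<omega>. CD K (T \<alpha>) t \<omega> \<partial>M)"
  proof (rule cInf_eq_minimum)
    show "(\<integral>\<omega>. CD K (T \<alpha>) t \<omega> \<partial>M) \<le> x" if "x \<in> (\<lambda>S. \<integral>\<omega>. CD K S t \<omega> \<partial>M) ` ?P" for x
      using that T unfolding t by (auto simp: integral_CD P intro!: active_count_optimal[OF assms(3)])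
  qed (use T in blast)
  ultimately show ?thesis by simp
qed

end
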